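(* Let $\mathcal A$ be a Möbius covariant net on two-dimensional Minkowski space, with chiral components $\mathcal A_L,\mathcal A_R$, and let $I,J\subset\mathbb R$ be bounded open intervals. Then $$\mathcal H^{\mathrm{out}}=\mathcal H^{\mathrm{in}}=\overline{\bigl(\mathcal A_L(I)\vee\mathcal A_R(J)\bigr)\Omega}.$$
   Context: **Poincaré covariant net.** Points of $\mathbb R^2$ are $(a_0,a_1)$ ($a_0$ time). A (local) Poincaré covariant net $\mathcal A$ assigns to each open bounded $O\subset\mathbb R^2$ a von Neumann algebra $\mathcal A(O)$ on a common separable Hilbert space $\mathcal H$ such that: (1) $O_1\subset O_2\Rightarrow\mathcal A(O_1)\subset\mathcal A(O_2)$; (2) $[\mathcal A(O_1),\mathcal A(O_2)]=0$ if $O_1,O_2$ are spacelike separated; (3) $O=\bigcup_iO_i\Rightarrow\mathcal A(O)=\bigvee_i\mathcal A(O_i)$; (4) there is a strongly continuous unitary representation $U$ of the proper orthochronous Poincaré group $\mathcal P_+^\uparrow$ with $U(g)\mathcal A(O)U(g)^*=\mathcal A(gO)$; (5) the joint spectrum of translations in $U$ lies in $\{(p_0,p_1):p_0+p_1\ge0,\ p_0-p_1\ge0\}$; (6) there is a unique (up to phase) unit vector $\Omega\in\mathcal H$ invariant under $U$, and it is cyclic for $\bigvee_O\mathcal A(O)$. **Möbius covariant net.** Write $\mathbb R^2=L_+\times L_-$ with $L_\pm=\{a_0\pm a_1=0\}$ (parametrized by $a_0-a_1$ on $L_+$ and $a_0+a_1$ on $L_-$); double cones are products $I\times J$ of bounded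 open intervals $I\subset L_+$, $J\subset L_-$. $PSL(2,\mathbb R)$ acts on $\mathbb R\cup\{\infty\}$ by fractional linear maps, hence $\widetilde G_L\times\widetilde G_R$, with $\widetilde G_L,\widetilde G_R$ copies of the universal cover $\overline{PSL(2,\mathbb R)}$ ($\widetilde G_L$ acting on $L_+$, $\widetilde G_R$ on $L_-$), acts locally on $\mathbb R^2$; it contains $\mathcal P_+^\uparrow$ and the dilations. $\mathcal A$ is Möbius covariant if $U$ extends to a unitary representation of this group such that for each $O$ there is a neighborhood $\mathcal U$ of the unit with $gO\subset\mathbb R^2$ and $U(g)\mathcal A(O)U(g)^*=\mathcal A(gO)$ for $g\in\mathcal U$. **Chiral components.** $\mathcal A_L(I)=\mathcal A(I\times J)\cap U(\widetilde G_R)'$ and $\mathcal A_R(J)=\mathcal A(I\times J)\cap U(\widetilde G_L)'$; these are independent of the choice of $J$, resp. $I$. **Waves and collision states.** $T(a)$ is the representative of translation by $a\in\mathbb R^2$, $T_\pm(t)=T(t,\pm t)$, $\mathcal H_\pm=\{\xi\in\mathcal H:T_\pm(t)\xi=\xi\ \forall t\}$, $P_\pm$ the projection onto $\mathcal H_\pm$. A local operator is an element $x$ of some $\mathcal A(O)$, $O$ bounded; $x(a)=T(a)xT(a)^*$. Fix $0<\varepsilon<1$ and a nonnegative symmetric smooth $h$ on $\mathbb R$ with $\int h=1$; put $h_{\mathcal T}(t)=|\mathcal T|^{-\varepsilon}h(|\mathcal T|^{-\varepsilon}(t-\mathcal T))$ and $x_\pm(h_{\mathcal T})=\int dt\,h_{\mathcal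 T}(t)\,x(t,\pm t)$. The strong limits $\Phi^{\mathrm{in}}_\pm(x)=\lim_{\mathcal T\to-\infty}x_\pm(h_{\mathcal T})$ and $\Phi^{\mathrm{out}}_\pm(x)=\lim_{\mathcal T\to+\infty}x_\pm(h_{\mathcal T})$ exist (Buchholz) and depend only on $P_\pm x\Omega=\Phi_\pm^{\mathrm{in/out}}(x)\Omega$. For $\xi_\pm\in\mathcal H_\pm$ choose local $x_{\pm,n}$ with $P_\pm x_{\pm,n}\Omega\to\xi_\pm$ and set $\xi_+\overset{\mathrm{in}}\times\xi_-=\lim_n\Phi^{\mathrm{in}}_+(x_{+,n})\Phi^{\mathrm{in}}_-(x_{-,n})\Omega$, and likewise $\xi_+\overset{\mathrm{out}}\times\xi_-$ with $\Phi^{\mathrm{out}}_\pm$. $\mathcal H^{\mathrm{in}}$, $\mathcal H^{\mathrm{out}}$ are the closed subspaces generated by the vectors $\xi_+\overset{\mathrm{in}}\times\xi_-$, resp. $\xi_+\overset{\mathrm{out}}\times\xi_-$ ($\xi_\pm\in\mathcal H_\pm$). *)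

theory Defs
  imports "HOL-Analysis.Analysis"
begin

section \<open>Separable complex Hilbert spaces\<close>

text \<open>The inner product is conjugate-linear in its first argument.
  Positive definiteness is inherited from \<^class>\<open>real_inner\<close>.\<close>

class complex_inner = real_inner +
  fixes scaleC :: "complex \<Rightarrow> 'a \<Rightarrow> 'a" (infixr "*\<^sub>C" 75)
    and cinner :: "'a \<Rightarrow> 'a \<Rightarrow> complex"
  assumes scaleC_add_right: "c *\<^sub>C (x + y) = c *\<^sub>C x + c *\<^sub>C y"
    and scaleC_add_left: "(c + d) *\<^sub>C x = c *\<^sub>C x + d *\<^sub>C x"
    and scaleC_scaleC: "c *\<^sub>C (d *\<^sub>C x) = (c * d) *\<^sub>C x"
    and scaleR_scaleC: "r *\<^sub>R x = complex_of_real r *\<^sub>C x"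
    and cinner_commute: "cinner x y = cnj (cinner y x)"
    and cinner_add_right: "cinner x (y + z) = cinner x y + cinner x z"
    and cinner_scaleC_right: "cinner x (c *\<^sub>C y) = c * cinner x y"
    and inner_eq_Re_cinner: "inner x y = Re (cinner x y)"

class separable_hilbert = complex_inner + banach + second_countable_topology

definition csubspace :: "'h::complex_inner set \<Rightarrow> bool" where
  "csubspace M \<longleftrightarrow> 0 \<in> M \<and> (\<forall>\<xi>\<in>M. \<forall>\<eta>\<in>M. \<xi> + \<eta> \<in> M) \<and> (\<forall>c. \<forall>\<xi>\<in>M. c *\<^sub>C \<xi> \<in> M)"

definition closed_cspan :: "'h::complex_inner set \<Rightarrow> 'h set" where
  "closed_cspan S = \<Inter>{M. csubspace M \<and> closed M \<and> S \<subseteq> M}"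

definition orth_proj :: "'h::complex_inner set \<Rightarrow> 'h \<Rightarrow> 'h" where
  "orth_proj M \<xi> = (THE \<eta>. \<eta> \<in> M \<and> (\<forall>\<zeta>\<in>M. cinner \<zeta> (\<xi> - \<eta>) = 0))"


section \<open>Bounded operators and von Neumann algebras\<close>

text \<open>The library type \<open>'h \<Rightarrow>\<^sub>L 'h\<close> consists of the bounded \<^emph>\<open>real\<close>-linear operators.\<close>

definition clinear_ops :: "('h::complex_inner \<Rightarrow>\<^sub>L 'h) set" where
  "clinear_ops = {x. \<forall>c \<xi>. blinfun_apply x (c *\<^sub>C \<xi>) = c *\<^sub>C blinfun_apply x \<xi>}"

definition adj :: "('h::complex_inner \<Rightarrow>\<^sub>L 'h) \<Rightarrow> ('h \<Rightarrow>\<^sub>L 'h)" where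
  "adj x = (THE y. \<forall>\<xi> \<eta>. cinner (x \<xi>) \<eta> = cinner \<xi> (blinfun_apply y \<eta>))"

definition unitary_op :: "('h::complex_inner \<Rightarrow>\<^sub>L 'h) \<Rightarrow> bool" where
  "unitary_op u \<longleftrightarrow> u \<in> clinear_ops \<and> adj u o\<^sub>L u = id_blinfun \<and> u o\<^sub>L adj u = id_blinfun"

definition commutant :: "('h::complex_inner \<Rightarrow>\<^sub>L 'h) set \<Rightarrow> ('h \<Rightarrow>\<^sub>L 'h) set" where
  "commutant S = {y \<in> clinear_ops. \<forall>x\<in>S. x o\<^sub>L y = y o\<^sub>L x}"

definition von_neumann_algebra :: "('h::complex_inner \<Rightarrow>\<^sub>L 'h) set \<Rightarrow> bool" where
  "von_neumann_algebra M \<longleftrightarrow>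
     M \<subseteq> clinear_ops \<and> (\<forall>x\<in>M. adj x \<in> M) \<and> commutant (commutant M) = M"

definition vN_generated :: "('h::complex_inner \<Rightarrow>\<^sub>L 'h) set \<Rightarrow> ('h \<Rightarrow>\<^sub>L 'h) set" where
  "vN_generated S = \<Inter>{M. von_neumann_algebra M \<and> S \<subseteq> M}"

definition conj_by :: "('h::complex_inner \<Rightarrow>\<^sub>L 'h) \<Rightarrow> ('h \<Rightarrow>\<^sub>L 'h) \<Rightarrow> ('h \<Rightarrow>\<^sub>L 'h)" where
  "conj_by u x = u o\<^sub>L x o\<^sub>L adj u"

text \<open>\<open>G\<close> is the carrier of a group with multiplication \<open>m\<close>, topologized as a subspace of
  the ambient type.\<close>

definition unitary_representation ::
  "'g::topological_space set \<Rightarrow> ('g \<Rightarrow> 'g \<Rightarrow> 'g) \<Rightarrow> ('g \<Rightarrow> ('h::complex_inner \<Rightarrow>\<^sub>L 'h)) \<Rightarrow> bool"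
where
  "unitary_representation G m U \<longleftrightarrow>
     (\<forall>g\<in>G. unitary_op (U g)) \<and>
     (\<forall>g\<in>G. \<forall>k\<in>G. U (m g k) = U g o\<^sub>L U k) \<and>
     (\<forall>\<xi>. continuous_on G (\<lambda>g. U g \<xi>))"


section \<open>Joint spectrum of a representation of the translations\<close>

definition projection_valued_measure :: "((real \<times> real) set \<Rightarrow> ('h::complex_inner \<Rightarrow>\<^sub>L 'h)) \<Rightarrow> bool"
where
  "projection_valued_measure E \<longleftrightarrow>
     (\<forall>B\<in>sets borel. E B \<in> clinear_ops \<and> adj (E B) = E B \<and> E B o\<^sub>L E B = E B) \<and>
     E UNIV = id_blinfun \<and>
     (\<forall>F::nat \<Rightarrow> (real \<times> real) set. range F \<subseteq> sets borel \<longrightarrow> disjoint_family F \<longrightarrow>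
        (\<forall>\<xi>. (\<lambda>n. E (F n) \<xi>) sums E (\<Union>n. F n) \<xi>))"

definition scalar_measure ::
  "((real \<times> real) set \<Rightarrow> ('h::complex_inner \<Rightarrow>\<^sub>L 'h)) \<Rightarrow> 'h \<Rightarrow> (real \<times> real) measure" where
  "scalar_measure E \<xi> = measure_of UNIV (sets borel) (\<lambda>B. ennreal (Re (cinner \<xi> (E B \<xi>))))"

text \<open>\<open>T(a) = \<integral> exp (i (a\<^sub>0 p\<^sub>0 - a\<^sub>1 p\<^sub>1)) dE(p)\<close> in the weak sense; by polarization it is enough
  to test on the diagonal.\<close>

definition spectral_measure_of ::
  "(real \<times> real \<Rightarrow> ('h::complex_inner \<Rightarrow>\<^sub>L 'h)) \<Rightarrow> ((real \<times> real) set \<Rightarrow> ('h \<Rightarrow>\<^sub>L 'h)) \<Rightarrow> bool"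
where
  "spectral_measure_of T E \<longleftrightarrow> projection_valued_measure E \<and>
     (\<forall>a \<xi>. cinner \<xi> (T a \<xi>) = (LINT p|scalar_measure E \<xi>. cis (fst a * fst p - snd a * snd p)))"

definition pvm_support :: "((real \<times> real) set \<Rightarrow> ('h::complex_inner \<Rightarrow>\<^sub>L 'h)) \<Rightarrow> (real \<times> real) set"
where
  "pvm_support E = {p. \<forall>N. open N \<longrightarrow> p \<in> N \<longrightarrow> E N \<noteq> 0}"


section \<open>Spacetime and its symmetries\<close>

text \<open>Points of Minkowski space are pairs \<open>(a\<^sub>0, a\<^sub>1)\<close> with \<open>a\<^sub>0\<close> the time coordinate.\<close>

definition spacelike_separated :: "(real \<times> real) set \<Rightarrow> (real \<times> real) set \<Rightarrow> bool" where
  "spacelike_separated R S \<longleftrightarrow>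
     (\<forall>a\<in>R. \<forall>b\<in>S. (fst a - fst b)\<^sup>2 < (snd a - snd b)\<^sup>2)"

text \<open>\<open>bounded_interval\<close> excludes the empty interval.\<close>

definition bounded_interval :: "real set \<Rightarrow> bool" where
  "bounded_interval I \<longleftrightarrow> (\<exists>a b. a < b \<and> I = {a<..<b})"

definition double_cone :: "real set \<Rightarrow> real set \<Rightarrow> (real \<times> real) set" where
  "double_cone I J = {a. fst a - snd a \<in> I \<and> fst a + snd a \<in> J}"

text \<open>Boost of rapidity \<open>l\<close> followed by translation by \<open>b\<close>.\<close>

definition poincare_map :: "real \<Rightarrow> real \<times> real \<Rightarrow> real \<times> real \<Rightarrow> real \<times> real" where
  "poincare_map l b a =
     (cosh l * fst a + sinh l * snd a + fst b, sinh l * fst a + cosh l * snd a + snd b)"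

text \<open>The proper orthochronous Poincare group. The product topology on the function type (pointwise
  convergence) induces its Lie group topology.\<close>

definition poincare_group :: "(real \<times> real \<Rightarrow> real \<times> real) set" where
  "poincare_group = {poincare_map l b | l b. True}"

definition translation_op ::
  "((real \<times> real \<Rightarrow> real \<times> real) \<Rightarrow> ('h::complex_inner \<Rightarrow>\<^sub>L 'h)) \<Rightarrow> real \<times> real \<Rightarrow> ('h \<Rightarrow>\<^sub>L 'h)" where
  "translation_op U b = U (\<lambda>a. a + b)"

text \<open>The universal cover of \<open>PSL(2,\<real>)\<close>, realized as the group (under composition) of all lifts to
  \<open>\<real>\<close> of fractional linear transformations of the circle \<open>\<real> \<union> {\<infinity>}\<close>. The covering map from \<open>\<real>\<close> to
  the circle is \<open>\<theta> \<mapsto> tan \<theta>\<close>, with homogeneous coordinates \<open>[sin \<theta> : cos \<theta>]\<close> and period \<open>\<pi>\<close>.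
  Again pointwise convergence induces the Lie group topology.\<close>

definition mobius_cover :: "(real \<Rightarrow> real) set" where
  "mobius_cover = {f. continuous_on UNIV f \<and>
     (\<exists>a b c d. a * d - b * c = 1 \<and>
        (\<forall>\<theta>. \<exists>r. r \<noteq> 0 \<and> a * sin \<theta> + b * cos \<theta> = r * sin (f \<theta>) \<and>
                          c * sin \<theta> + d * cos \<theta> = r * cos (f \<theta>)))}"

text \<open>The fractional linear action on \<open>x \<in> \<real>\<close>; the image of \<open>x\<close> is finite iff \<open>mobius_finite f x\<close>.\<close>

definition mobius_finite :: "(real \<Rightarrow> real) \<Rightarrow> real \<Rightarrow> bool" where
  "mobius_finite f x \<longleftrightarrow> cos (f (arctan x)) \<noteq> 0"

definition mobius_act :: "(real \<Rightarrow> real) \<Rightarrow> real \<Rightarrow> real" where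
  "mobius_act f x = tan (f (arctan x))"

text \<open>The two-dimensional group: the first (left) factor acts on \<open>a\<^sub>0 - a\<^sub>1\<close>, the second (right)
  factor on \<open>a\<^sub>0 + a\<^sub>1\<close>.\<close>

type_synonym mobius2 = "(real \<Rightarrow> real) \<times> (real \<Rightarrow> real)"

definition mobius2_group :: "mobius2 set" where
  "mobius2_group = mobius_cover \<times> mobius_cover"

definition mobius2_mult :: "mobius2 \<Rightarrow> mobius2 \<Rightarrow> mobius2" where
  "mobius2_mult g k = (fst g \<circ> fst k, snd g \<circ> snd k)"

definition mobius2_finite :: "mobius2 \<Rightarrow> real \<times> real \<Rightarrow> bool" where
  "mobius2_finite g a \<longleftrightarrow>
     mobius_finite (fst g) (fst a - snd a) \<and> mobius_finite (snd g) (fst a + snd a)"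

definition mobius2_act :: "mobius2 \<Rightarrow> real \<times> real \<Rightarrow> real \<times> real" where
  "mobius2_act g a =
     (let u = mobius_act (fst g) (fst a - snd a); v = mobius_act (snd g) (fst a + snd a)
      in ((u + v) / 2, (v - u) / 2))"

text \<open>For \<open>\<alpha> > 0\<close>, the lift of \<open>x \<mapsto> \<alpha> x + \<beta>\<close> that fixes the points \<open>\<pi>/2 + k \<pi>\<close> above \<open>\<infinity>\<close>; it is the
  one lying on the identity sheet of the cover.\<close>

definition affine_lift :: "real \<Rightarrow> real \<Rightarrow> real \<Rightarrow> real" where
  "affine_lift \<alpha> \<beta> \<theta> =
     (if cos \<theta> = 0 then \<theta> else arctan (\<alpha> * tan \<theta> + \<beta>) + pi * of_int (round (\<theta> / pi)))"

text \<open>The embedding of the Poincare group, on the element \<open>poincare_map l b\<close>, which acts in light-cone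
  coordinates as \<open>u \<mapsto> exp (-l) u + (b\<^sub>0 - b\<^sub>1)\<close> and \<open>v \<mapsto> exp l v + (b\<^sub>0 + b\<^sub>1)\<close>.\<close>

definition poincare_lift :: "real \<Rightarrow> real \<times> real \<Rightarrow> mobius2" where
  "poincare_lift l b =
     (affine_lift (exp (- l)) (fst b - snd b), affine_lift (exp l) (fst b + snd b))"


section \<open>Nets\<close>

text \<open>The joint spectrum of the translations is the support of their joint spectral measure, which
  exists and is unique by the Stone-Naimark-Ambrose-Godement theorem.
  Only the values of \<open>A\<close> on bounded open sets and of \<open>U\<close> on \<^const>\<open>poincare_group\<close>
  are meaningful.\<close>

locale poincare_covariant_net =
  fixes A :: "(real \<times> real) set \<Rightarrow> ('h::separable_hilbert \<Rightarrow>\<^sub>L 'h) set"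
    and U :: "(real \<times> real \<Rightarrow> real \<times> real) \<Rightarrow> ('h \<Rightarrow>\<^sub>L 'h)"
    and \<Omega> :: 'h
  assumes von_neumann: "\<lbrakk>open R; bounded R\<rbrakk> \<Longrightarrow> von_neumann_algebra (A R)"
    and isotony: "\<lbrakk>open R; bounded R; open S; bounded S; R \<subseteq> S\<rbrakk> \<Longrightarrow> A R \<subseteq> A S"
    and locality: "\<lbrakk>open R; bounded R; open S; bounded S; spacelike_separated R S;
                    x \<in> A R; y \<in> A S\<rbrakk> \<Longrightarrow> x o\<^sub>L y = y o\<^sub>L x"
    and additivity: "\<lbrakk>\<forall>R\<in>\<R>. open R; bounded (\<Union>\<R>)\<rbrakk>
                     \<Longrightarrow> A (\<Union>\<R>) = vN_generated (\<Union>R\<in>\<R>. A R)"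
    and representation: "unitary_representation poincare_group (\<circ>) U"
    and covariance: "\<lbrakk>g \<in> poincare_group; open R; bounded R\<rbrakk>
                     \<Longrightarrow> conj_by (U g) ` A R = A (g ` R)"
    and spectrum_condition: "\<exists>E. spectral_measure_of (translation_op U) E \<and>
                               pvm_support E \<subseteq> {p. fst p + snd p \<ge> 0 \<and> fst p - snd p \<ge> 0}"
    and vacuum_unit: "norm \<Omega> = 1"
    and vacuum_invariant: "g \<in> poincare_group \<Longrightarrow> U g \<Omega> = \<Omega>"
    and vacuum_unique: "\<lbrakk>norm \<xi> = 1; \<forall>g\<in>poincare_group. U g \<xi> = \<xi>\<rbrakk>
                        \<Longrightarrow> \<exists>c. cmod c = 1 \<and> \<xi> = c *\<^sub>C \<Omega>"
    and vacuum_cyclic: "closure ((\<lambda>x. blinfun_apply x \<Omega>) `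
                          vN_generated (\<Union>R\<in>{R. open R \<and> bounded R}. A R)) = UNIV"

locale mobius_covariant_net = poincare_covariant_net A U \<Omega>
  for A :: "(real \<times> real) set \<Rightarrow> ('h::separable_hilbert \<Rightarrow>\<^sub>L 'h) set"
    and U :: "(real \<times> real \<Rightarrow> real \<times> real) \<Rightarrow> ('h \<Rightarrow>\<^sub>L 'h)"
    and \<Omega> :: 'h +
  fixes V :: "mobius2 \<Rightarrow> ('h \<Rightarrow>\<^sub>L 'h)"
  assumes mobius_representation: "unitary_representation mobius2_group mobius2_mult V"
    and extends: "V (poincare_lift l b) = U (poincare_map l b)"
    and mobius_covariance: "\<lbrakk>open R; bounded R\<rbrakk> \<Longrightarrow>
          \<exists>N. openin (top_of_set mobius2_group) N \<and> (id, id) \<in> N \<and>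
              (\<forall>g\<in>N. (\<forall>a\<in>R. mobius2_finite g a) \<and> conj_by (V g) ` A R = A (mobius2_act g ` R))"

text \<open>The chiral components, with the auxiliary interval (\<open>J\<close>, resp. \<open>I\<close>) on which they do not
  depend kept as an argument.\<close>

definition chiral_L ::
  "((real \<times> real) set \<Rightarrow> ('h::complex_inner \<Rightarrow>\<^sub>L 'h) set) \<Rightarrow> (mobius2 \<Rightarrow> ('h \<Rightarrow>\<^sub>L 'h))
     \<Rightarrow> real set \<Rightarrow> real set \<Rightarrow> ('h \<Rightarrow>\<^sub>L 'h) set" where
  "chiral_L A V J I = A (double_cone I J) \<inter> commutant (V ` ({id} \<times> mobius_cover))"

definition chiral_R ::
  "((real \<times> real) set \<Rightarrow> ('h::complex_inner \<Rightarrow>\<^sub>L 'h) set) \<Rightarrow> (mobius2 \<Rightarrow> ('h \<Rightarrow>\<^sub>L 'h))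
     \<Rightarrow> real set \<Rightarrow> real set \<Rightarrow> ('h \<Rightarrow>\<^sub>L 'h) set" where
  "chiral_R A V I J = A (double_cone I J) \<inter> commutant (V ` (mobius_cover \<times> {id}))"


section \<open>Waves and collision states\<close>

text \<open>Throughout, the sign \<open>s = 1\<close> or \<open>s = -1\<close> selects \<open>+\<close> or \<open>-\<close>, and the filter \<open>F\<close> is
  \<^const>\<open>at_top\<close> for outgoing and \<^const>\<open>at_bot\<close> for incoming objects.\<close>

definition local_op ::
  "((real \<times> real) set \<Rightarrow> ('h::complex_inner \<Rightarrow>\<^sub>L 'h) set) \<Rightarrow> ('h \<Rightarrow>\<^sub>L 'h) \<Rightarrow> bool" where
  "local_op A x \<longleftrightarrow> (\<exists>R. open R \<and> bounded R \<and> x \<in> A R)"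

definition wave_space ::
  "((real \<times> real \<Rightarrow> real \<times> real) \<Rightarrow> ('h::complex_inner \<Rightarrow>\<^sub>L 'h)) \<Rightarrow> real \<Rightarrow> 'h set" where
  "wave_space U s = {\<xi>. \<forall>t. translation_op U (t, s * t) \<xi> = \<xi>}"

definition wave_profile :: "(real \<Rightarrow> real) \<Rightarrow> bool" where
  "wave_profile h \<longleftrightarrow> (\<forall>t. h t \<ge> 0) \<and> (\<forall>t. h (- t) = h t) \<and>
     (\<forall>n t. ((deriv ^^ n) h) differentiable at t) \<and> has_bochner_integral lborel h 1"

definition scaled_profile :: "(real \<Rightarrow> real) \<Rightarrow> real \<Rightarrow> real \<Rightarrow> real \<Rightarrow> real" where
  "scaled_profile h \<epsilon> \<T> t = \<bar>\<T>\<bar> powr (- \<epsilon>) * h (\<bar>\<T>\<bar> powr (- \<epsilon>) * (t - \<T>))"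

text \<open>The operator \<open>x\<^sub>s(h\<^sub>\<T>)\<close>, as a strong (pointwise Bochner) integral.\<close>

definition smeared_op ::
  "((real \<times> real \<Rightarrow> real \<times> real) \<Rightarrow> ('h::separable_hilbert \<Rightarrow>\<^sub>L 'h)) \<Rightarrow> (real \<Rightarrow> real) \<Rightarrow> real
     \<Rightarrow> real \<Rightarrow> ('h \<Rightarrow>\<^sub>L 'h) \<Rightarrow> real \<Rightarrow> 'h \<Rightarrow> 'h" where
  "smeared_op U h \<epsilon> s x \<T> \<xi> =
     (LINT t|lborel. scaled_profile h \<epsilon> \<T> t *\<^sub>R conj_by (translation_op U (t, s * t)) x \<xi>)"

definition asymptotic_field ::
  "((real \<times> real \<Rightarrow> real \<times> real) \<Rightarrow> ('h::separable_hilbert \<Rightarrow>\<^sub>L 'h)) \<Rightarrow> (real \<Rightarrow> real) \<Rightarrow> real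
     \<Rightarrow> real filter \<Rightarrow> real \<Rightarrow> ('h \<Rightarrow>\<^sub>L 'h) \<Rightarrow> 'h \<Rightarrow> 'h" where
  "asymptotic_field U h \<epsilon> F s x \<xi> = Lim F (\<lambda>\<T>. smeared_op U h \<epsilon> s x \<T> \<xi>)"

definition approximating_ops ::
  "((real \<times> real) set \<Rightarrow> ('h::separable_hilbert \<Rightarrow>\<^sub>L 'h) set)
     \<Rightarrow> ((real \<times> real \<Rightarrow> real \<times> real) \<Rightarrow> ('h \<Rightarrow>\<^sub>L 'h)) \<Rightarrow> 'h
     \<Rightarrow> real \<Rightarrow> 'h \<Rightarrow> (nat \<Rightarrow> ('h \<Rightarrow>\<^sub>L 'h)) \<Rightarrow> bool" where
  "approximating_ops A U \<Omega> s \<xi> x \<longleftrightarrow>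
     (\<forall>n. local_op A (x n)) \<and> (\<lambda>n. orth_proj (wave_space U s) (x n \<Omega>)) \<longlonglongrightarrow> \<xi>"

text \<open>The limit exists and is independent of the approximating sequences.\<close>

definition collision_state ::
  "((real \<times> real) set \<Rightarrow> ('h::separable_hilbert \<Rightarrow>\<^sub>L 'h) set)
     \<Rightarrow> ((real \<times> real \<Rightarrow> real \<times> real) \<Rightarrow> ('h \<Rightarrow>\<^sub>L 'h)) \<Rightarrow> 'h \<Rightarrow> (real \<Rightarrow> real) \<Rightarrow> real
     \<Rightarrow> real filter \<Rightarrow> 'h \<Rightarrow> 'h \<Rightarrow> 'h" where
  "collision_state A U \<Omega> h \<epsilon> F \<xi>p \<xi>m =
     (THE \<zeta>. \<exists>x y. approximating_ops A U \<Omega> 1 \<xi>p x \<and> approximating_ops A U \<Omega> (-1) \<xi>m y \<and>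
        (\<lambda>n. asymptotic_field U h \<epsilon> F 1 (x n) (asymptotic_field U h \<epsilon> F (-1) (y n) \<Omega>))
          \<longlonglongrightarrow> \<zeta>)"

definition collision_space ::
  "((real \<times> real) set \<Rightarrow> ('h::separable_hilbert \<Rightarrow>\<^sub>L 'h) set)
     \<Rightarrow> ((real \<times> real \<Rightarrow> real \<times> real) \<Rightarrow> ('h \<Rightarrow>\<^sub>L 'h)) \<Rightarrow> 'h \<Rightarrow> (real \<Rightarrow> real) \<Rightarrow> real
     \<Rightarrow> real filter \<Rightarrow> 'h set" where
  "collision_space A U \<Omega> h \<epsilon> F =
     closed_cspan {collision_state A U \<Omega> h \<epsilon> F \<xi>p \<xi>m | \<xi>p \<xi>m.
                     \<xi>p \<in> wave_space U 1 \<and> \<xi>m \<in> wave_space U (-1)}"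

abbreviation "out_space A U \<Omega> h \<epsilon> \<equiv> collision_space A U \<Omega> h \<epsilon> at_top"
abbreviation "in_space A U \<Omega> h \<epsilon> \<equiv> collision_space A U \<Omega> h \<epsilon> at_bot"

end

theory Submission
  imports Defs "HOL-Complex_Analysis.Conformal_Mappings"
begin

text \<open>By the Mautner phenomenon the vectors in \<open>\<H>\<^sub>+\<close> and \<open>\<H>\<^sub>-\<close>, which are only assumed to be invariant
  under lightlike translations, are invariant under one whole factor of the Moebius group. For
  \<open>x \<in> \<A>(I \<times> J)\<close> the averages of \<open>x\<close> over the powers of a contraction of \<open>J\<close> stay in \<open>\<A>(I \<times> J)\<close>. By the
  mean ergodic theorem, locality and the Reeh-Schlieder property they converge strongly to some
  \<open>y\<close> with \<open>y \<Omega> = P\<^sub>+ x \<Omega>\<close>, and \<open>y\<close> belongs to \<open>\<A>\<^sub>L(I)\<close> because the vacuum is separating. Locality also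
  shows that both \<open>\<Phi>\<^sup>i\<^sup>n\<^sub>+(x)\<close> and \<open>\<Phi>\<^sup>o\<^sup>u\<^sup>t\<^sub>+(x)\<close> are equal to \<open>y\<close>: they agree on the vectors created from
  the vacuum in a region from which the wave escapes. So in- and out-fields coincide and are chiral
  fields. Finally \<open>\<parallel>a b \<Omega>\<parallel> = \<parallel>a \<Omega>\<parallel> \<parallel>b \<Omega>\<parallel>\<close> for left and right chiral fields \<open>a\<close>, \<open>b\<close>, by uniqueness of the
  vacuum, so collision states are limits of vectors \<open>a b \<Omega>\<close>.\<close>

section \<open>Hilbert spaces\<close>

text \<open>Covariance under the cover holds only near the identity, in a neighbourhood depending on
  the region. An operator can therefore be tested against all translations but only against short
  rotations; \<open>commute_all\<close> shows that these generate the group. Averaging uses one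
  contraction because translates of \<open>x\<close> leave \<open>A (double_cone I J)\<close>, while
  a contraction maps that algebra into itself; its fixed vectors turn out to be exactly the
  translation-invariant ones. Behind the Mautner step is a Bruhat relation: up to translations on
  both sides, \<open>rot \<epsilon>\<close> equals \<open>rot \<phi>\<close> followed by a dilation
  that depends on the ratio of sines, so both have the same coefficient in a translation-invariant
  vector. Shrinking the angles isolates first the dilation, then the rotation. The Reeh-Schlieder
  property is not an axiom and is derived from additivity and the spectrum condition. Both
  chiralities are instances of one locale \<open>half_net\<close>, in which the group moves only the
  second interval. A sign \<open>\<sigma>\<close> tells outgoing from incoming; it decides on which
  side of \<open>I\<close> the test vectors are created.\<close>

context complex_inner
begin

lemma cinner_add_left: "cinner (x + y) z = cinner x z + cinner y z"
  by (metis cinner_add_right cinner_commute complex_cnj_add)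

lemma cinner_scaleC_left: "cinner (c *\<^sub>C x) y = cnj c * cinner x y"
  by (metis cinner_commute cinner_scaleC_right complex_cnj_mult)

lemma scaleC_one [simp]: "1 *\<^sub>C x = x"
  by (metis of_real_1 scaleR_one scaleR_scaleC)

end

lemma scaleC_zero_left [simp]: "0 *\<^sub>C (x::'a::complex_inner) = 0"
  by (metis of_real_0 scaleR_zero_left scaleR_scaleC)

lemma scaleC_zero_right [simp]: "c *\<^sub>C (0::'a::complex_inner) = 0"
  by (metis mult_zero_right scaleC_scaleC scaleC_zero_left)

lemma scaleC_minus_one [simp]: "(- 1) *\<^sub>C (x::'a::complex_inner) = - x"
  by (metis of_real_1 of_real_minus scaleR_minus1_left scaleR_scaleC)

lemma scaleC_minus_right [simp]: "c *\<^sub>C (- x::'a::complex_inner) = - (c *\<^sub>C x)"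
  by (metis mult.commute scaleC_minus_one scaleC_scaleC)

lemma scaleC_minus_left [simp]: "(- c) *\<^sub>C (x::'a::complex_inner) = - (c *\<^sub>C x)"
  by (metis mult_minus1 scaleC_minus_one scaleC_scaleC)

lemma scaleC_diff_right: "c *\<^sub>C (x - y::'a::complex_inner) = c *\<^sub>C x - c *\<^sub>C y"
  by (metis scaleC_add_right scaleC_minus_right uminus_add_conv_diff add.commute)

lemma cinner_self: "cinner x (x::'a::complex_inner) = complex_of_real ((norm x)\<^sup>2)"
proof (rule complex_eqI)
  show "Re (cinner x x) = Re (complex_of_real ((norm x)\<^sup>2))"
    by (simp add: inner_eq_Re_cinner[symmetric] power2_norm_eq_inner)
  show "Im (cinner x x) = Im (complex_of_real ((norm x)\<^sup>2))"
    using arg_cong[OF cinner_commute[of x x], of Im] by simp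
qed

lemma norm_sq_cinner: "(norm (x::'a::complex_inner))\<^sup>2 = cmod (cinner x x)"
  by (simp add: cinner_self norm_power)

lemma norm_scaleC: "norm (c *\<^sub>C (x::'a::complex_inner)) = cmod c * norm x"
proof -
  have "complex_of_real ((norm (c *\<^sub>C x))\<^sup>2) = complex_of_real ((cmod c * norm x)\<^sup>2)"
    unfolding cinner_self[symmetric] cinner_scaleC_left cinner_scaleC_right
    by (simp add: cinner_self power_mult_distrib complex_norm_square[unfolded of_real_power])
  then show ?thesis
    by (metis mult_nonneg_nonneg norm_ge_zero of_real_eq_iff power2_eq_imp_eq)
qed

text \<open>Cauchy-Schwarz for the real inner product controls only the real part. Turning
  \<open>y\<close> by a phase makes \<open>cinner x y\<close> real and nonnegative without changing
  the norm of \<open>y\<close>.\<close>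

lemma cmod_cinner_le: "cmod (cinner x (y::'a::complex_inner)) \<le> norm x * norm y"
proof (cases "cinner x y = 0")
  case False
  define c where "c = cnj (cinner x y) / cmod (cinner x y)"
  have "cmod c = 1"
    using False by (simp add: c_def norm_divide)
  have "c * cinner x y = cmod (cinner x y)"
    using False
    by (simp add: c_def complex_norm_square[symmetric] power2_eq_square mult.commute)
  then have "cmod (cinner x y) = inner x (c *\<^sub>C y)"
    by (simp add: inner_eq_Re_cinner cinner_scaleC_right)
  also have "\<dots> \<le> norm x * norm (c *\<^sub>C y)"
    by (rule norm_cauchy_schwarz)
  finally show ?thesis
    by (simp add: norm_scaleC \<open>cmod c = 1\<close>)
qed auto

lemma bounded_bilinear_cinner: "bounded_bilinear (cinner :: 'a::complex_inner \<Rightarrow> 'a \<Rightarrow> complex)"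
proof
  show "cinner (r *\<^sub>R a) b = r *\<^sub>R cinner a b" for r and a b :: 'a
    by (simp add: scaleR_scaleC cinner_scaleC_left scaleR_conv_of_real)
  show "cinner a (r *\<^sub>R b) = r *\<^sub>R cinner a b" for r and a b :: 'a
    by (simp add: scaleR_scaleC cinner_scaleC_right scaleR_conv_of_real)
  show "\<exists>K. \<forall>a b::'a. norm (cinner a b) \<le> norm a * norm b * K"
    using cmod_cinner_le by (intro exI[of _ 1]) auto
qed (auto simp: cinner_add_left cinner_add_right)

interpretation cinner: bounded_bilinear "cinner :: 'a::complex_inner \<Rightarrow> 'a \<Rightarrow> complex"
  by (rule bounded_bilinear_cinner)

declare cinner.zero_left [simp] cinner.zero_right [simp]

lemma bounded_linear_scaleC: "bounded_linear (\<lambda>x::'a::complex_inner. c *\<^sub>C x)"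
proof (rule bounded_linear_intro[where K = "cmod c"])
  show "c *\<^sub>C (r *\<^sub>R x) = r *\<^sub>R (c *\<^sub>C x)" for r and x :: 'a
    by (simp add: scaleR_scaleC scaleC_scaleC mult.commute)
qed (auto simp: scaleC_add_right norm_scaleC)

lemmas tendsto_scaleC = bounded_linear.tendsto[OF bounded_linear_scaleC]

lemma cinner_ext: "(\<And>\<zeta>. cinner \<zeta> x = cinner \<zeta> y) \<Longrightarrow> x = (y::'a::complex_inner)"
  using cinner_self[of "x - y"] by (metis cinner.diff_right eq_iff_diff_eq_0 norm_eq_zero
      of_real_eq_0_iff zero_eq_power2)

lemma csubspace_diff: "csubspace M \<Longrightarrow> x \<in> M \<Longrightarrow> y \<in> M \<Longrightarrow> x - y \<in> M"
  unfolding csubspace_def by (metis scaleC_minus_one uminus_add_conv_diff add.commute)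

lemma csubspace_scaleR: "csubspace M \<Longrightarrow> x \<in> M \<Longrightarrow> r *\<^sub>R x \<in> M"
  by (simp add: csubspace_def scaleR_scaleC)

lemma csubspace_closure:
  assumes "csubspace M"
  shows "csubspace (closure (M::'a::complex_inner set))"
  unfolding csubspace_def
proof (intro conjI ballI allI)
  show "0 \<in> closure M"
    using assms closure_subset unfolding csubspace_def by blast
next
  fix x y assume "x \<in> closure M" "y \<in> closure M"
  then obtain f g where "\<And>n::nat. f n \<in> M" "f \<longlonglongrightarrow> x" "\<And>n::nat. g n \<in> M" "g \<longlonglongrightarrow> y"
    by (auto simp: closure_sequential)
  then show "x + y \<in> closure M"
    using assms tendsto_add[of f x sequentially g y]
    unfolding closure_sequential csubspace_def by (intro exI[of _ "\<lambda>n. f n + g n"]) auto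
next
  fix c x assume "x \<in> closure M"
  then obtain f where "\<And>n::nat. f n \<in> M" "f \<longlonglongrightarrow> x"
    by (auto simp: closure_sequential)
  then show "c *\<^sub>C x \<in> closure M"
    using assms tendsto_scaleC[of f x sequentially c]
    unfolding closure_sequential csubspace_def by (intro exI[of _ "\<lambda>n. c *\<^sub>C f n"]) auto
qed

section \<open>Closed spans, orthogonal projections and the Riesz representation\<close>

lemma csubspace_closed_cspan: "csubspace (closed_cspan S)"
  by (auto simp: closed_cspan_def csubspace_def)

lemma closed_closed_cspan: "closed (closed_cspan S)"
  unfolding closed_cspan_def by (rule closed_Inter) auto

lemma closed_cspan_superset: "S \<subseteq> closed_cspan S"
  by (auto simp: closed_cspan_def)

lemma closed_cspan_minimal: "csubspace M \<Longrightarrow> closed M \<Longrightarrow> S \<subseteq> M \<Longrightarrow> closed_cspan S \<subseteq> M"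
  by (auto simp: closed_cspan_def)

text \<open>A minimizing sequence for the distance to \<open>M\<close> is Cauchy by the
  parallelogram law. At the nearest point no move along a vector of \<open>M\<close> can shorten the
  distance, which forces orthogonality.\<close>

lemma projection_exists:
  fixes M :: "'a::{complex_inner,banach} set"
  assumes M: "csubspace M" and "closed M"
  shows "\<exists>\<eta>\<in>M. \<forall>\<zeta>\<in>M. cinner \<zeta> (\<xi> - \<eta>) = 0"
proof -
  have ne: "M \<noteq> {}"
    using M by (auto simp: csubspace_def)
  define d where "d = infdist \<xi> M"
  have d: "d \<le> dist \<xi> y" if "y \<in> M" for y
    using infdist_le that unfolding d_def by blast
  have "d \<ge> 0"
    by (simp add: d_def infdist_nonneg)
  have "\<exists>y\<in>M. dist \<xi> y < d + inverse (real (Suc n))" for n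
    using cInf_lessD[of "dist \<xi> ` M" "infdist \<xi> M + inverse (real (Suc n))"] ne
    by (auto simp: d_def infdist_notempty)
  then obtain y where y: "\<And>n. y n \<in> M" "\<And>n. dist \<xi> (y n) < d + inverse (real (Suc n))"
    by metis
  have para: "(norm (p - q))\<^sup>2 \<le> 2 * (norm (\<xi> - p))\<^sup>2 + 2 * (norm (\<xi> - q))\<^sup>2 - 4 * d\<^sup>2"
    if "p \<in> M" "q \<in> M" for p q
  proof -
    have "(1/2) *\<^sub>R (p + q) \<in> M"
      using M that csubspace_scaleR unfolding csubspace_def by blast
    from d[OF this] have "d\<^sup>2 \<le> (norm (\<xi> - (1/2) *\<^sub>R (p + q)))\<^sup>2"
      using \<open>d \<ge> 0\<close> by (simp add: dist_norm power_mono)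
    then show ?thesis
      by (simp add: power2_norm_eq_inner inner_simps inner_commute algebra_simps)
  qed
  have lim: "(\<lambda>n. norm (\<xi> - y n)) \<longlonglongrightarrow> d"
  proof (rule tendsto_sandwich[OF _ _ tendsto_const])
    show "\<forall>\<^sub>F n in sequentially. d \<le> norm (\<xi> - y n)"
      using d y by (simp add: dist_norm)
    show "\<forall>\<^sub>F n in sequentially. norm (\<xi> - y n) \<le> d + inverse (real (Suc n))"
      using y(2) by (simp add: dist_norm less_imp_le)
    show "(\<lambda>n. d + inverse (real (Suc n))) \<longlonglongrightarrow> d"
      using tendsto_add[OF tendsto_const LIMSEQ_inverse_real_of_nat, of d] by simp
  qed
  have "Cauchy y"
  proof (rule metric_CauchyI)
    fix e :: real assume "e > 0"
    have "(\<lambda>n. (norm (\<xi> - y n))\<^sup>2) \<longlonglongrightarrow> d\<^sup>2"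
      by (intro tendsto_intros lim)
    then have "\<forall>\<^sub>F n in sequentially. (norm (\<xi> - y n))\<^sup>2 < d\<^sup>2 + e\<^sup>2 / 4"
      by (rule order_tendstoD) (use \<open>e > 0\<close> in auto)
    then obtain N where N: "\<And>n. n \<ge> N \<Longrightarrow> (norm (\<xi> - y n))\<^sup>2 < d\<^sup>2 + e\<^sup>2 / 4"
      by (auto simp: eventually_sequentially)
    have "dist (y m) (y n) < e" if "m \<ge> N" "n \<ge> N" for m n
    proof -
      have "(norm (y m - y n))\<^sup>2 < e\<^sup>2"
        using para[OF y(1)[of m] y(1)[of n]] N[OF that(1)] N[OF that(2)] by linarith
      then show ?thesis
        using \<open>e > 0\<close> by (simp add: dist_norm power_less_imp_less_base less_imp_le)
    qed
    then show "\<exists>N. \<forall>m\<ge>N. \<forall>n\<ge>N. dist (y m) (y n) < e"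
      by blast
  qed
  then obtain \<eta> where \<eta>: "y \<longlonglongrightarrow> \<eta>"
    using convergent_eq_Cauchy by blast
  have "\<eta> \<in> M"
    using \<open>closed M\<close> \<eta> y(1) closed_sequentially by blast
  have "norm (\<xi> - \<eta>) = d"
    using LIMSEQ_unique[OF lim tendsto_norm[OF tendsto_diff[OF tendsto_const \<eta>]]] by simp
  have "cinner \<zeta> (\<xi> - \<eta>) = 0" if "\<zeta> \<in> M" for \<zeta>
  proof (cases "\<zeta> = 0")
    case False
    \<comment> \<open>\<open>c *\<^sub>C \<zeta>\<close> is the projection of the residual onto the
      line of \<open>\<zeta>\<close>. Adding it to \<open>\<eta>\<close> lowers the squared distance
      by the quotient below, so by minimality that quotient is 0.\<close>
    define c where "c = cinner \<zeta> (\<xi> - \<eta>) / complex_of_real ((norm \<zeta>)\<^sup>2)"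
    have nz: "(norm \<zeta>)\<^sup>2 \<noteq> 0"
      using False by simp
    have "\<eta> + c *\<^sub>C \<zeta> \<in> M"
      using M \<open>\<eta> \<in> M\<close> \<open>\<zeta> \<in> M\<close> by (simp add: csubspace_def)
    from d[OF this] have "d\<^sup>2 \<le> (norm (\<xi> - \<eta> - c *\<^sub>C \<zeta>))\<^sup>2"
      using \<open>d \<ge> 0\<close> by (simp add: dist_norm power_mono diff_diff_eq)
    moreover have "complex_of_real ((norm (\<xi> - \<eta> - c *\<^sub>C \<zeta>))\<^sup>2)
        = complex_of_real (d\<^sup>2 - (cmod (cinner \<zeta> (\<xi> - \<eta>)))\<^sup>2 / (norm \<zeta>)\<^sup>2)"
    proof -
      have *: "cinner (\<xi> - \<eta>) \<zeta> = cnj (cinner \<zeta> (\<xi> - \<eta>))"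
        by (rule cinner_commute)
      have "complex_of_real ((norm (\<xi> - \<eta> - c *\<^sub>C \<zeta>))\<^sup>2)
          = cinner (\<xi> - \<eta>) (\<xi> - \<eta>) - cnj c * cinner \<zeta> (\<xi> - \<eta>) - c * cinner (\<xi> - \<eta>) \<zeta>
             + c * cnj c * cinner \<zeta> \<zeta>"
        unfolding cinner_self[symmetric]
        by (simp only: cinner.diff_left cinner.diff_right cinner_scaleC_left cinner_scaleC_right)
           (simp add: algebra_simps)
      also have "\<dots> = cinner (\<xi> - \<eta>) (\<xi> - \<eta>)
          - cinner \<zeta> (\<xi> - \<eta>) * cnj (cinner \<zeta> (\<xi> - \<eta>)) / complex_of_real ((norm \<zeta>)\<^sup>2)"
        unfolding * using nz by (simp add: c_def cinner_self[of \<zeta>] field_simps)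
      finally show ?thesis
        by (simp add: cinner_self \<open>norm (\<xi> - \<eta>) = d\<close> complex_norm_square[unfolded of_real_power])
    qed
    ultimately have "(cmod (cinner \<zeta> (\<xi> - \<eta>)))\<^sup>2 / (norm \<zeta>)\<^sup>2 \<le> 0"
      unfolding of_real_eq_iff by linarith
    then show ?thesis
      using nz by (simp add: divide_le_0_iff)
  qed simp
  with \<open>\<eta> \<in> M\<close> show ?thesis
    by blast
qed

lemma orth_proj_unique:
  assumes "csubspace M" "\<eta> \<in> M" "\<And>\<zeta>. \<zeta> \<in> M \<Longrightarrow> cinner \<zeta> (\<xi> - \<eta>) = 0"
  shows "orth_proj M \<xi> = \<eta>"
  unfolding orth_proj_def
proof (rule the_equality)
  fix \<eta>' assume \<eta>': "\<eta>' \<in> M \<and> (\<forall>\<zeta>\<in>M. cinner \<zeta> (\<xi> - \<eta>') = 0)"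
  then have m: "\<eta>' - \<eta> \<in> M"
    using assms csubspace_diff by blast
  have "cinner (\<eta>' - \<eta>) (\<eta>' - \<eta>) = cinner (\<eta>' - \<eta>) (\<xi> - \<eta>) - cinner (\<eta>' - \<eta>) (\<xi> - \<eta>')"
    by (simp add: cinner.diff_right)
  also have "\<dots> = 0"
    using assms(3)[OF m] \<eta>' m by simp
  finally show "\<eta>' = \<eta>"
    by (simp add: cinner_self)
qed (use assms in auto)

lemma
  fixes M :: "'a::{complex_inner,banach} set"
  assumes "csubspace M" "closed M"
  shows orth_proj_in: "orth_proj M \<xi> \<in> M"
    and orth_proj_orth: "\<zeta> \<in> M \<Longrightarrow> cinner \<zeta> (\<xi> - orth_proj M \<xi>) = 0"
proof -
  obtain \<eta> where \<eta>: "\<eta> \<in> M" "\<And>\<zeta>. \<zeta> \<in> M \<Longrightarrow> cinner \<zeta> (\<xi> - \<eta>) = 0"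
    using projection_exists[OF assms] by blast
  then have "orth_proj M \<xi> = \<eta>"
    by (intro orth_proj_unique assms)
  then show "orth_proj M \<xi> \<in> M" "\<zeta> \<in> M \<Longrightarrow> cinner \<zeta> (\<xi> - orth_proj M \<xi>) = 0"
    using \<eta> by auto
qed

lemma orth_proj_fixed: "csubspace M \<Longrightarrow> \<xi> \<in> M \<Longrightarrow> orth_proj M \<xi> = \<xi>"
  by (rule orth_proj_unique) auto

lemma norm_orth_proj_le:
  fixes M :: "'a::{complex_inner,banach} set"
  assumes "csubspace M" "closed M"
  shows "norm (orth_proj M \<xi>) \<le> norm \<xi>"
proof -
  let ?p = "orth_proj M \<xi>"
  have "cinner ?p ?p = cinner ?p \<xi>"
    using orth_proj_orth[OF assms orth_proj_in[OF assms], of \<xi> \<xi>] by (simp add: cinner.diff_right)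
  then have "(norm ?p)\<^sup>2 \<le> norm ?p * norm \<xi>"
    using cmod_cinner_le[of ?p \<xi>] by (simp add: norm_sq_cinner)
  then show ?thesis
    by (cases "norm ?p = 0") (auto simp: power2_eq_square)
qed

lemma
  fixes M :: "'a::{complex_inner,banach} set"
  assumes "csubspace M" "closed M"
  shows orth_proj_add: "orth_proj M (\<xi> + \<eta>) = orth_proj M \<xi> + orth_proj M \<eta>"
    and orth_proj_scaleC: "orth_proj M (c *\<^sub>C \<xi>) = c *\<^sub>C orth_proj M \<xi>"
proof -
  note P = orth_proj_in[OF assms] orth_proj_orth[OF assms]
  show "orth_proj M (\<xi> + \<eta>) = orth_proj M \<xi> + orth_proj M \<eta>"
  proof (rule orth_proj_unique[OF assms(1)])
    show "orth_proj M \<xi> + orth_proj M \<eta> \<in> M"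
      using P(1) assms(1) by (simp add: csubspace_def)
    fix \<zeta> assume "\<zeta> \<in> M"
    from P(2)[OF this, of \<xi>] P(2)[OF this, of \<eta>]
    show "cinner \<zeta> (\<xi> + \<eta> - (orth_proj M \<xi> + orth_proj M \<eta>)) = 0"
      by (simp add: cinner.diff_right cinner.add_right)
  qed
  show "orth_proj M (c *\<^sub>C \<xi>) = c *\<^sub>C orth_proj M \<xi>"
  proof (rule orth_proj_unique[OF assms(1)])
    show "c *\<^sub>C orth_proj M \<xi> \<in> M"
      using P(1) assms(1) by (simp add: csubspace_def)
    fix \<zeta> assume "\<zeta> \<in> M"
    from P(2)[OF this, of \<xi>]
    show "cinner \<zeta> (c *\<^sub>C \<xi> - c *\<^sub>C orth_proj M \<xi>) = 0"
      by (simp add: cinner_scaleC_right flip: scaleC_diff_right)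
  qed
qed

lemma bounded_linear_orth_proj:
  fixes M :: "'a::{complex_inner,banach} set"
  assumes "csubspace M" "closed M"
  shows "bounded_linear (orth_proj M)"
  by (rule bounded_linear_intro[where K = 1])
     (auto simp: orth_proj_add[OF assms] scaleR_scaleC orth_proj_scaleC[OF assms]
       norm_orth_proj_le[OF assms])

text \<open>There is essentially one direction \<open>w\<close> orthogonal to the kernel:
  subtracting a multiple of \<open>w\<close> puts any vector into the kernel, so the inner product
  with \<open>w\<close> reads off the value of \<open>f\<close>.\<close>

lemma riesz_representation:
  fixes f :: "'a::{complex_inner,banach} \<Rightarrow> complex"
  assumes f: "bounded_linear f" and fc: "\<And>c \<xi>. f (c *\<^sub>C \<xi>) = c * f \<xi>"
  shows "\<exists>\<eta>. \<forall>\<xi>. f \<xi> = cinner \<eta> \<xi>"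
proof (cases "\<forall>\<xi>. f \<xi> = 0")
  case True
  then show ?thesis
    by (intro exI[of _ 0]) (simp add: cinner.zero_left)
next
  case False
  then obtain v where v: "f v \<noteq> 0"
    by blast
  interpret f: bounded_linear f by fact
  define M where "M = {\<xi>. f \<xi> = 0}"
  have M: "csubspace M"
    by (auto simp: M_def csubspace_def f.add fc)
  have "closed M"
    unfolding M_def by (intro closed_Collect_eq f.continuous_on continuous_on_id continuous_on_const)
  define w where "w = v - orth_proj M v"
  have "f (orth_proj M v) = 0"
    using orth_proj_in[OF M \<open>closed M\<close>, of v] by (simp add: M_def)
  then have fw: "f w = f v"
    by (simp add: w_def f.diff)
  then have "w \<noteq> 0"
    using v by (auto simp: f.zero)
  have "f \<xi> = cinner ((cnj (f w) / complex_of_real ((norm w)\<^sup>2)) *\<^sub>C w) \<xi>" for \<xi>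
  proof -
    have "\<xi> - (f \<xi> / f w) *\<^sub>C w \<in> M"
      using v fw by (simp add: M_def f.diff fc)
    then have "cinner (\<xi> - (f \<xi> / f w) *\<^sub>C w) w = 0"
      using orth_proj_orth[OF M \<open>closed M\<close>] w_def by blast
    then have "cinner w (\<xi> - (f \<xi> / f w) *\<^sub>C w) = 0"
      by (metis cinner_commute complex_cnj_zero)
    then have "cinner w \<xi> = (f \<xi> / f w) * cinner w w"
      by (simp add: cinner.diff_right cinner_scaleC_right)
    then show ?thesis
      using v fw \<open>w \<noteq> 0\<close> by (simp add: cinner_scaleC_left cinner_self)
  qed
  then show ?thesis
    by blast
qed

subsection \<open>Adjoints\<close>

text \<open>Complex linearity must be assumed, since the operator type also contains merely real
  linear maps. It makes each coefficient a functional to which Riesz applies, and so gives the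
  description \<open>adj\<close> a meaning.\<close>

lemma adjoint_exists:
  fixes x :: "'a::{complex_inner,banach} \<Rightarrow>\<^sub>L 'a"
  assumes "x \<in> clinear_ops"
  shows "\<exists>y. \<forall>\<xi> \<eta>. cinner (x \<xi>) \<eta> = cinner \<xi> (blinfun_apply y \<eta>)"
proof -
  have "\<exists>\<zeta>. \<forall>\<xi>. cinner \<eta> (x \<xi>) = cinner \<zeta> \<xi>" for \<eta>
  proof (rule riesz_representation)
    show "bounded_linear (\<lambda>\<xi>. cinner \<eta> (x \<xi>))"
      by (rule bounded_linear_compose[OF cinner.bounded_linear_right blinfun.bounded_linear_right])
    show "cinner \<eta> (x (c *\<^sub>C \<xi>)) = c * cinner \<eta> (x \<xi>)" for c \<xi>
      using assms by (simp add: clinear_ops_def cinner_scaleC_right)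
  qed
  then obtain y where "\<And>\<eta> \<xi>. cinner \<eta> (x \<xi>) = cinner (y \<eta>) \<xi>"
    by metis
  then have y: "cinner (x \<xi>) \<eta> = cinner \<xi> (y \<eta>)" for \<xi> \<eta>
    by (metis cinner_commute)
  have "bounded_linear y"
  proof (rule bounded_linear_intro[where K = "norm x"])
    show "y (\<xi> + \<eta>) = y \<xi> + y \<eta>" for \<xi> \<eta>
      by (rule cinner_ext) (simp add: y[symmetric] cinner.add_right)
    show "y (r *\<^sub>R \<xi>) = r *\<^sub>R y \<xi>" for r \<xi>
      by (rule cinner_ext) (simp add: y[symmetric] cinner.scaleR_right)
    show "norm (y \<xi>) \<le> norm \<xi> * norm x" for \<xi>
    proof -
      have "cinner (y \<xi>) (y \<xi>) = cinner (x (y \<xi>)) \<xi>"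
        by (simp add: y)
      then have "(norm (y \<xi>))\<^sup>2 \<le> norm (x (y \<xi>)) * norm \<xi>"
        using cmod_cinner_le[of "x (y \<xi>)" \<xi>] by (simp add: norm_sq_cinner)
      also have "\<dots> \<le> norm x * norm (y \<xi>) * norm \<xi>"
        by (intro mult_right_mono norm_blinfun) auto
      finally show ?thesis
        by (cases "norm (y \<xi>) = 0") (auto simp: power2_eq_square algebra_simps)
    qed
  qed
  then show ?thesis
    using y by (intro exI[of _ "Blinfun y"]) (simp add: bounded_linear_Blinfun_apply)
qed

lemma adj_eqI:
  assumes "\<And>\<xi> \<eta>. cinner (blinfun_apply x \<xi>) \<eta> = cinner \<xi> (blinfun_apply y \<eta>)"
  shows "adj x = y"
  unfolding adj_def
proof (rule the_equality)
  show "\<forall>\<xi> \<eta>. cinner (x \<xi>) \<eta> = cinner \<xi> (y \<eta>)"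
    using assms by blast
  fix z assume "\<forall>\<xi> \<eta>. cinner (x \<xi>) \<eta> = cinner \<xi> (blinfun_apply z \<eta>)"
  then show "z = y"
    using assms by (intro blinfun_eqI cinner_ext) metis
qed

lemma cinner_adj_right:
  fixes x :: "'a::{complex_inner,banach} \<Rightarrow>\<^sub>L 'a"
  assumes "x \<in> clinear_ops"
  shows "cinner \<xi> (adj x \<eta>) = cinner (x \<xi>) \<eta>"
  using adjoint_exists[OF assms] adj_eqI by metis

lemma cinner_adj_left:
  fixes x :: "'a::{complex_inner,banach} \<Rightarrow>\<^sub>L 'a"
  assumes "x \<in> clinear_ops"
  shows "cinner (adj x \<xi>) \<eta> = cinner \<xi> (x \<eta>)"
  by (metis assms cinner_adj_right cinner_commute)

lemma adj_clinear:
  fixes x :: "'a::{complex_inner,banach} \<Rightarrow>\<^sub>L 'a"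
  assumes "x \<in> clinear_ops"
  shows "adj x \<in> clinear_ops"
  unfolding clinear_ops_def
proof (intro CollectI allI cinner_ext)
  show "cinner \<zeta> (adj x (c *\<^sub>C \<xi>)) = cinner \<zeta> (c *\<^sub>C adj x \<xi>)" for \<zeta> c \<xi>
    by (simp add: cinner_adj_right[OF assms] cinner_scaleC_right)
qed

lemma adj_adj:
  fixes x :: "'a::{complex_inner,banach} \<Rightarrow>\<^sub>L 'a"
  assumes "x \<in> clinear_ops"
  shows "adj (adj x) = x"
  by (rule adj_eqI) (simp add: cinner_adj_left[OF assms])

lemma clinear_compose: "x \<in> clinear_ops \<Longrightarrow> y \<in> clinear_ops \<Longrightarrow> x o\<^sub>L y \<in> clinear_ops"
  by (simp add: clinear_ops_def)

lemma clinear_add: "x \<in> clinear_ops \<Longrightarrow> y \<in> clinear_ops \<Longrightarrow> x + y \<in> clinear_ops"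
  by (simp add: clinear_ops_def blinfun.add_left scaleC_add_right)

lemma clinear_diff: "x \<in> clinear_ops \<Longrightarrow> y \<in> clinear_ops \<Longrightarrow> x - y \<in> clinear_ops"
  by (simp add: clinear_ops_def blinfun.diff_left scaleC_diff_right)

lemma clinear_id: "id_blinfun \<in> clinear_ops"
  by (simp add: clinear_ops_def)

lemma adj_compose:
  fixes x y :: "'a::{complex_inner,banach} \<Rightarrow>\<^sub>L 'a"
  assumes "x \<in> clinear_ops" "y \<in> clinear_ops"
  shows "adj (x o\<^sub>L y) = adj y o\<^sub>L adj x"
  by (rule adj_eqI) (simp add: cinner_adj_right assms)

definition proj_op :: "'a::{complex_inner,banach} set \<Rightarrow> 'a \<Rightarrow>\<^sub>L 'a" where
  "proj_op M = Blinfun (orth_proj M)"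

lemma
  fixes M :: "'a::{complex_inner,banach} set"
  assumes "csubspace M" "closed M"
  shows proj_op_apply: "proj_op M \<xi> = orth_proj M \<xi>"
    and proj_op_clinear: "proj_op M \<in> clinear_ops"
  using assms by (auto simp: proj_op_def bounded_linear_Blinfun_apply bounded_linear_orth_proj
      clinear_ops_def orth_proj_scaleC)

text \<open>Invariance under \<open>adj x\<close> says that \<open>x\<close> also preserves the
  orthogonal complement, so \<open>M\<close> reduces \<open>x\<close>. In this way invariant
  subspaces yield elements of commutants.\<close>

lemma proj_op_commutes:
  fixes M :: "'a::{complex_inner,banach} set"
  assumes M: "csubspace M" "closed M" and x: "x \<in> clinear_ops"
    and inv: "\<And>\<xi>. \<xi> \<in> M \<Longrightarrow> x \<xi> \<in> M" "\<And>\<xi>. \<xi> \<in> M \<Longrightarrow> adj x \<xi> \<in> M"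
  shows "x o\<^sub>L proj_op M = proj_op M o\<^sub>L x"
proof (rule blinfun_eqI)
  fix \<xi>
  have "orth_proj M (x \<xi>) = x (orth_proj M \<xi>)"
  proof (rule orth_proj_unique[OF M(1)])
    show "x (orth_proj M \<xi>) \<in> M"
      by (intro inv orth_proj_in M)
    fix \<zeta> assume "\<zeta> \<in> M"
    have "cinner \<zeta> (x \<xi> - x (orth_proj M \<xi>)) = cinner (adj x \<zeta>) (\<xi> - orth_proj M \<xi>)"
      by (simp add: cinner_adj_left[OF x] blinfun.diff_right)
    then show "cinner \<zeta> (x \<xi> - x (orth_proj M \<xi>)) = 0"
      using orth_proj_orth[OF M inv(2)[OF \<open>\<zeta> \<in> M\<close>]] by simp
  qed
  then show "(x o\<^sub>L proj_op M) \<xi> = (proj_op M o\<^sub>L x) \<xi>"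
    by (simp add: proj_op_apply[OF M])
qed

text \<open>The double orthogonal complement: applied to the residual
  \<open>\<xi> - orth_proj M \<xi>\<close>, the hypothesis makes that vector orthogonal to
  itself.\<close>

lemma orth_dense:
  fixes M :: "'a::{complex_inner,banach} set"
  assumes "csubspace M" "closed M" "\<And>\<eta>. (\<forall>\<zeta>\<in>M. cinner \<zeta> \<eta> = 0) \<Longrightarrow> cinner \<eta> \<xi> = 0"
  shows "\<xi> \<in> M"
proof -
  let ?\<eta> = "\<xi> - orth_proj M \<xi>"
  have "cinner ?\<eta> \<xi> = 0"
    using assms(3) orth_proj_orth[OF assms(1,2)] by blast
  moreover have "cinner (orth_proj M \<xi>) ?\<eta> = 0"
    by (intro orth_proj_orth orth_proj_in assms)
  then have "cinner ?\<eta> (orth_proj M \<xi>) = 0"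
    by (metis cinner_commute complex_cnj_zero)
  ultimately have "cinner ?\<eta> ?\<eta> = 0"
    by (simp add: cinner.diff_right)
  then have "\<xi> = orth_proj M \<xi>"
    by (simp add: cinner_self)
  then show ?thesis
    by (metis orth_proj_in[OF assms(1,2)])
qed

subsection \<open>Unitary operators\<close>

lemma
  assumes "unitary_op u"
  shows unitary_clinear: "u \<in> clinear_ops"
    and unitary_adj_apply: "adj u (u \<xi>) = \<xi>"
    and unitary_apply_adj: "u (adj u \<xi>) = \<xi>"
  using assms unfolding unitary_op_def
  by (auto dest: arg_cong[of _ _ "\<lambda>x. blinfun_apply x \<xi>"])

lemma unitary_cinner:
  fixes u :: "'a::{complex_inner,banach} \<Rightarrow>\<^sub>L 'a"
  assumes "unitary_op u"
  shows "cinner (u \<xi>) (u \<eta>) = cinner \<xi> \<eta>"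
  by (metis assms cinner_adj_right unitary_adj_apply unitary_clinear)

lemma unitary_norm:
  fixes u :: "'a::{complex_inner,banach} \<Rightarrow>\<^sub>L 'a"
  assumes "unitary_op u"
  shows "norm (u \<xi>) = norm \<xi>"
  by (metis assms cinner_self norm_ge_zero of_real_eq_iff power2_eq_imp_eq unitary_cinner)

lemma unitary_adj_norm:
  fixes u :: "'a::{complex_inner,banach} \<Rightarrow>\<^sub>L 'a"
  assumes "unitary_op u"
  shows "norm (adj u \<xi>) = norm \<xi>"
  by (metis assms unitary_apply_adj unitary_norm)

lemma conj_by_apply: "conj_by u x \<xi> = u (x (adj u \<xi>))"
  by (simp add: conj_by_def)

lemma norm_conj_by_le:
  fixes u :: "'a::{complex_inner,banach} \<Rightarrow>\<^sub>L 'a"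
  assumes "unitary_op u"
  shows "norm (conj_by u x) \<le> norm x"
  by (rule norm_blinfun_bound)
     (auto simp: conj_by_apply unitary_norm[OF assms] intro: order_trans[OF norm_blinfun]
       simp: unitary_adj_norm[OF assms])

lemma unitary_fixed_adj: "unitary_op u \<Longrightarrow> u \<xi> = \<xi> \<Longrightarrow> adj u \<xi> = \<xi>"
  by (metis unitary_adj_apply)

lemma conj_by_fixed_iff:
  fixes u :: "'a::{complex_inner,banach} \<Rightarrow>\<^sub>L 'a"
  assumes "unitary_op u"
  shows "conj_by u x = x \<longleftrightarrow> u o\<^sub>L x = x o\<^sub>L u"
proof
  assume "conj_by u x = x"
  then show "u o\<^sub>L x = x o\<^sub>L u"
    by (metis assms blinfun_apply_blinfun_compose blinfun_eqI conj_by_apply unitary_adj_apply)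
next
  assume "u o\<^sub>L x = x o\<^sub>L u"
  then have "u (x \<xi>) = x (u \<xi>)" for \<xi>
    by (metis blinfun_apply_blinfun_compose)
  then show "conj_by u x = x"
    by (intro blinfun_eqI) (simp add: conj_by_apply unitary_apply_adj[OF assms])
qed

subsection \<open>Commutants\<close>

lemma commutant_antimono: "S \<subseteq> T \<Longrightarrow> commutant T \<subseteq> commutant S"
  by (auto simp: commutant_def)

lemma commutant_bicommutant: "S \<subseteq> clinear_ops \<Longrightarrow> S \<subseteq> commutant (commutant S)"
  by (auto simp: commutant_def)

lemma commutant_triple:
  assumes "S \<subseteq> clinear_ops"
  shows "commutant (commutant (commutant S)) = commutant S"
proof
  show "commutant (commutant (commutant S)) \<subseteq> commutant S"
    by (intro commutant_antimono commutant_bicommutant assms)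
  show "commutant S \<subseteq> commutant (commutant (commutant S))"
    by (rule commutant_bicommutant) (auto simp: commutant_def)
qed

lemma commutant_adj:
  fixes S :: "('a::{complex_inner,banach} \<Rightarrow>\<^sub>L 'a) set"
  assumes S: "S \<subseteq> clinear_ops" "\<And>x. x \<in> S \<Longrightarrow> adj x \<in> S" and y: "y \<in> commutant S"
  shows "adj y \<in> commutant S"
proof -
  have yc: "y \<in> clinear_ops"
    using y by (simp add: commutant_def)
  have "x o\<^sub>L adj y = adj y o\<^sub>L x" if "x \<in> S" for x
  proof -
    have "adj (adj x o\<^sub>L y) = adj (y o\<^sub>L adj x)"
      using y S(2)[OF that] by (simp add: commutant_def)
    moreover have "x \<in> clinear_ops"
      using that S by blast
    ultimately show ?thesis
      by (simp add: adj_compose adj_clinear yc adj_adj)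
  qed
  then show ?thesis
    by (simp add: commutant_def adj_clinear yc)
qed

lemma von_neumann_bicommutant:
  fixes S :: "('a::{complex_inner,banach} \<Rightarrow>\<^sub>L 'a) set"
  assumes S: "S \<subseteq> clinear_ops" "\<And>x. x \<in> S \<Longrightarrow> adj x \<in> S"
  shows "von_neumann_algebra (commutant (commutant S))"
  unfolding von_neumann_algebra_def
proof (intro conjI ballI)
  show "commutant (commutant S) \<subseteq> clinear_ops"
    by (auto simp: commutant_def)
  show "adj x \<in> commutant (commutant S)" if "x \<in> commutant (commutant S)" for x
  proof (rule commutant_adj[OF _ _ that])
    show "commutant S \<subseteq> clinear_ops"
      by (auto simp: commutant_def)
  qed (rule commutant_adj[OF S])
  show "commutant (commutant (commutant (commutant S))) = commutant (commutant S)"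
    by (subst commutant_triple[OF S(1)]) simp
qed

lemma vN_generated_superset: "S \<subseteq> vN_generated S"
  by (auto simp: vN_generated_def)

lemma vN_generated_bicommutant:
  fixes S :: "('a::{complex_inner,banach} \<Rightarrow>\<^sub>L 'a) set"
  assumes S: "S \<subseteq> clinear_ops" "\<And>x. x \<in> S \<Longrightarrow> adj x \<in> S"
  shows "vN_generated S \<subseteq> commutant (commutant S)"
  unfolding vN_generated_def
  using von_neumann_bicommutant[OF S] commutant_bicommutant[OF S(1)] by blast

lemma vN_generated_commutes:
  fixes S :: "('a::{complex_inner,banach} \<Rightarrow>\<^sub>L 'a) set"
  assumes "S \<subseteq> clinear_ops" "\<And>x. x \<in> S \<Longrightarrow> adj x \<in> S" "p \<in> commutant S" "n \<in> vN_generated S"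
  shows "n o\<^sub>L p = p o\<^sub>L n"
  using vN_generated_bicommutant[OF assms(1,2)] assms(3,4) by (auto simp: commutant_def)

lemma blinfun_assoc: "(x o\<^sub>L y) o\<^sub>L z = x o\<^sub>L (y o\<^sub>L z)"
  by (rule blinfun_eqI) simp

lemma commutant_compose: "x \<in> commutant S \<Longrightarrow> y \<in> commutant S \<Longrightarrow> x o\<^sub>L y \<in> commutant S"
  unfolding commutant_def by (auto simp: clinear_compose) (metis blinfun_assoc)

lemma commutant_add: "x \<in> commutant S \<Longrightarrow> y \<in> commutant S \<Longrightarrow> x + y \<in> commutant S"
  by (auto simp: commutant_def clinear_add bounded_bilinear.add_left[OF bounded_bilinear_blinfun_compose]
      bounded_bilinear.add_right[OF bounded_bilinear_blinfun_compose])

lemma commutant_diff: "x \<in> commutant S \<Longrightarrow> y \<in> commutant S \<Longrightarrow> x - y \<in> commutant S"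
  by (auto simp: commutant_def clinear_diff bounded_bilinear.diff_left[OF bounded_bilinear_blinfun_compose]
      bounded_bilinear.diff_right[OF bounded_bilinear_blinfun_compose])

lemma commutant_id: "S \<subseteq> clinear_ops \<Longrightarrow> id_blinfun \<in> commutant S"
  by (auto simp: commutant_def clinear_id intro!: blinfun_eqI)

definition scaleC_op :: "complex \<Rightarrow> 'a::complex_inner \<Rightarrow>\<^sub>L 'a" where
  "scaleC_op c = Blinfun (\<lambda>\<xi>. c *\<^sub>C \<xi>)"

lemma scaleC_op_apply [simp]: "scaleC_op c \<xi> = c *\<^sub>C \<xi>"
  by (simp add: scaleC_op_def bounded_linear_Blinfun_apply bounded_linear_scaleC)

lemma scaleC_op_commutant: "S \<subseteq> clinear_ops \<Longrightarrow> scaleC_op c \<in> commutant S"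
  by (auto simp: commutant_def clinear_ops_def scaleC_scaleC mult.commute intro!: blinfun_eqI)

lemma
  assumes "von_neumann_algebra M"
  shows vN_clinear: "M \<subseteq> clinear_ops"
    and vN_adj: "x \<in> M \<Longrightarrow> adj x \<in> M"
    and vN_compose: "x \<in> M \<Longrightarrow> y \<in> M \<Longrightarrow> x o\<^sub>L y \<in> M"
    and vN_add: "x \<in> M \<Longrightarrow> y \<in> M \<Longrightarrow> x + y \<in> M"
    and vN_diff: "x \<in> M \<Longrightarrow> y \<in> M \<Longrightarrow> x - y \<in> M"
    and vN_id: "id_blinfun \<in> M"
    and vN_scaleC: "scaleC_op c \<in> M"
proof -
  have M: "commutant (commutant M) = M" "M \<subseteq> clinear_ops"
    using assms by (auto simp: von_neumann_algebra_def)
  have c: "commutant M \<subseteq> clinear_ops"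
    by (auto simp: commutant_def)
  show "M \<subseteq> clinear_ops" "x \<in> M \<Longrightarrow> adj x \<in> M"
    using assms by (auto simp: von_neumann_algebra_def)
  show "x \<in> M \<Longrightarrow> y \<in> M \<Longrightarrow> x o\<^sub>L y \<in> M"
    using commutant_compose[of x "commutant M" y] M by simp
  show "x \<in> M \<Longrightarrow> y \<in> M \<Longrightarrow> x + y \<in> M"
    using commutant_add[of x "commutant M" y] M by simp
  show "x \<in> M \<Longrightarrow> y \<in> M \<Longrightarrow> x - y \<in> M"
    using commutant_diff[of x "commutant M" y] M by simp
  show "id_blinfun \<in> M"
    using commutant_id[OF c] M by simp
  show "scaleC_op c \<in> M"
    using scaleC_op_commutant[OF c] M by simp
qed

lemma vN_generated_vN:
  fixes S :: "('a::{complex_inner,banach} \<Rightarrow>\<^sub>L 'a) set"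
  assumes "S \<subseteq> clinear_ops" "\<And>x. x \<in> S \<Longrightarrow> adj x \<in> S"
  shows "x \<in> vN_generated S \<Longrightarrow> y \<in> vN_generated S \<Longrightarrow> x o\<^sub>L y \<in> vN_generated S"
    and "x \<in> vN_generated S \<Longrightarrow> y \<in> vN_generated S \<Longrightarrow> x + y \<in> vN_generated S"
    and "scaleC_op c \<in> vN_generated S"
  unfolding vN_generated_def by (auto intro: vN_compose vN_add vN_scaleC)

text \<open>Phrased with closure properties only, so that it covers local algebras as well as
  generated ones.\<close>

lemma csubspace_orbit:
  assumes "\<And>x y. x \<in> N \<Longrightarrow> y \<in> N \<Longrightarrow> x o\<^sub>L y \<in> N" "\<And>x y. x \<in> N \<Longrightarrow> y \<in> N \<Longrightarrow> x + y \<in> N"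
    and "\<And>c. scaleC_op c \<in> N"
  shows "csubspace ((\<lambda>x. blinfun_apply x \<xi>) ` N)"
  unfolding csubspace_def
proof (intro conjI ballI allI)
  show "0 \<in> (\<lambda>x. blinfun_apply x \<xi>) ` N"
    by (rule image_eqI[of _ _ "scaleC_op 0"]) (auto simp: assms)
next
  fix a b assume "a \<in> (\<lambda>x. blinfun_apply x \<xi>) ` N" "b \<in> (\<lambda>x. blinfun_apply x \<xi>) ` N"
  then obtain x y where "x \<in> N" "y \<in> N" "a = x \<xi>" "b = y \<xi>"
    by blast
  then show "a + b \<in> (\<lambda>x. blinfun_apply x \<xi>) ` N"
    by (intro image_eqI[of _ _ "x + y"]) (auto simp: assms blinfun.add_left)
next
  fix c a assume "a \<in> (\<lambda>x. blinfun_apply x \<xi>) ` N"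
  then obtain x where "x \<in> N" "a = x \<xi>"
    by blast
  then show "c *\<^sub>C a \<in> (\<lambda>x. blinfun_apply x \<xi>) ` N"
    by (intro image_eqI[of _ _ "scaleC_op c o\<^sub>L x"]) (auto simp: assms)
qed

lemma csubspace_vN_orbit: "von_neumann_algebra M \<Longrightarrow> csubspace ((\<lambda>x. blinfun_apply x \<xi>) ` M)"
  by (rule csubspace_orbit) (auto intro: vN_compose vN_add vN_scaleC)

subsection \<open>Strong limits\<close>

text \<open>A three-term estimate: the uniform bound makes the error of replacing
  \<open>\<xi>\<close> by a nearby vector of \<open>D\<close> independent of
  \<open>n\<close>.\<close>

lemma strong_limit_on_dense:
  fixes X :: "nat \<Rightarrow> ('a::real_normed_vector \<Rightarrow> 'b::banach)"
  assumes lin: "\<And>n. linear (X n)" and bound: "\<And>n \<xi>. norm (X n \<xi>) \<le> C * norm \<xi>"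
    and dense: "closure D = UNIV" and conv: "\<And>\<xi>. \<xi> \<in> D \<Longrightarrow> convergent (\<lambda>n. X n \<xi>)"
  shows "convergent (\<lambda>n. X n \<xi>)"
proof -
  define C' where "C' = \<bar>C\<bar> + 1"
  have C': "norm (X n \<xi>) \<le> C' * norm \<xi>" "C' > 0" for n \<xi>
  proof -
    show "norm (X n \<xi>) \<le> C' * norm \<xi>"
      by (rule order_trans[OF bound mult_right_mono]) (auto simp: C'_def)
  qed (simp add: C'_def)
  have "Cauchy (\<lambda>n. X n \<xi>)"
  proof (rule metric_CauchyI)
    fix e :: real assume "e > 0"
    have "\<xi> \<in> closure D"
      using dense by simp
    then obtain \<eta> where \<eta>: "\<eta> \<in> D" "dist \<eta> \<xi> < e / (3 * C')"
      using \<open>e > 0\<close> C'(2) closure_approachable[of \<xi> D] by (metis divide_pos_pos zero_less_mult_iff zero_less_numeral)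
    have "Cauchy (\<lambda>n. X n \<eta>)"
      using conv[OF \<eta>(1)] by (rule convergent_Cauchy)
    then obtain N where N: "\<And>m n. m \<ge> N \<Longrightarrow> n \<ge> N \<Longrightarrow> dist (X m \<eta>) (X n \<eta>) < e / 3"
      using \<open>e > 0\<close> unfolding Cauchy_altdef2 by (metis Cauchy_def \<open>Cauchy (\<lambda>n. X n \<eta>)\<close> divide_pos_pos zero_less_numeral)
    have close: "dist (X n \<xi>) (X n \<eta>) < e / 3" for n
    proof -
      have "dist (X n \<xi>) (X n \<eta>) = norm (X n (\<xi> - \<eta>))"
        by (simp add: dist_norm linear_diff[OF lin])
      also have "\<dots> \<le> C' * norm (\<xi> - \<eta>)"
        by (rule C')
      also have "\<dots> < C' * (e / (3 * C'))"
        using \<eta>(2) C'(2) by (intro mult_strict_left_mono) (auto simp: dist_norm norm_minus_commute)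
      finally show ?thesis
        using C'(2) by simp
    qed
    have "dist (X m \<xi>) (X n \<xi>) < e" if "m \<ge> N" "n \<ge> N" for m n
      using N[OF that] close[of m] close[of n]
        dist_triangle[of "X m \<xi>" "X n \<xi>" "X m \<eta>"] dist_triangle[of "X m \<eta>" "X n \<xi>" "X n \<eta>"]
      by (simp add: dist_commute)
    then show "\<exists>M. \<forall>m\<ge>M. \<forall>n\<ge>M. dist (X m \<xi>) (X n \<xi>) < e"
      by blast
  qed
  then show ?thesis
    by (simp add: Cauchy_convergent)
qed

lemma strong_limit_operator:
  fixes X :: "nat \<Rightarrow> ('a::{complex_inner,banach} \<Rightarrow>\<^sub>L 'a)"
  assumes cl: "\<And>n. X n \<in> clinear_ops" and bound: "\<And>n. norm (X n) \<le> C"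
    and dense: "closure D = UNIV" and conv: "\<And>\<xi>. \<xi> \<in> D \<Longrightarrow> convergent (\<lambda>n. X n \<xi>)"
  obtains y where "y \<in> clinear_ops" "\<And>\<xi>. (\<lambda>n. X n \<xi>) \<longlonglongrightarrow> blinfun_apply y \<xi>"
proof -
  have b: "norm (X n \<xi>) \<le> C * norm \<xi>" for n \<xi>
    using norm_blinfun[of "X n" \<xi>] bound[of n] mult_right_mono[of _ _ "norm \<xi>"]
    by (meson norm_ge_zero order_trans)
  have L: "(\<lambda>n. X n \<xi>) \<longlonglongrightarrow> lim (\<lambda>n. X n \<xi>)" for \<xi>
    using strong_limit_on_dense[of "\<lambda>n. blinfun_apply (X n)", OF _ b dense conv]
    by (simp add: convergent_LIMSEQ_iff blinfun.bounded_linear_right bounded_linear.linear)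
  have bl: "bounded_linear (\<lambda>\<xi>. lim (\<lambda>n. X n \<xi>))"
  proof (rule bounded_linear_intro[where K = C])
    show "lim (\<lambda>n. X n (\<xi> + \<eta>)) = lim (\<lambda>n. X n \<xi>) + lim (\<lambda>n. X n \<eta>)" for \<xi> \<eta>
      using tendsto_add[OF L[of \<xi>] L[of \<eta>]] by (intro limI) (simp add: blinfun.add_right)
    show "lim (\<lambda>n. X n (r *\<^sub>R \<xi>)) = r *\<^sub>R lim (\<lambda>n. X n \<xi>)" for r \<xi>
      using tendsto_scaleR[OF tendsto_const L[of \<xi>], of r]
      by (intro limI) (simp add: blinfun.scaleR_right)
    show "norm (lim (\<lambda>n. X n \<xi>)) \<le> norm \<xi> * C" for \<xi>
      by (rule LIMSEQ_le_const2[OF tendsto_norm[OF L]]) (use b in \<open>auto simp: mult.commute\<close>)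
  qed
  show thesis
  proof
    show "(\<lambda>n. X n \<xi>) \<longlonglongrightarrow> Blinfun (\<lambda>\<xi>. lim (\<lambda>n. X n \<xi>)) \<xi>" for \<xi>
      using L by (simp add: bounded_linear_Blinfun_apply[OF bl])
    show "Blinfun (\<lambda>\<xi>. lim (\<lambda>n. X n \<xi>)) \<in> clinear_ops"
      unfolding clinear_ops_def
    proof (intro CollectI allI)
      fix c \<xi>
      have "lim (\<lambda>n. X n (c *\<^sub>C \<xi>)) = c *\<^sub>C lim (\<lambda>n. X n \<xi>)"
        using tendsto_scaleC[OF L[of \<xi>], of c] cl by (intro limI) (simp add: clinear_ops_def)
      then show "Blinfun (\<lambda>\<xi>. lim (\<lambda>n. X n \<xi>)) (c *\<^sub>C \<xi>)
          = c *\<^sub>C Blinfun (\<lambda>\<xi>. lim (\<lambda>n. X n \<xi>)) \<xi>"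
        by (simp add: bounded_linear_Blinfun_apply[OF bl])
    qed
  qed
qed

text \<open>Commutation with a fixed bounded operator survives pointwise limits, so a double
  commutant is closed under them.\<close>

lemma vN_strong_limit:
  assumes M: "von_neumann_algebra M" and X: "\<And>n. X n \<in> M" and y: "y \<in> clinear_ops"
    and lim: "\<And>\<xi>. (\<lambda>n. blinfun_apply (X n) \<xi>) \<longlonglongrightarrow> blinfun_apply y \<xi>"
  shows "y \<in> M"
proof -
  have "z o\<^sub>L y = y o\<^sub>L z" if z: "z \<in> commutant M" for z
  proof (rule blinfun_eqI)
    fix \<xi>
    have "(\<lambda>n. z (X n \<xi>)) \<longlonglongrightarrow> z (y \<xi>)"
      by (intro blinfun.tendsto tendsto_const lim)
    moreover have "z (X n \<xi>) = X n (z \<xi>)" for n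
      using z X[of n] unfolding commutant_def by (metis (mono_tags, lifting) blinfun_apply_blinfun_compose mem_Collect_eq)
    ultimately show "(z o\<^sub>L y) \<xi> = (y o\<^sub>L z) \<xi>"
      using LIMSEQ_unique lim[of "z \<xi>"] by fastforce
  qed
  then have "y \<in> commutant (commutant M)"
    using y by (simp add: commutant_def)
  then show ?thesis
    using M by (simp add: von_neumann_algebra_def)
qed

lemma blinfun_eq_on_dense:
  fixes x y :: "'a::real_normed_vector \<Rightarrow>\<^sub>L 'b::real_normed_vector"
  assumes "closure D = UNIV" "\<And>\<xi>. \<xi> \<in> D \<Longrightarrow> x \<xi> = y \<xi>"
  shows "x = y"
proof (rule blinfun_eqI)
  fix \<xi>
  have "closed {\<xi>. x \<xi> = y \<xi>}"
    by (intro closed_Collect_eq continuous_intros)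
  then have "closure D \<subseteq> {\<xi>. x \<xi> = y \<xi>}"
    using assms(2) by (intro closure_minimal) auto
  then show "x \<xi> = y \<xi>"
    using assms(1) by auto
qed

section \<open>The universal cover of the Moebius group\<close>

text \<open>The matrix acts on homogeneous coordinates; \<open>r\<close> may be negative, so lines
  and not rays are compared. Determinant and continuity are kept apart, so that matrices can be
  multiplied on their own.\<close>

definition mobius_matrix :: "(real \<Rightarrow> real) \<Rightarrow> real \<Rightarrow> real \<Rightarrow> real \<Rightarrow> real \<Rightarrow> bool" where
  "mobius_matrix f a b c d \<longleftrightarrow>
     (\<forall>\<theta>. \<exists>r. r \<noteq> 0 \<and> a * sin \<theta> + b * cos \<theta> = r * sin (f \<theta>) \<and>
                    c * sin \<theta> + d * cos \<theta> = r * cos (f \<theta>))"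

lemma mobius_cover_iff:
  "f \<in> mobius_cover \<longleftrightarrow>
     continuous_on UNIV f \<and> (\<exists>a b c d. a * d - b * c = 1 \<and> mobius_matrix f a b c d)"
  by (simp add: mobius_cover_def mobius_matrix_def)

lemma mobius_matrix_comp:
  assumes "mobius_matrix f a b c d" "mobius_matrix g a' b' c' d'"
  shows "mobius_matrix (f \<circ> g) (a * a' + b * c') (a * b' + b * d') (c * a' + d * c') (c * b' + d * d')"
  unfolding mobius_matrix_def
proof
  fix \<theta>
  obtain r where r: "r \<noteq> 0" "a' * sin \<theta> + b' * cos \<theta> = r * sin (g \<theta>)"
      "c' * sin \<theta> + d' * cos \<theta> = r * cos (g \<theta>)"
    using assms(2) unfolding mobius_matrix_def by metis
  obtain q where q: "q \<noteq> 0" "a * sin (g \<theta>) + b * cos (g \<theta>) = q * sin (f (g \<theta>))"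
      "c * sin (g \<theta>) + d * cos (g \<theta>) = q * cos (f (g \<theta>))"
    using assms(1) unfolding mobius_matrix_def by metis
  have "(a * a' + b * c') * sin \<theta> + (a * b' + b * d') * cos \<theta>
      = a * (a' * sin \<theta> + b' * cos \<theta>) + b * (c' * sin \<theta> + d' * cos \<theta>)"
    by (simp add: algebra_simps)
  also have "\<dots> = r * q * sin ((f \<circ> g) \<theta>)"
    unfolding r(2,3) comp_def mult.assoc[of r] q(2)[symmetric] by (simp add: algebra_simps)
  finally have 1: "(a * a' + b * c') * sin \<theta> + (a * b' + b * d') * cos \<theta> = r * q * sin ((f \<circ> g) \<theta>)" .
  have "(c * a' + d * c') * sin \<theta> + (c * b' + d * d') * cos \<theta>
      = c * (a' * sin \<theta> + b' * cos \<theta>) + d * (c' * sin \<theta> + d' * cos \<theta>)"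
    by (simp add: algebra_simps)
  also have "\<dots> = r * q * cos ((f \<circ> g) \<theta>)"
    unfolding r(2,3) comp_def mult.assoc[of r] q(3)[symmetric] by (simp add: algebra_simps)
  finally show "\<exists>r. r \<noteq> 0 \<and>
       (a * a' + b * c') * sin \<theta> + (a * b' + b * d') * cos \<theta> = r * sin ((f \<circ> g) \<theta>) \<and>
       (c * a' + d * c') * sin \<theta> + (c * b' + d * d') * cos \<theta> = r * cos ((f \<circ> g) \<theta>)"
    using 1 r(1) q(1) by (intro exI[of _ "r * q"]) simp
qed

lemma mobius_cover_comp:
  assumes "f \<in> mobius_cover" "g \<in> mobius_cover"
  shows "f \<circ> g \<in> mobius_cover"
proof -
  obtain a b c d where f: "continuous_on UNIV f" "a * d - b * c = 1" "mobius_matrix f a b c d"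
    using assms(1) unfolding mobius_cover_iff by blast
  obtain a' b' c' d' where g: "continuous_on UNIV g" "a' * d' - b' * c' = 1"
      "mobius_matrix g a' b' c' d'"
    using assms(2) unfolding mobius_cover_iff by blast
  have "(a * a' + b * c') * (c * b' + d * d') - (a * b' + b * d') * (c * a' + d * c')
      = (a * d - b * c) * (a' * d' - b' * c')"
    by (simp add: algebra_simps)
  also have "\<dots> = 1"
    by (simp add: f g)
  finally show ?thesis
    unfolding mobius_cover_iff
    using mobius_matrix_comp[OF f(3) g(3)] continuous_on_compose[OF g(1)] f(1)
    by (metis continuous_on_subset subset_UNIV)
qed

subsection \<open>Rotations and affine maps\<close>

definition rot :: "real \<Rightarrow> real \<Rightarrow> real" where
  "rot \<phi> \<theta> = \<theta> + \<phi>"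

lemma rot_matrix: "mobius_matrix (rot \<phi>) (cos \<phi>) (sin \<phi>) (- sin \<phi>) (cos \<phi>)"
  unfolding mobius_matrix_def rot_def
  by (intro allI exI[of _ 1]) (simp add: sin_add cos_add)

lemma rot_cover: "rot \<phi> \<in> mobius_cover"
  unfolding mobius_cover_iff
proof (intro conjI exI)
  show "continuous_on UNIV (rot \<phi>)"
    unfolding rot_def by (intro continuous_intros)
  show "cos \<phi> * cos \<phi> - sin \<phi> * (- sin \<phi>) = 1"
    using sin_cos_squared_add3[of \<phi>] by simp
qed (rule rot_matrix)

lemma rot_comp: "rot \<phi> \<circ> rot \<psi> = rot (\<phi> + \<psi>)"
  by (auto simp: rot_def)

lemma rot_0: "rot 0 = id"
  by (auto simp: rot_def)

lemma id_cover: "id \<in> mobius_cover"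
  using rot_cover[of 0] by (simp add: rot_0)

text \<open>The half-open cell contains exactly one lift of infinity, its left end, where
  \<open>affine_lift\<close> branches.\<close>

lemma real_cell:
  fixes \<theta> :: real
  obtains \<phi> k where "\<theta> = \<phi> + pi * of_int k" "k = round (\<theta> / pi)" "- (pi / 2) \<le> \<phi>" "\<phi> < pi / 2"
proof
  let ?k = "round (\<theta> / pi)"
  show "\<theta> = (\<theta> - pi * of_int ?k) + pi * of_int ?k"
    by simp
  have "of_int ?k \<le> \<theta> / pi + 1 / 2" "\<theta> / pi + 1 / 2 < of_int ?k + 1"
    unfolding round_def by linarith+
  then show "- (pi / 2) \<le> \<theta> - pi * of_int ?k" "\<theta> - pi * of_int ?k < pi / 2"
    by (simp_all add: field_simps)
qed simp

lemma affine_lift_cell: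
  assumes "- (pi / 2) < \<phi>" "\<phi> < pi / 2"
  shows "affine_lift \<alpha> \<beta> (\<phi> + pi * of_int k) = arctan (\<alpha> * tan \<phi> + \<beta>) + pi * of_int k"
proof -
  have c: "cos \<phi> > 0"
    using assms by (rule cos_gt_zero_pi)
  have "cos (\<phi> + pi * of_int k) \<noteq> 0"
    using c by (simp add: cos_add sin_int_times_real cos_int_times_real sin_zero_iff_int2 mult.commute)
  moreover have "round ((\<phi> + pi * of_int k) / pi) = k"
    using assms by (intro round_unique') (simp add: field_simps abs_if)
  moreover have "tan (\<phi> + pi * of_int k) = tan \<phi>"
    using tan_periodic_int[of \<phi> k] by (simp add: mult.commute)
  ultimately show ?thesis
    by (simp add: affine_lift_def)
qed

lemma affine_lift_pole: "affine_lift \<alpha> \<beta> (pi / 2 + pi * of_int k) = pi / 2 + pi * of_int k"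
proof -
  have "cos (pi / 2 + pi * of_int k) = 0"
    by (simp add: cos_add sin_zero_iff_int2 mult.commute)
  then show ?thesis
    by (simp add: affine_lift_def)
qed

lemma affine_lift_pole': "affine_lift \<alpha> \<beta> (- (pi / 2) + pi * of_int k) = - (pi / 2) + pi * of_int k"
  using affine_lift_pole[of \<alpha> \<beta> "k - 1"] by (simp add: algebra_simps)

lemma affine_lift_comp:
  "affine_lift \<alpha> \<beta> \<circ> affine_lift \<alpha>' \<beta>' = affine_lift (\<alpha> * \<alpha>') (\<alpha> * \<beta>' + \<beta>)"
proof
  fix \<theta> :: real
  obtain \<phi> k where \<theta>: "\<theta> = \<phi> + pi * of_int k" "- (pi / 2) \<le> \<phi>" "\<phi> < pi / 2"
    by (rule real_cell)
  show "(affine_lift \<alpha> \<beta> \<circ> affine_lift \<alpha>' \<beta>') \<theta> = affine_lift (\<alpha> * \<alpha>') (\<alpha> * \<beta>' + \<beta>) \<theta>"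
  proof (cases "\<phi> = - (pi / 2)")
    case True
    then show ?thesis
      unfolding \<theta> by (simp only: comp_def affine_lift_pole')
  next
    case False
    then have \<phi>: "- (pi / 2) < \<phi>"
      using \<theta> by simp
    show ?thesis
      unfolding \<theta>(1) comp_def affine_lift_cell[OF \<phi> \<theta>(3)]
      by (subst affine_lift_cell[OF arctan_lbound arctan_ubound])
         (simp add: tan_arctan algebra_simps)
  qed
qed

lemma affine_lift_id: "affine_lift 1 0 = id"
proof
  fix \<theta> :: real
  obtain \<phi> k where \<theta>: "\<theta> = \<phi> + pi * of_int k" "- (pi / 2) \<le> \<phi>" "\<phi> < pi / 2"
    by (rule real_cell)
  show "affine_lift 1 0 \<theta> = id \<theta>"
  proof (cases "\<phi> = - (pi / 2)")
    case True
    then show ?thesis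
      unfolding \<theta> by (simp only: id_def affine_lift_pole')
  next
    case False
    then have \<phi>: "- (pi / 2) < \<phi>"
      using \<theta> by simp
    show ?thesis
      unfolding \<theta>(1) affine_lift_cell[OF \<phi> \<theta>(3)] using arctan_tan[OF \<phi> \<theta>(3)] by simp
  qed
qed

text \<open>Serves continuity: a monotone surjection of the line is continuous, which avoids a limit
  argument at the lifts of infinity.\<close>

lemma affine_lift_mono:
  assumes "\<alpha> > 0"
  shows "mono (affine_lift \<alpha> \<beta>)"
proof (rule monoI)
  fix x y :: real assume "x \<le> y"
  obtain \<phi> k where x: "x = \<phi> + pi * of_int k" "- (pi / 2) \<le> \<phi>" "\<phi> < pi / 2"
    by (rule real_cell)
  obtain \<psi> l where y: "y = \<psi> + pi * of_int l" "- (pi / 2) \<le> \<psi>" "\<psi> < pi / 2"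
    by (rule real_cell)
  \<comment> \<open>The action on one cell. It maps the cell into itself, so points of different
    cells keep their order.\<close>
  define F where "F \<phi> = (if \<phi> = - (pi / 2) then \<phi> else arctan (\<alpha> * tan \<phi> + \<beta>))" for \<phi>
  have F: "affine_lift \<alpha> \<beta> (\<phi> + pi * of_int k) = F \<phi> + pi * of_int k"
    if "- (pi / 2) \<le> \<phi>" "\<phi> < pi / 2" for \<phi> k
    using that affine_lift_cell[of \<phi> \<alpha> \<beta> k] affine_lift_pole'[of \<alpha> \<beta> k] by (auto simp: F_def)
  have Fb: "- (pi / 2) \<le> F \<phi>" "F \<phi> < pi / 2" for \<phi>
    using arctan_lbound arctan_ubound by (auto simp: F_def less_imp_le)
  show "affine_lift \<alpha> \<beta> x \<le> affine_lift \<alpha> \<beta> y"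
  proof (cases "k = l")
    case True
    then have "\<phi> \<le> \<psi>"
      using x y \<open>x \<le> y\<close> by simp
    have "F \<phi> \<le> F \<psi>"
    proof (cases "\<phi> = - (pi / 2)")
      case True
      then show ?thesis
        using Fb(1)[of \<psi>] by (simp add: F_def)
    next
      case False
      then have "tan \<phi> \<le> tan \<psi>"
        using \<open>\<phi> \<le> \<psi>\<close> x y tan_mono_le[of \<phi> \<psi>] by simp
      then show ?thesis
        using False \<open>\<phi> \<le> \<psi>\<close> x assms by (simp add: F_def arctan_le_iff)
    qed
    then show ?thesis
      using True F[OF x(2,3)] F[OF y(2,3)] by (simp add: x(1) y(1))
  next
    case False
    have "k < l"
    proof (rule ccontr)
      assume "\<not> k < l"
      with False have "of_int l + 1 \<le> (of_int k :: real)"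
        by linarith
      then have "pi * (of_int l + 1) \<le> pi * of_int k"
        by (intro mult_left_mono) auto
      then show False
        using \<open>x \<le> y\<close> x y by (simp add: algebra_simps)
    qed
    then have "of_int k + 1 \<le> (of_int l :: real)"
      by linarith
    then have "pi * (of_int k + 1) \<le> pi * of_int l"
      by (intro mult_left_mono) auto
    then show ?thesis
      unfolding x(1) y(1) F[OF x(2,3)] F[OF y(2,3)]
      using Fb(2)[of \<phi>] Fb(1)[of \<psi>] by (simp add: algebra_simps)
  qed
qed

lemma affine_lift_inverse:
  assumes "\<alpha> > 0"
  shows "affine_lift \<alpha> \<beta> \<circ> affine_lift (1 / \<alpha>) (- \<beta> / \<alpha>) = id"
    and "affine_lift (1 / \<alpha>) (- \<beta> / \<alpha>) \<circ> affine_lift \<alpha> \<beta> = id"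
  unfolding affine_lift_comp using assms by (simp_all add: affine_lift_id)

lemma affine_lift_continuous:
  assumes "\<alpha> > 0"
  shows "continuous_on UNIV (affine_lift \<alpha> \<beta>)"
proof (rule continuous_onI_mono)
  have "surj (affine_lift \<alpha> \<beta>)"
    using affine_lift_inverse(1)[OF assms] by (metis comp_surj surj_id surjI comp_apply id_apply)
  then show "open (range (affine_lift \<alpha> \<beta>))"
    by simp
  show "affine_lift \<alpha> \<beta> x \<le> affine_lift \<alpha> \<beta> y" if "x \<le> y" for x y
    using affine_lift_mono[OF assms] that by (rule monoD)
qed

text \<open>Division by \<open>sqrt \<alpha>\<close> normalizes the matrix with rows
  \<open>\<alpha>\<close>, \<open>\<beta>\<close> and \<open>0\<close>, \<open>1\<close> to
  determinant 1.\<close>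

lemma affine_lift_matrix:
  assumes "\<alpha> > 0"
  shows "mobius_matrix (affine_lift \<alpha> \<beta>) (sqrt \<alpha>) (\<beta> / sqrt \<alpha>) 0 (1 / sqrt \<alpha>)"
  unfolding mobius_matrix_def
proof
  fix \<theta>
  show "\<exists>r. r \<noteq> 0 \<and> sqrt \<alpha> * sin \<theta> + \<beta> / sqrt \<alpha> * cos \<theta> = r * sin (affine_lift \<alpha> \<beta> \<theta>) \<and>
             0 * sin \<theta> + 1 / sqrt \<alpha> * cos \<theta> = r * cos (affine_lift \<alpha> \<beta> \<theta>)"
  proof (cases "cos \<theta> = 0")
    case True
    then show ?thesis
      using assms by (intro exI[of _ "sqrt \<alpha>"]) (simp add: affine_lift_def)
  next
    case False
    define t where "t = \<alpha> * tan \<theta> + \<beta>"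
    define f where "f = affine_lift \<alpha> \<beta> \<theta>"
    have f: "f = arctan t + pi * of_int (round (\<theta> / pi))"
      using False by (simp add: f_def t_def affine_lift_def)
    have "cos f \<noteq> 0"
      unfolding f by (simp add: cos_add sin_zero_iff_int2 sin_int_times_real cos_int_times_real mult.commute)
    moreover have "tan f = t"
      unfolding f using tan_periodic_int[of "arctan t" "round (\<theta> / pi)"]
      by (simp add: mult.commute tan_arctan)
    ultimately have s: "sin f = t * cos f"
      by (simp add: tan_def field_simps)
    have "t * cos \<theta> = \<alpha> * sin \<theta> + \<beta> * cos \<theta>"
      using False by (simp add: t_def tan_def field_simps)
    moreover have "\<alpha> = sqrt \<alpha> * sqrt \<alpha>"
      using assms by simp
    ultimately have "cos \<theta> / sqrt \<alpha> * t = sqrt \<alpha> * sin \<theta> + \<beta> / sqrt \<alpha> * cos \<theta>"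
      using assms by (simp add: field_simps)
    then show ?thesis
      unfolding f_def[symmetric] s using False \<open>cos f \<noteq> 0\<close> assms
      by (intro exI[of _ "cos \<theta> / sqrt \<alpha> / cos f"]) simp
  qed
qed

lemma affine_lift_cover:
  assumes "\<alpha> > 0"
  shows "affine_lift \<alpha> \<beta> \<in> mobius_cover"
  unfolding mobius_cover_iff
  using affine_lift_matrix[OF assms, of \<beta>] affine_lift_continuous[OF assms, of \<beta>] assms
  by (intro conjI exI[of _ "sqrt \<alpha>"] exI[of _ "\<beta> / sqrt \<alpha>"] exI[of _ 0] exI[of _ "1 / sqrt \<alpha>"]) auto

text \<open>Two lifts of the same circle map differ by a continuous function with values in
  \<open>\<pi> \<int>\<close>, so they agree everywhere as soon as they agree at one point.\<close>

lemma lift_unique: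
  fixes f g :: "real \<Rightarrow> real"
  assumes f: "continuous_on UNIV f" and g: "continuous_on UNIV g"
    and s: "\<And>\<theta>. sin (f \<theta> - g \<theta>) = 0" and "f \<theta>\<^sub>0 = g \<theta>\<^sub>0"
  shows "f = g"
proof
  fix \<theta>
  have 1: "\<exists>i::int. f \<theta> - g \<theta> = of_int i * pi" for \<theta>
    using s sin_zero_iff_int2 by blast
  have "(\<lambda>\<theta>. f \<theta> - g \<theta>) constant_on UNIV"
  proof (rule continuous_discrete_range_constant)
    show "continuous_on UNIV (\<lambda>\<theta>. f \<theta> - g \<theta>)"
      by (intro continuous_intros f g)
    fix x :: real
    have "pi \<le> norm ((f y - g y) - (f x - g x))" if "f y - g y \<noteq> f x - g x" for y
    proof -
      obtain i j :: int where ij: "f y - g y = of_int i * pi" "f x - g x = of_int j * pi"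
        using 1 by metis
      then have "i \<noteq> j"
        using that by auto
      then have "\<bar>real_of_int (i - j)\<bar> \<ge> 1"
        by linarith
      then have "\<bar>real_of_int (i - j)\<bar> * pi \<ge> 1 * pi"
        by (intro mult_right_mono) auto
      then show ?thesis
        unfolding ij by (simp add: abs_mult flip: left_diff_distrib)
    qed
    then show "\<exists>e>0. \<forall>y. y \<in> UNIV \<and> f y - g y \<noteq> f x - g x \<longrightarrow> e \<le> norm (f y - g y - (f x - g x))"
      by (intro exI[of _ pi]) auto
  qed auto
  then show "f \<theta> = g \<theta>"
    using \<open>f \<theta>\<^sub>0 = g \<theta>\<^sub>0\<close> unfolding constant_on_def by (metis UNIV_I eq_iff_diff_eq_0)
qed

text \<open>The angle \<open>pi / 2\<close> lies above infinity, so a map fixing it has an upper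
  triangular matrix. Fixing the angle itself, and not just modulo \<open>pi\<close>, excludes the
  other sheets and permits \<open>lift_unique\<close>.\<close>

lemma cover_fixing_infinity:
  assumes f: "continuous_on UNIV f" and m: "mobius_matrix f a b c d" and det: "a * d - b * c = 1"
    and fixinf: "f (pi / 2) = pi / 2"
  shows "a / d > 0" "f = affine_lift (a / d) (b / d)"
proof -
  obtain r where "r \<noteq> 0" "c = r * cos (pi / 2)"
    using m fixinf unfolding mobius_matrix_def by (metis add.right_neutral cos_pi_half mult.right_neutral mult_zero_right sin_pi_half)
  then have "c = 0"
    by simp
  then have "a * d = 1"
    using det by simp
  then have "d \<noteq> 0" "a \<noteq> 0"
    by auto
  have "a / d = a * (a * d) / d"
    using \<open>a * d = 1\<close> by simp
  also have "\<dots> = a\<^sup>2"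
    using \<open>d \<noteq> 0\<close> by (simp add: power2_eq_square)
  finally have "a / d = a\<^sup>2" .
  then show pos: "a / d > 0"
    using \<open>a \<noteq> 0\<close> by simp
  show "f = affine_lift (a / d) (b / d)"
  proof (rule lift_unique[OF f affine_lift_continuous[OF pos]])
    show "f (pi / 2) = affine_lift (a / d) (b / d) (pi / 2)"
      by (simp add: affine_lift_def fixinf)
    fix \<theta>
    obtain r where r: "r \<noteq> 0" "a * sin \<theta> + b * cos \<theta> = r * sin (f \<theta>)" "d * cos \<theta> = r * cos (f \<theta>)"
      using m \<open>c = 0\<close> unfolding mobius_matrix_def by (metis add_0 mult_zero_left)
    obtain q where q: "q \<noteq> 0"
      "sqrt (a / d) * sin \<theta> + b / d / sqrt (a / d) * cos \<theta> = q * sin (affine_lift (a / d) (b / d) \<theta>)"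
      "1 / sqrt (a / d) * cos \<theta> = q * cos (affine_lift (a / d) (b / d) \<theta>)"
      using affine_lift_matrix[OF pos, of "b / d"] unfolding mobius_matrix_def
      by (metis add_0 mult_zero_left)
    have "r * q * sin (f \<theta> - affine_lift (a / d) (b / d) \<theta>)
        = (r * sin (f \<theta>)) * (q * cos (affine_lift (a / d) (b / d) \<theta>))
          - (r * cos (f \<theta>)) * (q * sin (affine_lift (a / d) (b / d) \<theta>))"
      by (simp add: sin_diff algebra_simps)
    also have "\<dots> = (a * sin \<theta> + b * cos \<theta>) * (1 / sqrt (a / d) * cos \<theta>)
          - (d * cos \<theta>) * (sqrt (a / d) * sin \<theta> + b / d / sqrt (a / d) * cos \<theta>)"
      unfolding r(2,3) q(2,3) ..
    also have "\<dots> = 0"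
    proof -
      define w where "w = sqrt (a / d)"
      have "w > 0" "w * w = a / d"
        unfolding w_def using pos by (metis real_sqrt_gt_zero, metis abs_of_pos real_sqrt_mult_self)
      then have "a = w * w * d"
        using \<open>d \<noteq> 0\<close> by simp
      then show ?thesis
        unfolding w_def[symmetric] using \<open>w > 0\<close> \<open>d \<noteq> 0\<close> by (simp add: field_simps)
    qed
    finally show "sin (f \<theta> - affine_lift (a / d) (b / d) \<theta>) = 0"
      using r(1) q(1) by simp
  qed
qed

text \<open>An Iwasawa decomposition: rotating back by the displacement of \<open>pi / 2\<close>
  leaves a map that fixes infinity on the identity sheet.\<close>

lemma mobius_cover_decompose:
  assumes "f \<in> mobius_cover"
  obtains \<phi> \<alpha> \<beta> where "\<alpha> > 0" "f = rot \<phi> \<circ> affine_lift \<alpha> \<beta>"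
proof -
  define \<phi> where "\<phi> = f (pi / 2) - pi / 2"
  have "rot (- \<phi>) \<circ> f \<in> mobius_cover"
    by (intro mobius_cover_comp rot_cover assms)
  then obtain a b c d where m: "continuous_on UNIV (rot (- \<phi>) \<circ> f)" "a * d - b * c = 1"
      "mobius_matrix (rot (- \<phi>) \<circ> f) a b c d"
    unfolding mobius_cover_iff by blast
  have "(rot (- \<phi>) \<circ> f) (pi / 2) = pi / 2"
    by (simp add: rot_def \<phi>_def)
  note * = cover_fixing_infinity[OF m(1,3,2) this]
  have "rot \<phi> \<circ> (rot (- \<phi>) \<circ> f) = f"
    by (auto simp: rot_def)
  with * that show ?thesis
    by metis
qed

text \<open>The double cosets of the subgroup of translations: off the affine group, they are separated
  by the lower left matrix entry alone.\<close>

lemma bruhat: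
  assumes "0 < \<phi>" "\<phi> < pi / 2" "0 < \<epsilon>" "\<epsilon> < pi / 2"
  obtains \<beta> \<beta>' where
    "affine_lift 1 \<beta> \<circ> rot \<epsilon> = rot \<phi> \<circ> affine_lift ((sin \<epsilon> / sin \<phi>)\<^sup>2) \<beta>'"
proof -
  define a where "a = sin \<epsilon> / sin \<phi>"
  have s: "sin \<phi> > 0" "sin \<epsilon> > 0"
    using assms by (auto intro!: sin_gt_zero)
  then have "a > 0" and as: "a * sin \<phi> = sin \<epsilon>"
    by (auto simp: a_def)
  \<comment> \<open>Chosen so that the first column of the matrix of
    \<open>affine_lift 1 \<beta> \<circ> rot \<epsilon>\<close> is \<open>a\<close> times that of
    \<open>rot \<phi>\<close>. Undoing \<open>rot \<phi>\<close> then fixes infinity.\<close>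
  define \<beta> where "\<beta> = (cos \<epsilon> - a * cos \<phi>) / sin \<epsilon>"
  have \<beta>: "\<beta> * sin \<epsilon> = cos \<epsilon> - a * cos \<phi>"
    using s by (simp add: \<beta>_def)
  define G where "G = rot (- \<phi>) \<circ> (affine_lift 1 \<beta> \<circ> rot \<epsilon>)"
  \<comment> \<open>On the cover this must hold exactly and not only modulo \<open>pi\<close>. Both
    angles lie in the cell around \<open>pi\<close>, hence the shifts by
    \<open>pi * of_int 1\<close>.\<close>
  have "affine_lift 1 \<beta> (pi / 2 + \<epsilon>) = pi / 2 + \<phi>"
  proof -
    have "tan (- (pi / 2) + \<psi>) = - cos \<psi> / sin \<psi>" for \<psi> :: real
      unfolding tan_def sin_add cos_add by simp
    moreover have "- cos \<epsilon> / sin \<epsilon> + \<beta> = - cos \<phi> / sin \<phi>"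
      using s \<open>a > 0\<close> unfolding \<beta>_def as[symmetric] by (simp add: field_simps)
    ultimately have t: "tan (- (pi / 2) + \<epsilon>) + \<beta> = tan (- (pi / 2) + \<phi>)"
      by simp
    have "affine_lift 1 \<beta> ((- (pi / 2) + \<epsilon>) + pi * of_int 1)
        = arctan (1 * tan (- (pi / 2) + \<epsilon>) + \<beta>) + pi * of_int 1"
      using assms by (intro affine_lift_cell) auto
    also have "\<dots> = (- (pi / 2) + \<phi>) + pi * of_int 1"
      unfolding mult_1 t using assms by (subst arctan_tan) auto
    finally have "affine_lift 1 \<beta> ((- (pi / 2) + \<epsilon>) + pi * of_int 1) = (- (pi / 2) + \<phi>) + pi * of_int 1" .
    then show ?thesis
      by (simp add: algebra_simps)
  qed
  then have fixinf: "G (pi / 2) = pi / 2"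
    by (simp add: G_def rot_def)
  have cont: "continuous_on UNIV G"
  proof -
    have "G \<in> mobius_cover"
      unfolding G_def by (intro mobius_cover_comp rot_cover affine_lift_cover) simp
    then show ?thesis
      by (simp add: mobius_cover_iff)
  qed
  have "mobius_matrix (affine_lift 1 \<beta> \<circ> rot \<epsilon>) (a * cos \<phi>) (sin \<epsilon> + \<beta> * cos \<epsilon>) (- sin \<epsilon>) (cos \<epsilon>)"
    using mobius_matrix_comp[OF affine_lift_matrix[of 1 \<beta>] rot_matrix[of \<epsilon>]]
    by (simp add: \<beta>)
  note m = mobius_matrix_comp[OF rot_matrix[of "- \<phi>"] this]
  define b d where "b = cos (- \<phi>) * (sin \<epsilon> + \<beta> * cos \<epsilon>) + sin (- \<phi>) * cos \<epsilon>"
    and "d = - sin (- \<phi>) * (sin \<epsilon> + \<beta> * cos \<epsilon>) + cos (- \<phi>) * cos \<epsilon>"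
  have e1: "cos (- \<phi>) * (a * cos \<phi>) + sin (- \<phi>) * - sin \<epsilon> = a"
  proof -
    have "cos (- \<phi>) * (a * cos \<phi>) + sin (- \<phi>) * - sin \<epsilon> = a * ((cos \<phi>)\<^sup>2 + (sin \<phi>)\<^sup>2)"
      unfolding as[symmetric] power2_eq_square cos_minus sin_minus by algebra
    then show ?thesis
      using sin_cos_squared_add2[of \<phi>] by simp
  qed
  have e2: "- sin (- \<phi>) * (a * cos \<phi>) + cos (- \<phi>) * - sin \<epsilon> = 0"
    unfolding as[symmetric] by simp
  have m': "mobius_matrix G a b 0 d"
    using m unfolding G_def[symmetric] b_def[symmetric] d_def[symmetric] e1 e2 .
  have "a * d = 1"
  proof -
    have "a * d = a * sin \<phi> * sin \<epsilon> + cos \<epsilon> * ((\<beta> * sin \<epsilon>) + a * cos \<phi>)"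
      unfolding d_def by (simp add: as[symmetric] algebra_simps)
    also have "\<dots> = sin \<epsilon> * sin \<epsilon> + cos \<epsilon> * cos \<epsilon>"
      unfolding as \<beta> by simp
    also have "\<dots> = 1"
      by (simp only: add.commute[of "sin \<epsilon> * sin \<epsilon>"] sin_cos_squared_add3)
    finally show ?thesis .
  qed
  then have "a / d = a\<^sup>2"
    by (metis div_by_1 mult.commute nonzero_mult_div_cancel_left
        mult_zero_right power2_eq_square times_divide_eq_left zero_neq_one divide_divide_eq_left)
  then have "G = affine_lift (a\<^sup>2) (b / d)"
    using cover_fixing_infinity(2)[OF cont m' _ fixinf] \<open>a * d = 1\<close> by simp
  moreover have "rot \<phi> \<circ> G = affine_lift 1 \<beta> \<circ> rot \<epsilon>"
    by (auto simp: G_def rot_def)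
  ultimately show ?thesis
    using that a_def by metis
qed

subsection \<open>Topology\<close>

lemma continuous_rot: "continuous_on UNIV rot"
  unfolding rot_def
  by (intro continuous_on_coordinatewise_then_product continuous_intros)

lemma continuous_affine_lift: "continuous_on {0<..} (\<lambda>\<alpha>. affine_lift \<alpha> (f \<alpha>))"
  if "continuous_on {0<..} f"
proof (rule continuous_on_coordinatewise_then_product)
  show "continuous_on {0<..} (\<lambda>\<alpha>. affine_lift \<alpha> (f \<alpha>) \<theta>)" for \<theta>
    unfolding affine_lift_def by (cases "cos \<theta> = 0") (auto intro!: continuous_intros that)
qed

lemma continuous_translation: "continuous_on UNIV (affine_lift 1)"
proof (rule continuous_on_coordinatewise_then_product)
  show "continuous_on UNIV (\<lambda>\<beta>. affine_lift 1 \<beta> \<theta>)" for \<theta>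
    unfolding affine_lift_def by (cases "cos \<theta> = 0") (auto intro!: continuous_intros)
qed

text \<open>A positive number divided by a large integer falls into the interval, and repeated
  addition gives it back. This extends statements about short rotations to all rotations.\<close>

lemma additive_set_UNIV:
  fixes S :: "real set"
  assumes "\<delta> > 0" "{0<..<\<delta>} \<subseteq> S" and add: "\<And>x y. x \<in> S \<Longrightarrow> y \<in> S \<Longrightarrow> x + y \<in> S"
    and neg: "\<And>x. x \<in> S \<Longrightarrow> - x \<in> S"
  shows "x \<in> S"
proof -
  have mult: "real (Suc n) * y \<in> S" if "y \<in> S" for n y
  proof (induction n)
    case (Suc n)
    then show ?case
      using add[OF Suc that] by (simp add: algebra_simps)
  qed (simp add: that)
  have pos: "x \<in> S" if "x > 0" for x
  proof -
    obtain n where n: "x / \<delta> < real n"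
      using reals_Archimedean2 by blast
    then have "real n > 0"
      using that \<open>\<delta> > 0\<close> by (meson divide_pos_pos less_trans)
    have "x / real (Suc n) < \<delta>"
    proof -
      have "x < \<delta> * real n"
        using n \<open>\<delta> > 0\<close> by (simp add: field_simps)
      also have "\<dots> \<le> \<delta> * real (Suc n)"
        using \<open>\<delta> > 0\<close> by simp
      finally show ?thesis
        by (simp add: field_simps)
    qed
    then have "x / real (Suc n) \<in> S"
      using assms(2) that by auto
    from mult[OF this, of n] show ?thesis
      by (simp del: of_nat_Suc)
  qed
  have "0 \<in> S"
    using add[of 1 "- 1"] pos[of 1] neg[of 1] by simp
  then show ?thesis
    using pos[of x] pos[of "- x"] neg[of "- x"] by (cases x "0::real" rule: linorder_cases) auto
qed

section \<open>Unitary representations of the cover\<close>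

locale mobius_rep =
  fixes W :: "(real \<Rightarrow> real) \<Rightarrow> ('h::{complex_inner,banach} \<Rightarrow>\<^sub>L 'h)"
  assumes rep: "unitary_representation mobius_cover (\<circ>) W"
begin

text \<open>Only translation invariance is demanded, as in \<open>wave_space\<close>;
  \<open>fixed_all\<close> shows that such vectors are invariant under the whole cover.\<close>

definition W_fixed :: "'h set" where
  "W_fixed = {\<xi>. \<forall>b. W (affine_lift 1 b) \<xi> = \<xi>}"

lemma unitary: "g \<in> mobius_cover \<Longrightarrow> unitary_op (W g)"
  using rep by (simp add: unitary_representation_def)

lemma mult: "g \<in> mobius_cover \<Longrightarrow> k \<in> mobius_cover \<Longrightarrow> W (g \<circ> k) = W g o\<^sub>L W k"
  using rep by (simp add: unitary_representation_def)

lemma mult_apply: "g \<in> mobius_cover \<Longrightarrow> k \<in> mobius_cover \<Longrightarrow> W (g \<circ> k) \<xi> = W g (W k \<xi>)"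
  by (simp add: mult)

lemma cont: "continuous_on mobius_cover (\<lambda>g. W g \<xi>)"
  using rep by (simp add: unitary_representation_def)

lemma W_id: "W id = id_blinfun"
proof (rule blinfun_eqI)
  fix \<xi>
  have "W id (W id \<xi>) = W id \<xi>"
    using mult_apply[OF id_cover id_cover, of \<xi>] by simp
  then show "W id \<xi> = id_blinfun \<xi>"
    by (metis id_cover unitary unitary_adj_apply id_blinfun.rep_eq id_apply)
qed

lemma adj_W:
  assumes "g \<in> mobius_cover" "k \<in> mobius_cover" "g \<circ> k = id"
  shows "adj (W g) = W k"
proof (rule blinfun_eqI)
  fix \<xi>
  have "W g (W k \<xi>) = \<xi>"
    using mult_apply[OF assms(1,2), of \<xi>] assms(3) W_id by simp
  then show "adj (W g) \<xi> = W k \<xi>"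
    using unitary_adj_apply[OF unitary[OF assms(1)]] by metis
qed

text \<open>Inverses are not built into \<open>mobius_cover\<close>; an explicit one comes from the
  decomposition into a rotation and an affine map.\<close>

lemma adj_W_exists:
  assumes g: "g \<in> mobius_cover"
  shows "\<exists>k\<in>mobius_cover. adj (W g) = W k"
proof -
  obtain \<phi> \<alpha> \<beta> where \<alpha>: "\<alpha> > 0" and g': "g = rot \<phi> \<circ> affine_lift \<alpha> \<beta>"
    using mobius_cover_decompose[OF g] .
  have k: "affine_lift (1 / \<alpha>) (- \<beta> / \<alpha>) \<circ> rot (- \<phi>) \<in> mobius_cover"
    using \<alpha> by (intro mobius_cover_comp rot_cover affine_lift_cover) simp
  have "g \<circ> (affine_lift (1 / \<alpha>) (- \<beta> / \<alpha>) \<circ> rot (- \<phi>))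
      = rot \<phi> \<circ> (affine_lift \<alpha> \<beta> \<circ> affine_lift (1 / \<alpha>) (- \<beta> / \<alpha>)) \<circ> rot (- \<phi>)"
    by (simp add: g' comp_assoc)
  also have "\<dots> = id"
    unfolding affine_lift_inverse(1)[OF \<alpha>] by (auto simp: rot_def)
  finally show ?thesis
    using adj_W[OF g k] k by blast
qed

lemma cont_rot: "continuous_on UNIV (\<lambda>\<phi>. W (rot \<phi>) \<xi>)"
  by (rule continuous_on_compose2[OF cont continuous_rot]) (auto simp: rot_cover)

lemma cont_trans: "continuous_on UNIV (\<lambda>b. W (affine_lift 1 b) \<xi>)"
  by (rule continuous_on_compose2[OF cont continuous_translation]) (auto simp: affine_lift_cover)

lemma tendsto_rot: "((\<lambda>\<phi>. W (rot \<phi>) \<xi>) \<longlongrightarrow> \<xi>) (at_right 0)"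
proof -
  have "((\<lambda>\<phi>. W (rot \<phi>) \<xi>) \<longlongrightarrow> W (rot 0) \<xi>) (at_right 0)"
    using cont_rot[of \<xi>] by (auto simp: continuous_on intro: tendsto_within_subset)
  then show ?thesis
    by (simp add: rot_0 W_id)
qed

lemma csubspace_W_fixed: "csubspace W_fixed"
  unfolding W_fixed_def csubspace_def
  using unitary_clinear[OF unitary[OF affine_lift_cover]]
  by (auto simp: blinfun.add_right clinear_ops_def)

lemma closed_W_fixed: "closed W_fixed"
  unfolding W_fixed_def by (intro closed_Collect_all closed_Collect_eq continuous_intros)

text \<open>The equality case of Cauchy-Schwarz for a unitary. It reduces invariance to one matrix
  coefficient, the quantity that the limits below control.\<close>

lemma fixed_if_cinner:
  assumes "g \<in> mobius_cover" "cinner \<xi> (W g \<xi>) = cinner \<xi> \<xi>"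
  shows "W g \<xi> = \<xi>"
proof -
  have "cinner (W g \<xi>) \<xi> = cinner \<xi> \<xi>"
    by (metis assms(2) cinner_commute)
  then have "cinner (W g \<xi> - \<xi>) (W g \<xi> - \<xi>) = 0"
    using assms(2) unitary_cinner[OF unitary[OF assms(1)]]
    by (simp add: cinner.diff_left cinner.diff_right)
  then show ?thesis
    by (simp add: cinner_self)
qed

text \<open>Matrix coefficients of a translation invariant vector are constant on double cosets, and
  the double coset of a small rotation comes close to every dilation and every rotation
  (the Mautner phenomenon).\<close>

lemma fixed_coefficient:
  assumes \<xi>: "\<xi> \<in> W_fixed" and "0 < \<phi>" "\<phi> < pi / 2" "0 < \<epsilon>" "\<epsilon> < pi / 2"
  shows "cinner \<xi> (W (rot \<epsilon>) \<xi>) = cinner \<xi> (W (rot \<phi>) (W (affine_lift ((sin \<epsilon> / sin \<phi>)\<^sup>2) 0) \<xi>))"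
proof -
  obtain \<beta> \<beta>' where b: "affine_lift 1 \<beta> \<circ> rot \<epsilon> = rot \<phi> \<circ> affine_lift ((sin \<epsilon> / sin \<phi>)\<^sup>2) \<beta>'"
    using bruhat assms by blast
  let ?\<alpha> = "(sin \<epsilon> / sin \<phi>)\<^sup>2"
  have "sin \<phi> > 0" "sin \<epsilon> > 0"
    using assms by (auto intro!: sin_gt_zero)
  then have pos: "?\<alpha> > 0"
    by simp
  have tr: "affine_lift 1 b \<in> mobius_cover" for b
    by (rule affine_lift_cover) simp
  \<comment> \<open>Written on the right, the translation acts on \<open>\<xi>\<close> first and
    disappears.\<close>
  have "affine_lift ?\<alpha> \<beta>' = affine_lift ?\<alpha> 0 \<circ> affine_lift 1 (\<beta>' / ?\<alpha>)"
    unfolding affine_lift_comp using pos by simp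
  then have 1: "W (affine_lift ?\<alpha> \<beta>') \<xi> = W (affine_lift ?\<alpha> 0) \<xi>"
    using \<xi> mult_apply[OF affine_lift_cover[OF pos] tr] by (simp add: W_fixed_def)
  \<comment> \<open>By unitarity the other translation may be inserted in both arguments; in the
    first one it is absorbed by \<open>\<xi>\<close>.\<close>
  have "cinner \<xi> (W (rot \<epsilon>) \<xi>) = cinner (W (affine_lift 1 \<beta>) \<xi>) (W (affine_lift 1 \<beta>) (W (rot \<epsilon>) \<xi>))"
    by (rule unitary_cinner[OF unitary[OF tr], symmetric])
  also have "\<dots> = cinner \<xi> (W (affine_lift 1 \<beta> \<circ> rot \<epsilon>) \<xi>)"
    using \<xi> by (simp add: W_fixed_def mult_apply[OF tr rot_cover])
  also have "\<dots> = cinner \<xi> (W (rot \<phi>) (W (affine_lift ?\<alpha> 0) \<xi>))"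
    unfolding b mult_apply[OF rot_cover affine_lift_cover[OF pos]] 1 ..
  finally show ?thesis .
qed

text \<open>Both angles of \<open>fixed_coefficient\<close> tend to 0 at a rate that keeps the
  dilation equal to \<open>\<alpha>\<close>. The left coefficient tends to
  \<open>cinner \<xi> \<xi>\<close>, the right one to the coefficient of the dilation.\<close>

lemma fixed_dilation:
  assumes \<xi>: "\<xi> \<in> W_fixed" and "\<alpha> > 0"
  shows "W (affine_lift \<alpha> 0) \<xi> = \<xi>"
proof (rule fixed_if_cinner[OF affine_lift_cover[OF \<open>\<alpha> > 0\<close>]])
  \<comment> \<open>Solves \<open>sin (\<epsilon> \<phi>) / sin \<phi> = sqrt \<alpha>\<close>; for
    small \<open>\<phi>\<close> the argument of \<open>arcsin\<close> is below 1.\<close>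
  define \<epsilon> where "\<epsilon> \<phi> = arcsin (sqrt \<alpha> * sin \<phi>)" for \<phi> :: real
  have "isCont \<epsilon> 0"
    unfolding \<epsilon>_def by (rule isCont_o2[of _ _ arcsin]) (auto intro!: continuous_intros isCont_arcsin)
  then have "(\<epsilon> \<longlongrightarrow> 0) (at 0)"
    by (simp add: isCont_def \<epsilon>_def)
  then have lim: "(\<epsilon> \<longlongrightarrow> 0) (at_right 0)"
    by (rule tendsto_within_subset) auto
  have ev: "\<forall>\<^sub>F \<phi> in at_right 0. 0 < \<phi> \<and> \<phi> < pi / 2"
    using eventually_at_right_real[of 0 "pi / 2"] by simp
  have "((\<lambda>\<phi>. sqrt \<alpha> * sin \<phi>) \<longlongrightarrow> sqrt \<alpha> * sin 0) (at_right 0)"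
    by (intro tendsto_intros)
  then have "\<forall>\<^sub>F \<phi> in at_right 0. sqrt \<alpha> * sin \<phi> < 1"
    by (rule order_tendstoD) simp
  then have ev2: "\<forall>\<^sub>F \<phi> in at_right 0. 0 < \<epsilon> \<phi> \<and> \<epsilon> \<phi> < pi / 2 \<and> sin (\<epsilon> \<phi>) / sin \<phi> = sqrt \<alpha>"
    using ev
  proof eventually_elim
    case (elim \<phi>)
    have s: "sin \<phi> > 0"
      using elim by (intro sin_gt_zero) auto
    have p: "0 < sqrt \<alpha> * sin \<phi>"
      using s \<open>\<alpha> > 0\<close> by simp
    have "arcsin 0 < \<epsilon> \<phi>" "\<epsilon> \<phi> < arcsin 1"
      unfolding \<epsilon>_def using elim p by (subst arcsin_less_mono; linarith)+
    moreover have "sin (\<epsilon> \<phi>) = sqrt \<alpha> * sin \<phi>"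
      unfolding \<epsilon>_def using elim p by (intro sin_arcsin) linarith+
    ultimately show ?case
      using s by simp
  qed
  have eq: "\<forall>\<^sub>F \<phi> in at_right 0.
      cinner \<xi> (W (rot (\<epsilon> \<phi>)) \<xi>) = cinner \<xi> (W (rot \<phi>) (W (affine_lift \<alpha> 0) \<xi>))"
    using ev ev2
  proof eventually_elim
    case (elim \<phi>)
    then show ?case
      using fixed_coefficient[OF \<xi>, of \<phi> "\<epsilon> \<phi>"] \<open>\<alpha> > 0\<close> by simp
  qed
  have "filterlim \<epsilon> (at_right 0) (at_right 0)"
    using lim ev2 by (auto simp: filterlim_at elim: eventually_mono)
  from filterlim_compose[OF tendsto_rot this]
  have "((\<lambda>\<phi>. cinner \<xi> (W (rot (\<epsilon> \<phi>)) \<xi>)) \<longlongrightarrow> cinner \<xi> \<xi>) (at_right 0)"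
    by (intro cinner.tendsto tendsto_const)
  then have "((\<lambda>\<phi>. cinner \<xi> (W (rot \<phi>) (W (affine_lift \<alpha> 0) \<xi>))) \<longlongrightarrow> cinner \<xi> \<xi>) (at_right 0)"
    using tendsto_cong[OF eq] by simp
  moreover have "((\<lambda>\<phi>. cinner \<xi> (W (rot \<phi>) (W (affine_lift \<alpha> 0) \<xi>)))
      \<longlongrightarrow> cinner \<xi> (W (affine_lift \<alpha> 0) \<xi>)) (at_right 0)"
    by (intro cinner.tendsto tendsto_const tendsto_rot)
  ultimately show "cinner \<xi> (W (affine_lift \<alpha> 0) \<xi>) = cinner \<xi> \<xi>"
    using tendsto_unique[OF trivial_limit_at_right_real] by blast
qed

text \<open>Now \<open>\<phi>\<close> is kept and only \<open>\<epsilon>\<close> tends to 0. The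
  dilation factor degenerates, which is harmless since dilations already fix
  \<open>\<xi>\<close>.\<close>

lemma fixed_rot:
  assumes \<xi>: "\<xi> \<in> W_fixed"
  shows "W (rot \<phi>) \<xi> = \<xi>"
proof -
  have small: "W (rot \<phi>) \<xi> = \<xi>" if \<phi>: "0 < \<phi>" "\<phi> < pi / 2" for \<phi>
  proof (rule fixed_if_cinner[OF rot_cover])
    have "\<forall>\<^sub>F \<epsilon> in at_right 0. cinner \<xi> (W (rot \<epsilon>) \<xi>) = cinner \<xi> (W (rot \<phi>) \<xi>)"
      using eventually_at_right_real[of 0 "pi / 2", OF pi_half_gt_zero]
    proof eventually_elim
      case (elim \<epsilon>)
      have "sin \<phi> > 0" "sin \<epsilon> > 0"
        using elim \<phi> by (auto intro!: sin_gt_zero)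
      then show ?case
        using fixed_coefficient[OF \<xi> \<phi>, of \<epsilon>] elim fixed_dilation[OF \<xi>] by simp
    qed
    moreover have "((\<lambda>\<epsilon>. cinner \<xi> (W (rot \<epsilon>) \<xi>)) \<longlongrightarrow> cinner \<xi> \<xi>) (at_right 0)"
      by (intro cinner.tendsto tendsto_const tendsto_rot)
    ultimately have "((\<lambda>\<epsilon>::real. cinner \<xi> (W (rot \<phi>) \<xi>)) \<longlongrightarrow> cinner \<xi> \<xi>) (at_right 0)"
      using tendsto_cong by fastforce
    then show "cinner \<xi> (W (rot \<phi>) \<xi>) = cinner \<xi> \<xi>"
      by (simp add: tendsto_const_iff)
  qed
  have "\<phi> \<in> {\<phi>. W (rot \<phi>) \<xi> = \<xi>}"
  proof (rule additive_set_UNIV[where \<delta> = "pi / 2"])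
    show "x + y \<in> {\<phi>. W (rot \<phi>) \<xi> = \<xi>}"
      if "x \<in> {\<phi>. W (rot \<phi>) \<xi> = \<xi>}" "y \<in> {\<phi>. W (rot \<phi>) \<xi> = \<xi>}" for x y
      using that mult_apply[OF rot_cover rot_cover, of x y \<xi>] by (simp add: rot_comp)
    show "- x \<in> {\<phi>. W (rot \<phi>) \<xi> = \<xi>}" if "x \<in> {\<phi>. W (rot \<phi>) \<xi> = \<xi>}" for x
      using that mult_apply[OF rot_cover rot_cover, of "- x" x \<xi>] by (simp add: rot_comp rot_0 W_id)
  qed (use small in auto)
  then show ?thesis
    by simp
qed

lemma fixed_all:
  assumes \<xi>: "\<xi> \<in> W_fixed" and g: "g \<in> mobius_cover"
  shows "W g \<xi> = \<xi>"
proof -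
  obtain \<phi> \<alpha> \<beta> where "\<alpha> > 0" and g': "g = rot \<phi> \<circ> affine_lift \<alpha> \<beta>"
    using mobius_cover_decompose[OF g] .
  have "affine_lift \<alpha> \<beta> = affine_lift 1 \<beta> \<circ> affine_lift \<alpha> 0"
    by (simp add: affine_lift_comp)
  then have "W (affine_lift \<alpha> \<beta>) \<xi> = W (affine_lift 1 \<beta>) (W (affine_lift \<alpha> 0) \<xi>)"
    using mult_apply[of "affine_lift 1 \<beta>" "affine_lift \<alpha> 0"] \<open>\<alpha> > 0\<close> by (simp add: affine_lift_cover)
  also have "\<dots> = \<xi>"
    using \<xi> by (simp add: fixed_dilation[OF \<xi> \<open>\<alpha> > 0\<close>]) (simp add: W_fixed_def)
  finally show ?thesis
    unfolding g' using \<open>\<alpha> > 0\<close>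
    by (simp add: mult_apply[OF rot_cover affine_lift_cover] fixed_rot[OF \<xi>])
qed

text \<open>Conjugation by the contraction turns a translation by \<open>b\<close> into one by
  \<open>\<alpha> * b\<close>. So the displacement of \<open>\<xi>\<close> is the same for
  \<open>b\<close> and for \<open>\<alpha> ^ k * b\<close>, and strong continuity makes it
  0.\<close>

lemma W_fixedI_contraction:
  assumes "0 < \<alpha>" "\<alpha> < 1" and \<xi>: "W (affine_lift \<alpha> \<beta>) \<xi> = \<xi>"
  shows "\<xi> \<in> W_fixed"
proof -
  let ?\<delta> = "affine_lift \<alpha> \<beta>" and ?n = "\<lambda>b. affine_lift 1 b"
  have d: "?\<delta> \<in> mobius_cover" and n: "\<And>b. ?n b \<in> mobius_cover"
    using assms by (auto intro: affine_lift_cover)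
  have step: "norm (W (?n b) \<xi> - \<xi>) = norm (W (?n (\<alpha> * b)) \<xi> - \<xi>)" for b
  proof -
    have "norm (W (?n b) \<xi> - \<xi>) = norm (W ?\<delta> (W (?n b) \<xi> - \<xi>))"
      by (rule unitary_norm[OF unitary[OF d], symmetric])
    also have "W ?\<delta> (W (?n b) \<xi> - \<xi>) = W (?\<delta> \<circ> ?n b) \<xi> - \<xi>"
      by (simp add: blinfun.diff_right \<xi> mult_apply[OF d n])
    also have "?\<delta> \<circ> ?n b = ?n (\<alpha> * b) \<circ> ?\<delta>"
      by (simp add: affine_lift_comp add.commute)
    also have "W (?n (\<alpha> * b) \<circ> ?\<delta>) \<xi> = W (?n (\<alpha> * b)) \<xi>"
      by (simp only: mult_apply[OF n d] \<xi>)
    finally show ?thesis .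
  qed
  have "W (?n b) \<xi> = \<xi>" for b
  proof -
    have "norm (W (?n b) \<xi> - \<xi>) = norm (W (?n (\<alpha> ^ k * b)) \<xi> - \<xi>)" for k
    proof (induction k)
      case (Suc k)
      then show ?case
        using step[of "\<alpha> ^ k * b"] by (simp add: mult.assoc)
    qed simp
    moreover have "(\<lambda>k. norm (W (?n (\<alpha> ^ k * b)) \<xi> - \<xi>)) \<longlonglongrightarrow> 0"
    proof -
      have "(\<lambda>k. \<alpha> ^ k * b) \<longlonglongrightarrow> 0 * b"
        using assms by (intro tendsto_intros LIMSEQ_power_zero) simp
      then have "(\<lambda>k. W (?n (\<alpha> ^ k * b)) \<xi>) \<longlonglongrightarrow> W (?n 0) \<xi>"
        using continuous_on_tendsto_compose[OF cont_trans] by simp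
      then have "(\<lambda>k. norm (W (?n (\<alpha> ^ k * b)) \<xi> - \<xi>)) \<longlonglongrightarrow> norm (W (?n 0) \<xi> - \<xi>)"
        by (rule tendsto_norm[OF tendsto_diff[OF _ tendsto_const]])
      then show ?thesis
        by (simp add: affine_lift_id W_id)
    qed
    ultimately have "(\<lambda>k::nat. norm (W (?n b) \<xi> - \<xi>)) \<longlonglongrightarrow> 0"
      by simp
    then show ?thesis
      by (simp add: LIMSEQ_const_iff)
  qed
  then show ?thesis
    by (simp add: W_fixed_def)
qed

text \<open>The elements commuting with \<open>y\<close> form a group. Short rotations yield all
  rotations, and \<open>bruhat\<close> expresses an affine map of any dilation factor by
  translations and rotations.\<close>

lemma commute_all:
  assumes tr: "\<And>b. W (affine_lift 1 b) o\<^sub>L y = y o\<^sub>L W (affine_lift 1 b)"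
    and "\<delta> > 0" and rt: "\<And>\<phi>. 0 < \<phi> \<Longrightarrow> \<phi> < \<delta> \<Longrightarrow> W (rot \<phi>) o\<^sub>L y = y o\<^sub>L W (rot \<phi>)"
    and g: "g \<in> mobius_cover"
  shows "W g o\<^sub>L y = y o\<^sub>L W g"
proof -
  define S where "S = {g \<in> mobius_cover. \<forall>\<xi>. W g (y \<xi>) = y (W g \<xi>)}"
  have comp: "g \<circ> k \<in> S" if "g \<in> S" "k \<in> S" for g k
    using that by (auto simp: S_def mobius_cover_comp mult_apply)
  have inv: "k \<in> S" if "g \<in> S" "k \<in> mobius_cover" "g \<circ> k = id" for g k
  proof -
    have k: "W g (W k \<xi>) = \<xi>" for \<xi>
      using that mult_apply[of g k \<xi>] by (simp add: S_def W_id)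
    have "W g (W k (y \<xi>)) = W g (y (W k \<xi>))" for \<xi>
      using that by (simp add: k S_def)
    then have "W k (y \<xi>) = y (W k \<xi>)" for \<xi>
      using that unitary_adj_apply[OF unitary[of g]] unfolding S_def by (metis (mono_tags, lifting) mem_Collect_eq)
    then show ?thesis
      using that by (simp add: S_def)
  qed
  have S1: "affine_lift 1 b \<in> S" for b
    using arg_cong[OF tr[of b], of blinfun_apply]
    by (auto simp: S_def affine_lift_cover fun_eq_iff)
  have "\<phi> \<in> {\<phi>. rot \<phi> \<in> S}" for \<phi>
  proof (rule additive_set_UNIV[OF \<open>\<delta> > 0\<close>])
    show "{0<..<\<delta>} \<subseteq> {\<phi>. rot \<phi> \<in> S}"
    proof
      fix \<phi> assume "\<phi> \<in> {0<..<\<delta>}"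
      then show "\<phi> \<in> {\<phi>. rot \<phi> \<in> S}"
        using arg_cong[OF rt[of \<phi>], of blinfun_apply] by (auto simp: S_def rot_cover fun_eq_iff)
    qed
    show "x + y \<in> {\<phi>. rot \<phi> \<in> S}" if "x \<in> {\<phi>. rot \<phi> \<in> S}" "y \<in> {\<phi>. rot \<phi> \<in> S}" for x y
      using that comp[of "rot x" "rot y"] by (simp add: rot_comp)
    show "- x \<in> {\<phi>. rot \<phi> \<in> S}" if "x \<in> {\<phi>. rot \<phi> \<in> S}" for x
      using that inv[of "rot x" "rot (- x)"] by (simp add: rot_comp rot_0 rot_cover)
  qed
  then have S2: "rot \<phi> \<in> S" for \<phi>
    by simp
  have S3: "affine_lift \<alpha> \<beta> \<in> S" if "\<alpha> > 0" for \<alpha> \<beta>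
  proof -
    \<comment> \<open>Small enough that \<open>s\<close> and \<open>sqrt \<alpha> * s\<close> lie
      strictly between 0 and 1, hence are sines of two angles below \<open>pi / 2\<close>, with
      ratio \<open>sqrt \<alpha>\<close>.\<close>
    define s where "s = 1 / (2 * (1 + sqrt \<alpha>))"
    define \<phi> \<epsilon> where "\<phi> = arcsin s" and "\<epsilon> = arcsin (sqrt \<alpha> * s)"
    have q: "sqrt \<alpha> > 0"
      using that by simp
    have s: "0 < s" "s < 1" "0 < sqrt \<alpha> * s" "sqrt \<alpha> * s < 1"
    proof -
      have "2 * (1 + w) > 1" "2 * (1 + w) > w" "2 * (1 + w) > 0" if "w > 0" for w :: real
        using that by auto
      note this[OF q]
      then show "0 < s" "s < 1" "0 < sqrt \<alpha> * s" "sqrt \<alpha> * s < 1"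
        unfolding s_def using q by (simp_all only: divide_less_eq_1_pos times_divide_eq_right mult_1_right
            zero_less_divide_iff) auto
    qed
    have "arcsin 0 < \<phi>" "\<phi> < arcsin 1" "arcsin 0 < \<epsilon>" "\<epsilon> < arcsin 1"
      unfolding \<phi>_def \<epsilon>_def using s
      by (subst arcsin_less_mono; linarith)+
    then have r: "0 < \<phi>" "\<phi> < pi / 2" "0 < \<epsilon>" "\<epsilon> < pi / 2"
      by auto
    have "sin \<phi> = s" "sin \<epsilon> = sqrt \<alpha> * s"
      unfolding \<phi>_def \<epsilon>_def using s by (auto intro!: sin_arcsin)
    then have "(sin \<epsilon> / sin \<phi>)\<^sup>2 = \<alpha>"
      using s that by simp
    then obtain b b' where b: "affine_lift 1 b \<circ> rot \<epsilon> = rot \<phi> \<circ> affine_lift \<alpha> b'"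
      using bruhat[OF r] by metis
    have "affine_lift \<alpha> b' = rot (- \<phi>) \<circ> (rot \<phi> \<circ> affine_lift \<alpha> b')"
      by (auto simp: rot_def)
    also have "\<dots> \<in> S"
      unfolding b[symmetric] by (intro comp S1 S2)
    \<comment> \<open>\<open>bruhat\<close> dictates the translation part \<open>b'\<close>; a
      further translation changes it to \<open>\<beta>\<close>.\<close>
    finally have "affine_lift 1 (\<beta> - b') \<circ> affine_lift \<alpha> b' \<in> S"
      by (intro comp S1)
    then show ?thesis
      by (simp add: affine_lift_comp)
  qed
  obtain \<phi> \<alpha> \<beta> where "\<alpha> > 0" "g = rot \<phi> \<circ> affine_lift \<alpha> \<beta>"
    using mobius_cover_decompose[OF g] .
  then have "g \<in> S"
    using comp S2 S3 by simp
  then show ?thesis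
    by (intro blinfun_eqI) (simp add: S_def)
qed

end

section \<open>Positivity of the energy and the Reeh-Schlieder property\<close>

text \<open>\<open>measure_of\<close> takes the prescribed values only for a positive and countably
  additive function. Projections give nonnegative values, and strong additivity of \<open>E\<close>
  gives the rest.\<close>

lemma
  assumes E: "projection_valued_measure E"
  shows sets_scalar_measure: "sets (scalar_measure E \<xi>) = sets borel"
    and emeasure_scalar_measure: "B \<in> sets borel \<Longrightarrow>
      emeasure (scalar_measure E (\<xi>::'h::{complex_inner,banach})) B = ennreal (Re (cinner \<xi> (E B \<xi>)))"
proof -
  have sig: "sigma_sets UNIV (sets (borel::(real \<times> real) measure)) = sets borel"
    using sets.sigma_sets_eq[of "borel::(real \<times> real) measure"] by simp
  show sets: "sets (scalar_measure E \<xi>) = sets borel"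
    unfolding scalar_measure_def by (subst sets_measure_of) (auto simp: sig)
  have nonneg: "0 \<le> Re (cinner \<xi> (E B \<xi>))" if "B \<in> sets borel" for B
  proof -
    have "E B \<in> clinear_ops" "adj (E B) = E B" "E B o\<^sub>L E B = E B"
      using E that by (auto simp: projection_valued_measure_def)
    then have "cinner \<xi> (E B \<xi>) = cinner (E B \<xi>) (E B \<xi>)"
      by (metis blinfun_apply_blinfun_compose cinner_adj_left)
    then show ?thesis
      by (simp add: cinner_self)
  qed
  have ca: "countably_additive (sets borel) (\<lambda>B. ennreal (Re (cinner \<xi> (E B \<xi>))))"
    unfolding countably_additive_def
  proof (intro allI impI)
    fix F :: "nat \<Rightarrow> (real \<times> real) set"
    assume F: "range F \<subseteq> sets borel" "disjoint_family F"
    have "(\<lambda>n. E (F n) \<xi>) sums E (\<Union>n. F n) \<xi>"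
      using E F by (auto simp: projection_valued_measure_def)
    moreover have "bounded_linear (\<lambda>\<eta>. Re (cinner \<xi> \<eta>))"
      by (intro bounded_linear_compose[OF bounded_linear_Re cinner.bounded_linear_right])
    ultimately have "(\<lambda>n. Re (cinner \<xi> (E (F n) \<xi>))) sums Re (cinner \<xi> (E (\<Union>n. F n) \<xi>))"
      by (rule bounded_linear.sums[rotated])
    then show "(\<Sum>n. ennreal (Re (cinner \<xi> (E (F n) \<xi>)))) = ennreal (Re (cinner \<xi> (E (\<Union>n. F n) \<xi>)))"
      using F by (intro suminf_ennreal_eq nonneg) auto
  qed
  \<comment> \<open>A constant sequence is summable only if it vanishes, so additivity over copies
    of the empty set yields \<open>E {} \<xi> = 0\<close>.\<close>
  have "(\<lambda>n::nat. E {} \<xi>) sums E (\<Union>n::nat. {}) \<xi>"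
    using E by (auto simp: projection_valued_measure_def disjoint_family_on_def dest!: spec[of _ "\<lambda>_. {}"])
  then have "(\<lambda>n::nat. E {} \<xi>) \<longlonglongrightarrow> 0"
    by (intro summable_LIMSEQ_zero sums_summable)
  then have "E {} \<xi> = 0"
    by (simp add: LIMSEQ_const_iff)
  then have pos: "positive (sets borel) (\<lambda>B. ennreal (Re (cinner \<xi> (E B \<xi>))))"
    by (simp add: positive_def)
  show "emeasure (scalar_measure E \<xi>) B = ennreal (Re (cinner \<xi> (E B \<xi>)))" if "B \<in> sets borel"
    by (rule emeasure_measure_of[OF scalar_measure_def]) (use that pos ca in \<open>auto simp: sets\<close>)
qed

lemma finite_scalar_measure:
  fixes \<xi> :: "'h::{complex_inner,banach}"
  assumes E: "projection_valued_measure E"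
  shows "finite_measure (scalar_measure E \<xi>)"
proof
  have "space (scalar_measure E \<xi>) = UNIV"
    using sets_eq_imp_space_eq[OF sets_scalar_measure[OF E]] by simp
  then show "emeasure (scalar_measure E \<xi>) (space (scalar_measure E \<xi>)) \<noteq> \<infinity>"
    by (simp add: emeasure_scalar_measure[OF E])
qed

text \<open>Each point off the support has an open neighbourhood with vanishing projection. By the
  Lindeloef property countably many of them cover the complement, which is therefore null.\<close>

lemma AE_scalar_measure_support:
  fixes \<xi> :: "'h::{complex_inner,banach}"
  assumes E: "projection_valued_measure E"
  shows "AE p in scalar_measure E \<xi>. p \<in> pvm_support E"
proof -
  define \<F> where "\<F> = {N. open N \<and> E N = 0}"
  obtain \<F>' where \<F>': "\<F>' \<subseteq> \<F>" "countable \<F>'" "\<Union>\<F>' = \<Union>\<F>"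
    by (rule Lindelof[of \<F>]) (auto simp: \<F>_def)
  have "(\<Union>N\<in>\<F>'. N) \<in> null_sets (scalar_measure E \<xi>)"
  proof (rule null_sets_UN'[OF \<F>'(2)])
    fix N assume "N \<in> \<F>'"
    then have "open N" "E N = 0"
      using \<F>'(1) by (auto simp: \<F>_def)
    then show "N \<in> null_sets (scalar_measure E \<xi>)"
      by (auto simp: null_sets_def sets_scalar_measure[OF E] emeasure_scalar_measure[OF E])
  qed
  then show ?thesis
  proof (rule AE_I')
    show "{p \<in> space (scalar_measure E \<xi>). p \<notin> pvm_support E} \<subseteq> (\<Union>N\<in>\<F>'. N)"
      using \<F>'(3) by (auto simp: pvm_support_def \<F>_def)
  qed
qed

text \<open>For nonnegative \<open>q p\<close> the exponential has modulus at most 1 in the closed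
  upper half-plane, whence continuity up to the boundary. Inside, exponential decay beats the factor
  \<open>q p\<close> produced by differentiation.\<close>

lemma laplace_transform:
  fixes \<mu> :: "'a::topological_space measure" and q :: "'a \<Rightarrow> real"
  assumes fin: "finite_measure \<mu>" and q[measurable]: "q \<in> borel_measurable \<mu>" and pos: "AE p in \<mu>. 0 \<le> q p"
  defines "F \<equiv> \<lambda>z. LINT p|\<mu>. exp (\<i> * z * complex_of_real (q p))"
  shows "continuous_on {z. 0 \<le> Im z} F" "F holomorphic_on {z. 0 < Im z}"
proof -
  interpret finite_measure \<mu> by fact
  have norm_exp: "norm (exp (\<i> * z * complex_of_real x)) = exp (- (Im z * x))" for z x
    by (simp add: norm_exp_eq_Re)
  have meas: "(\<lambda>p. exp (\<i> * z * complex_of_real (q p))) \<in> borel_measurable \<mu>" for z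
    by measurable
  have int: "integrable \<mu> (\<lambda>p. exp (\<i> * z * complex_of_real (q p)))" if "0 \<le> Im z" for z
  proof (rule integrable_const_bound[OF _ meas])
    show "AE p in \<mu>. norm (exp (\<i> * z * complex_of_real (q p))) \<le> 1"
      using pos by eventually_elim (simp add: norm_exp that)
  qed
  show "continuous_on {z. 0 \<le> Im z} F"
  proof (rule continuous_on_sequentiallyI)
    fix u a assume u: "\<forall>n. u n \<in> {z. 0 \<le> Im z}" "a \<in> {z. 0 \<le> Im z}" "u \<longlonglongrightarrow> a"
    show "(\<lambda>n. F (u n)) \<longlonglongrightarrow> F a"
      unfolding F_def
    proof (rule integral_dominated_convergence[where w = "\<lambda>_. 1"])
      show "AE p in \<mu>. (\<lambda>n. exp (\<i> * u n * complex_of_real (q p))) \<longlonglongrightarrow> exp (\<i> * a * complex_of_real (q p))"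
        by (intro AE_I2 tendsto_intros u)
      show "AE p in \<mu>. norm (exp (\<i> * u n * complex_of_real (q p))) \<le> 1" for n
        using pos by eventually_elim (use u(1) in \<open>simp add: norm_exp\<close>)
    qed (auto intro: meas)
  qed
  show "F holomorphic_on {z. 0 < Im z}"
  proof (rule holomorphic_onI)
    fix z assume "z \<in> {z. 0 < Im z}"
    then have z: "0 < Im z"
      by simp
    \<comment> \<open>Half the height: the disc of radius \<open>y\<close> about \<open>z\<close>
      stays above height \<open>y\<close>, where the derivative is bounded by \<open>1 / y\<close>
      uniformly in \<open>p\<close>.\<close>
    define y where "y = Im z / 2"
    have y: "y > 0"
      using z by (simp add: y_def)
    have bound: "\<bar>x\<bar> * exp (- (v * x)) \<le> 1 / y" if "x \<ge> 0" "v \<ge> y" for x v :: real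
    proof -
      have "y * x \<le> v * x"
        using that by (intro mult_right_mono)
      also have "\<dots> \<le> exp (v * x)"
        using exp_ge_add_one_self[of "v * x"] by linarith
      finally have "y * x * exp (- (v * x)) \<le> 1"
        by (simp add: exp_minus field_simps)
      then show ?thesis
        using y that by (simp add: field_simps)
    qed
    define f where "f w x = exp (\<i> * w * complex_of_real x)" for w :: complex and x :: real
    \<comment> \<open>The mean value inequality bounds all difference quotients by the constant
      \<open>1 / y\<close>, which is integrable since the measure is finite.\<close>
    have lip: "norm (f w x - f z x) \<le> 1 / y * norm (w - z)" if "w \<in> ball z y" "x \<ge> 0" for w x
    proof (rule field_differentiable_bound[where S = "ball z y" and f' = "\<lambda>w. \<i> * complex_of_real x * f w x"])
      show "((\<lambda>w. f w x) has_field_derivative \<i> * complex_of_real x * f v x) (at v within ball z y)" for v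
        unfolding f_def by (auto intro!: derivative_eq_intros)
      show "norm (\<i> * complex_of_real x * f v x) \<le> 1 / y" if "v \<in> ball z y" for v
      proof -
        have "\<bar>Im z - Im v\<bar> < y"
          using that abs_Im_le_cmod[of "z - v"] by (simp add: dist_norm)
        then have "Im v \<ge> y"
          unfolding y_def by linarith
        with bound[OF \<open>x \<ge> 0\<close> this] show ?thesis
          by (simp add: f_def norm_mult norm_exp)
      qed
    qed (use that y in auto)
    have "(F has_field_derivative (LINT p|\<mu>. \<i> * complex_of_real (q p) * f z (q p))) (at z)"
      unfolding has_field_derivative_iff tendsto_at_iff_sequentially
    proof (intro allI impI)
      fix X assume X: "\<forall>i. X i \<in> UNIV - {z}" "X \<longlonglongrightarrow> z"
      have "\<forall>\<^sub>F n in sequentially. X n \<in> ball z y"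
        using X(2) y by (intro topological_tendstoD) auto
      then obtain N where N: "\<And>n. X (n + N) \<in> ball z y"
        by (auto simp: eventually_sequentially) (metis le_add2)
      have Im_pos: "Im (X (n + N)) \<ge> 0" for n
        using N[of n] abs_Im_le_cmod[of "z - X (n + N)"] y by (simp add: dist_norm y_def)
      have "(\<lambda>n. LINT p|\<mu>. (f (X (n + N)) (q p) - f z (q p)) / (X (n + N) - z))
          \<longlonglongrightarrow> (LINT p|\<mu>. \<i> * complex_of_real (q p) * f z (q p))"
      proof (rule integral_dominated_convergence[where w = "\<lambda>_. 1 / y"])
        show "AE p in \<mu>. (\<lambda>n. (f (X (n + N)) (q p) - f z (q p)) / (X (n + N) - z))
            \<longlonglongrightarrow> \<i> * complex_of_real (q p) * f z (q p)"
        proof (rule AE_I2)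
          fix p
          have "((\<lambda>w. f w (q p)) has_field_derivative \<i> * complex_of_real (q p) * f z (q p)) (at z)"
            unfolding f_def by (auto intro!: derivative_eq_intros)
          then show "(\<lambda>n. (f (X (n + N)) (q p) - f z (q p)) / (X (n + N) - z))
            \<longlonglongrightarrow> \<i> * complex_of_real (q p) * f z (q p)"
            unfolding has_field_derivative_iff tendsto_at_iff_sequentially
            using X LIMSEQ_ignore_initial_segment[OF X(2), of N]
            by (auto simp: comp_def dest!: spec[of _ "\<lambda>n. X (n + N)"])
        qed
        show "AE p in \<mu>. norm ((f (X (n + N)) (q p) - f z (q p)) / (X (n + N) - z)) \<le> 1 / y" for n
          using pos
        proof eventually_elim
          case (elim p)
          have "X (n + N) - z \<noteq> 0"
            using X(1) by auto
          then show ?case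
            using lip[OF N[of n] elim] y by (simp add: norm_divide pos_divide_le_eq)
        qed
      qed (auto simp: f_def)
      also have "(\<lambda>n. LINT p|\<mu>. (f (X (n + N)) (q p) - f z (q p)) / (X (n + N) - z))
          = (\<lambda>n. (F (X (n + N)) - F z) / (X (n + N) - z))"
        unfolding F_def f_def using int[OF Im_pos] int[OF less_imp_le[OF z]] by simp
      finally show "((\<lambda>y. (F y - F z) / (y - z)) \<circ> X) \<longlonglongrightarrow> (LINT p|\<mu>. \<i> * complex_of_real (q p) * f z (q p))"
        unfolding comp_def
        by (rule LIMSEQ_offset[where k = N and f = "\<lambda>n. (F (X n) - F z) / (X n - z)"])
    qed
    then show "F field_differentiable at z within {z. 0 < Im z}"
      using field_differentiable_def field_differentiable_at_within by blast
  qed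
qed

text \<open>Vanishing on a real interval permits Schwarz reflection to a disc, where the identity
  theorem gives zero. The zeros then spread through the half-plane and, by continuity, to the whole
  real line.\<close>

lemma upper_half_plane_vanish:
  assumes cont: "continuous_on {z. 0 \<le> Im z} G" and holo: "G holomorphic_on {z. 0 < Im z}"
    and "\<delta> > 0" and zero: "\<And>t. \<bar>t\<bar> < \<delta> \<Longrightarrow> G (complex_of_real t) = 0"
  shows "G (complex_of_real t) = 0"
proof -
  define H where "H z = (if 0 \<le> Im z then G z else cnj (G (cnj z)))" for z
  have H: "H holomorphic_on ball 0 \<delta>"
    unfolding H_def
  proof (rule Schwarz_reflection)
    show "G holomorphic_on ball 0 \<delta> \<inter> {z. 0 < Im z}" "continuous_on (ball 0 \<delta> \<inter> {z. 0 \<le> Im z}) G"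
      using cont holo by (auto intro: continuous_on_subset holomorphic_on_subset)
    show "G z \<in> \<real>" if "z \<in> ball 0 \<delta>" "z \<in> \<real>" for z
      using that zero by (auto elim!: Reals_cases)
  qed auto
  have "H z = 0" if "z \<in> ball 0 \<delta>" for z
  proof (rule analytic_continuation[OF H _ _ _ _ _ _ that])
    let ?U = "complex_of_real ` {-\<delta><..<\<delta>}"
    show "?U \<subseteq> ball 0 \<delta>" "0 \<in> ball (0::complex) \<delta>"
      using \<open>\<delta> > 0\<close> by auto
    show "H w = 0" if "w \<in> ?U" for w
      using that zero by (auto simp: H_def)
    show "0 islimpt ?U"
      unfolding islimpt_approachable
    proof (intro allI impI)
      fix e :: real assume "e > 0"
      define t where "t = min e \<delta> / 2"
      have "0 < t" "t < e" "t < \<delta>"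
        using \<open>e > 0\<close> \<open>\<delta> > 0\<close> by (auto simp: t_def min_def)
      then show "\<exists>x'\<in>?U. x' \<noteq> 0 \<and> dist x' 0 < e"
        by (intro bexI[of _ "complex_of_real t"]) auto
    qed
  qed auto
  then have G0: "G z = 0" if "z \<in> ball 0 \<delta> \<inter> {z. 0 < Im z}" for z
    using that H_def by (metis Int_iff less_imp_le mem_Collect_eq)
  have half: "G z = 0" if "z \<in> {z. 0 < Im z}" for z
  proof (rule analytic_continuation_open[where s = "ball 0 \<delta> \<inter> {z. 0 < Im z}" and g = "\<lambda>_. 0", OF _ _ _ _ _ holo])
    show "open (ball 0 \<delta> \<inter> {z. 0 < Im z})" "open {z. 0 < Im z}"
      by (auto intro!: open_Int open_halfspace_Im_gt)
    show "connected {z. 0 < Im z}"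
      by (intro convex_connected convex_halfspace_Im_gt)
    show "ball 0 \<delta> \<inter> {z. 0 < Im z} \<noteq> {}"
    proof -
      have "\<i> * complex_of_real (\<delta> / 2) \<in> ball 0 \<delta> \<inter> {z. 0 < Im z}"
        using \<open>\<delta> > 0\<close> by (simp add: norm_mult)
      then show ?thesis
        by blast
    qed
  qed (use G0 that in auto)
  have "(\<lambda>n. complex_of_real t + \<i> * complex_of_real (inverse (real (Suc n)))) \<longlonglongrightarrow> complex_of_real t + \<i> * complex_of_real 0"
    by (intro tendsto_intros tendsto_of_real LIMSEQ_inverse_real_of_nat)
  then have "(\<lambda>n. G (complex_of_real t + \<i> * complex_of_real (inverse (real (Suc n))))) \<longlonglongrightarrow> G (complex_of_real t)"
    by (intro continuous_on_tendsto_compose[OF cont]) auto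
  moreover have "G (complex_of_real t + \<i> * complex_of_real (inverse (real (Suc n)))) = 0" for n
    by (rule half) simp
  ultimately show ?thesis
    by (simp add: LIMSEQ_const_iff)
qed

text \<open>\<open>spectral_measure_of\<close> describes diagonal coefficients only; this recovers
  the mixed ones.\<close>

lemma polarization:
  fixes x :: "'h::{complex_inner,banach} \<Rightarrow>\<^sub>L 'h"
  assumes "x \<in> clinear_ops"
  shows "cinner \<xi> (x \<eta>) = (cinner (\<xi> + \<eta>) (x (\<xi> + \<eta>)) - \<i> * cinner (\<xi> + \<i> *\<^sub>C \<eta>) (x (\<xi> + \<i> *\<^sub>C \<eta>))
    - cinner (\<xi> - \<eta>) (x (\<xi> - \<eta>)) + \<i> * cinner (\<xi> - \<i> *\<^sub>C \<eta>) (x (\<xi> - \<i> *\<^sub>C \<eta>))) / 4"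
proof -
  have "x (\<i> *\<^sub>C \<eta>) = \<i> *\<^sub>C x \<eta>"
    using assms by (simp add: clinear_ops_def)
  then show ?thesis
    by (simp add: blinfun.add_right blinfun.diff_right cinner.add_left cinner.add_right
        cinner.diff_left cinner.diff_right cinner_scaleC_left cinner_scaleC_right algebra_simps)
qed

text \<open>Along a lightlike direction the phase is \<open>t\<close> times
  \<open>fst p - s * snd p\<close>, which is nonnegative on the spectrum. So the coefficient is the
  boundary value of a function holomorphic in the upper half-plane.\<close>

lemma positive_energy_vanish:
  fixes T :: "real \<times> real \<Rightarrow> ('h::{complex_inner,banach} \<Rightarrow>\<^sub>L 'h)"
  assumes E: "spectral_measure_of T E"
    and supp: "pvm_support E \<subseteq> {p. fst p + snd p \<ge> 0 \<and> fst p - snd p \<ge> 0}"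
    and s: "s = 1 \<or> s = - 1" and cl: "\<And>a. T a \<in> clinear_ops"
    and "\<delta> > 0" and zero: "\<And>t. \<bar>t\<bar> < \<delta> \<Longrightarrow> cinner \<xi> (T (t, s * t) \<eta>) = 0"
  shows "cinner \<xi> (T (t, s * t) \<eta>) = 0"
proof -
  have pvm: "projection_valued_measure E"
    using E by (simp add: spectral_measure_of_def)
  define q where "q p = fst p - s * snd p" for p :: "real \<times> real"
  define F where "F \<zeta> z = (LINT p|scalar_measure E \<zeta>. exp (\<i> * z * complex_of_real (q p)))" for \<zeta> z
  have F: "continuous_on {z. 0 \<le> Im z} (F \<zeta>)" "F \<zeta> holomorphic_on {z. 0 < Im z}" for \<zeta>
  proof -
    have "q \<in> borel_measurable borel"
      unfolding q_def by (intro borel_measurable_continuous_onI continuous_intros)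
    then have "q \<in> borel_measurable (scalar_measure E \<zeta>)"
      by (simp add: measurable_cong_sets[OF sets_scalar_measure[OF pvm] refl])
    moreover have "AE p in scalar_measure E \<zeta>. 0 \<le> q p"
      using AE_scalar_measure_support[OF pvm] by eventually_elim (use supp s in \<open>auto simp: q_def\<close>)
    ultimately show "continuous_on {z. 0 \<le> Im z} (F \<zeta>)" "F \<zeta> holomorphic_on {z. 0 < Im z}"
      unfolding F_def using laplace_transform finite_scalar_measure[OF pvm] by blast+
  qed
  have T: "cinner \<zeta> (T (t, s * t) \<zeta>) = F \<zeta> (complex_of_real t)" for \<zeta> t
  proof -
    have "cinner \<zeta> (T (t, s * t) \<zeta>) = (LINT p|scalar_measure E \<zeta>. cis (t * fst p - s * t * snd p))"
      using E by (simp add: spectral_measure_of_def)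
    also have "\<dots> = F \<zeta> (complex_of_real t)"
      unfolding F_def by (rule Bochner_Integration.integral_cong)
        (auto simp: cis_conv_exp q_def algebra_simps)
    finally show ?thesis .
  qed
  define G where "G z = (F (\<xi> + \<eta>) z - \<i> * F (\<xi> + \<i> *\<^sub>C \<eta>) z - F (\<xi> - \<eta>) z + \<i> * F (\<xi> - \<i> *\<^sub>C \<eta>) z) / 4" for z
  have G: "cinner \<xi> (T (t, s * t) \<eta>) = G (complex_of_real t)" for t
    unfolding G_def T[symmetric] by (rule polarization[OF cl])
  show ?thesis
    unfolding G
  proof (rule upper_half_plane_vanish[OF _ _ \<open>\<delta> > 0\<close>])
    show "continuous_on {z. 0 \<le> Im z} G" "G holomorphic_on {z. 0 < Im z}"
      unfolding G_def by (auto intro!: continuous_intros holomorphic_intros F)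
    show "G (complex_of_real t) = 0" if "\<bar>t\<bar> < \<delta>" for t
      using zero[OF that] G by simp
  qed
qed

section \<open>Double cones and the subspaces generated from the vacuum\<close>

lemma closed_blinfun_vimage: "closed S \<Longrightarrow> closed {\<xi>. blinfun_apply x \<xi> \<in> S}"
  using continuous_closed_vimage[of S "blinfun_apply x"]
  by (simp add: vimage_def linear_continuous_at blinfun.bounded_linear_right)

lemma open_double_cone: "open I \<Longrightarrow> open J \<Longrightarrow> open (double_cone I J)"
proof -
  assume "open I" "open J"
  have "double_cone I J = (\<lambda>a. fst a - snd a) -` I \<inter> (\<lambda>a. fst a + snd a) -` J"
    by (auto simp: double_cone_def)
  then show ?thesis
    using \<open>open I\<close> \<open>open J\<close> by (auto intro!: open_Int open_vimage continuous_intros)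
qed

lemma bounded_double_cone: "bounded I \<Longrightarrow> bounded J \<Longrightarrow> bounded (double_cone I J)"
proof -
  assume "bounded I" "bounded J"
  then obtain b c where b: "\<And>x. x \<in> I \<Longrightarrow> \<bar>x\<bar> \<le> b" and c: "\<And>x. x \<in> J \<Longrightarrow> \<bar>x\<bar> \<le> c"
    by (auto simp: bounded_iff)
  have "norm a \<le> b + c" if "a \<in> double_cone I J" for a
  proof -
    have "\<bar>fst a - snd a\<bar> \<le> b" "\<bar>fst a + snd a\<bar> \<le> c"
      using that b c by (auto simp: double_cone_def)
    moreover have "norm a \<le> \<bar>fst a\<bar> + \<bar>snd a\<bar>"
      using norm_fst_le norm_Pair_le[of "fst a" "snd a"] by (metis prod.collapse real_norm_def)
    ultimately show ?thesis
      by linarith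
  qed
  then show ?thesis
    unfolding bounded_iff by blast
qed

lemma double_cone_mono: "I \<subseteq> I' \<Longrightarrow> J \<subseteq> J' \<Longrightarrow> double_cone I J \<subseteq> double_cone I' J'"
  by (auto simp: double_cone_def)

lemma translation_map: "(\<lambda>a. a + b) = poincare_map 0 b"
  by (auto simp: poincare_map_def fun_eq_iff prod_eq_iff)

lemma translation_in_group: "(\<lambda>a. a + b) \<in> poincare_group"
  unfolding translation_map poincare_group_def by blast

context poincare_covariant_net
begin

definition cyc :: "(real \<times> real) set \<Rightarrow> 'h set" where
  "cyc R = closure ((\<lambda>x. blinfun_apply x \<Omega>) ` A R)"

abbreviation "T \<equiv> translation_op U"

lemma T_unitary: "unitary_op (T a)"
  using representation translation_in_group by (simp add: unitary_representation_def translation_op_def)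

lemma T_add: "T (a + b) = T a o\<^sub>L T b"
proof -
  have "(\<lambda>x. x + (a + b)) = (\<lambda>x. x + a) \<circ> (\<lambda>x. x + b)"
    by (auto simp: add_ac)
  then show ?thesis
    using representation translation_in_group
    unfolding unitary_representation_def translation_op_def by metis
qed

lemma T_0: "T 0 = id_blinfun"
proof (rule blinfun_eqI)
  fix \<xi>
  have "T 0 (T 0 \<xi>) = T 0 \<xi>"
    using T_add[of 0 0] by (metis add_0 blinfun_apply_blinfun_compose)
  then show "T 0 \<xi> = id_blinfun \<xi>"
    by (metis T_unitary unitary_adj_apply id_blinfun.rep_eq id_apply)
qed

lemma adj_T: "adj (T a) = T (- a)"
proof (rule blinfun_eqI)
  fix \<xi>
  have "T a (T (- a) \<xi>) = \<xi>"
    using T_add[of a "- a"] T_0 by (metis add.right_inverse blinfun_apply_blinfun_compose id_apply id_blinfun.rep_eq)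
  then show "adj (T a) \<xi> = T (- a) \<xi>"
    by (metis T_unitary unitary_adj_apply)
qed

lemma T_vacuum: "T a \<Omega> = \<Omega>"
  using vacuum_invariant[OF translation_in_group] by (simp add: translation_op_def)

lemma T_covariance: "open R \<Longrightarrow> bounded R \<Longrightarrow> conj_by (T a) ` A R = A ((\<lambda>x. x + a) ` R)"
  using covariance[OF translation_in_group] by (simp add: translation_op_def)

lemma csubspace_cyc: "open R \<Longrightarrow> bounded R \<Longrightarrow> csubspace (cyc R)"
  unfolding cyc_def by (intro csubspace_closure csubspace_vN_orbit von_neumann)

lemma closed_cyc: "closed (cyc R)"
  by (simp add: cyc_def)

lemma cyc_mono: "open R \<Longrightarrow> bounded R \<Longrightarrow> open S \<Longrightarrow> bounded S \<Longrightarrow> R \<subseteq> S \<Longrightarrow> cyc R \<subseteq> cyc S"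
  unfolding cyc_def by (intro closure_mono image_mono isotony)

lemma in_cyc: "x \<in> A R \<Longrightarrow> x \<Omega> \<in> cyc R"
  unfolding cyc_def by (intro subsetD[OF closure_subset]) auto

lemma cyc_apply:
  assumes "open R" "bounded R" "x \<in> A R" "\<xi> \<in> cyc R"
  shows "x \<xi> \<in> cyc R"
proof -
  have "cyc R \<subseteq> {\<xi>. x \<xi> \<in> cyc R}"
    unfolding cyc_def[of R]
  proof (rule closure_minimal)
    show "(\<lambda>x. blinfun_apply x \<Omega>) ` A R \<subseteq> {\<xi>. x \<xi> \<in> closure ((\<lambda>x. blinfun_apply x \<Omega>) ` A R)}"
      using vN_compose[OF von_neumann[OF assms(1,2)] assms(3)] in_cyc[unfolded cyc_def]
      by (auto simp flip: blinfun_apply_blinfun_compose)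
    show "closed {\<xi>. x \<xi> \<in> closure ((\<lambda>x. blinfun_apply x \<Omega>) ` A R)}"
      by (intro closed_blinfun_vimage closed_closure)
  qed
  then show ?thesis
    using assms by auto
qed

lemma vacuum_in_cyc: "open R \<Longrightarrow> bounded R \<Longrightarrow> \<Omega> \<in> cyc R"
  using in_cyc[OF vN_id[OF von_neumann]] by simp

text \<open>For small \<open>t\<close> covariance keeps the translated local vectors in
  \<open>cyc R'\<close>. Their coefficient with a vector orthogonal to \<open>cyc R'\<close>
  vanishes for small \<open>t\<close>, hence by positivity of the energy for all
  \<open>t\<close>.\<close>

lemma translate_cyc:
  assumes R: "open R" "bounded R" and R': "open R'" "bounded R'" and s: "s = 1 \<or> s = - 1"
    and "\<delta> > 0" and sub: "\<And>t. \<bar>t\<bar> < \<delta> \<Longrightarrow> (\<lambda>x. x + (t, s * t)) ` R \<subseteq> R'"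
    and \<xi>: "\<xi> \<in> cyc R"
  shows "T (t, s * t) \<xi> \<in> cyc R'"
proof -
  have 1: "T (t, s * t) (x \<Omega>) \<in> cyc R'" if x: "x \<in> A R" for x
  proof (rule orth_dense[OF csubspace_cyc[OF R'] closed_cyc])
    fix \<eta> assume \<eta>: "\<forall>\<zeta>\<in>cyc R'. cinner \<zeta> \<eta> = 0"
    obtain E where E: "spectral_measure_of T E"
        "pvm_support E \<subseteq> {p. fst p + snd p \<ge> 0 \<and> fst p - snd p \<ge> 0}"
      using spectrum_condition by blast
    show "cinner \<eta> (T (t, s * t) (x \<Omega>)) = 0"
    proof (rule positive_energy_vanish[OF E s unitary_clinear[OF T_unitary] \<open>\<delta> > 0\<close>])
      fix t assume t: "\<bar>t\<bar> < \<delta>"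
      have op: "open ((\<lambda>x. x + (t, s * t)) ` R)" "bounded ((\<lambda>x. x + (t, s * t)) ` R)"
        using open_translation[OF R(1), of "(t, s * t)"] bounded_translation[OF R(2), of "(t, s * t)"]
        by (auto simp: add.commute)
      have "conj_by (T (t, s * t)) x \<in> A ((\<lambda>x. x + (t, s * t)) ` R)"
        using T_covariance[OF R] x by blast
      then have "conj_by (T (t, s * t)) x \<in> A R'"
        using isotony[OF op R' sub[OF t]] by blast
      then have "conj_by (T (t, s * t)) x \<Omega> \<in> cyc R'"
        by (rule in_cyc)
      then have "T (t, s * t) (x \<Omega>) \<in> cyc R'"
        by (simp add: conj_by_apply adj_T T_vacuum)
      then show "cinner \<eta> (T (t, s * t) (x \<Omega>)) = 0"
        using \<eta> by (metis cinner_commute complex_cnj_zero)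
    qed
  qed
  have "cyc R \<subseteq> {\<xi>. T (t, s * t) \<xi> \<in> cyc R'}"
    unfolding cyc_def[of R]
  proof (rule closure_minimal)
    show "closed {\<xi>. T (t, s * t) \<xi> \<in> cyc R'}"
      by (intro closed_blinfun_vimage closed_cyc)
  qed (use 1 in auto)
  then show ?thesis
    using \<xi> by auto
qed

text \<open>A closed subspace that contains \<open>\<Omega>\<close> and is invariant under all
  translations and one small algebra is invariant under all local algebras, by covariance and
  additivity. Cyclicity of \<open>\<Omega>\<close> makes it the whole space.\<close>

theorem reeh_schlieder:
  assumes "bounded_interval I" "bounded_interval J"
  shows "cyc (double_cone I J) = UNIV"
proof -
  obtain a b c d where ab: "a < b" "I = {a<..<b}" and cd: "c < d" "J = {c<..<d}"
    using assms by (auto simp: bounded_interval_def)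
  define u v where "u = (a + b) / 2" and "v = (c + d) / 2"
  define D where "D r = double_cone {u - r<..<u + r} {v - r<..<v + r}" for r
  define r where "r = min ((b - a) / 2) ((d - c) / 2)"
  define r0 where "r0 = r / 2"
  have r: "0 < r0" "r0 < r"
    using ab cd by (auto simp: r0_def r_def min_def)
  have D: "open (D r)" "bounded (D r)" for r
    by (auto simp: D_def intro!: open_double_cone bounded_double_cone)
  have D_mono: "D r \<subseteq> D r'" if "r \<le> r'" for r r'
    using that unfolding D_def by (intro double_cone_mono) auto
  \<comment> \<open>Each use of \<open>translate_cyc\<close> enlarges the region a little.
    Intersecting over all radii above \<open>r0\<close> absorbs this loss and makes \<open>Z\<close>
    exactly translation invariant, while \<open>A (D r0)\<close> still acts on it.\<close>
  define Z where "Z = (\<Inter>r\<in>{r0<..}. cyc (D r))"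
  have Z: "csubspace Z" "closed Z"
    using csubspace_cyc[OF D] unfolding Z_def csubspace_def
    by (auto intro!: closed_INT closed_cyc)
  have \<Omega>: "\<Omega> \<in> Z"
    by (auto simp: Z_def intro!: vacuum_in_cyc D)
  have inv_A: "x \<xi> \<in> Z" if "x \<in> A (D r0)" "\<xi> \<in> Z" for x \<xi>
    unfolding Z_def
  proof
    fix r assume r: "r \<in> {r0<..}"
    have "x \<in> A (D r)"
      using that(1) isotony[OF D D D_mono, of r0 r] r by auto
    then show "x \<xi> \<in> cyc (D r)"
      using that(2) r by (intro cyc_apply D) (auto simp: Z_def)
  qed
  have inv_T: "T (t, s * t) \<xi> \<in> Z" if "\<xi> \<in> Z" and s: "s = 1 \<or> s = - 1" for s t \<xi>
    unfolding Z_def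
  proof
    fix r assume r: "r \<in> {r0<..}"
    define r' where "r' = (r0 + r) / 2"
    have r': "r0 < r'" "r' < r"
      using r by (auto simp: r'_def)
    show "T (t, s * t) \<xi> \<in> cyc (D r)"
    \<comment> \<open>The light-cone coordinate that moves changes by \<open>2 * t\<close>, hence
      half of the margin \<open>r - r'\<close>.\<close>
    proof (rule translate_cyc[OF D D s, where \<delta> = "(r - r') / 2"])
      show "(\<lambda>x. x + (t, s * t)) ` D r' \<subseteq> D r" if "\<bar>t\<bar> < (r - r') / 2" for t
        using that s r' by (auto simp: D_def double_cone_def abs_less_iff)
      show "\<xi> \<in> cyc (D r')"
        using that(1) r' by (auto simp: Z_def)
    qed (use r' in simp)
  qed
  have inv_T': "T x \<xi> \<in> Z" if "\<xi> \<in> Z" for x \<xi>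
  proof -
    \<comment> \<open>Every translation is a product of two lightlike ones.\<close>
    define t t' where "t = (fst x + snd x) / 2" and "t' = (fst x - snd x) / 2"
    have "x = (t, 1 * t) + (t', - 1 * t')"
      by (auto simp: t_def t'_def prod_eq_iff field_simps)
    then have "T x \<xi> = T (t, 1 * t) (T (t', - 1 * t') \<xi>)"
      by (simp only: T_add blinfun_apply_blinfun_compose)
    moreover have "T (t, 1 * t) (T (t', - 1 * t') \<xi>) \<in> Z"
      using that by (intro inv_T) auto
    ultimately show ?thesis
      by simp
  qed
  let ?P = "proj_op Z"
  have comm_T: "T x o\<^sub>L ?P = ?P o\<^sub>L T x" for x
    by (rule proj_op_commutes[OF Z unitary_clinear[OF T_unitary]]) (auto simp: adj_T inv_T')
  have comm_A: "x o\<^sub>L ?P = ?P o\<^sub>L x" if "x \<in> A (D r0)" for x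
    using that vN_clinear[OF von_neumann[OF D]] vN_adj[OF von_neumann[OF D]]
    by (intro proj_op_commutes[OF Z] inv_A) auto
  have comm_D: "x o\<^sub>L ?P = ?P o\<^sub>L x" if "x \<in> A ((\<lambda>y. y + z) ` D r0)" for x z
  proof -
    have "conj_by (T z) ` A (D r0) = A ((\<lambda>y. y + z) ` D r0)"
      by (rule T_covariance[OF D])
    then have "x \<in> conj_by (T z) ` A (D r0)"
      using that by simp
    then obtain w where w: "w \<in> A (D r0)" "x = conj_by (T z) w"
      by (rule imageE)
    have c: "T z (?P \<xi>) = ?P (T z \<xi>)" "w (?P \<xi>) = ?P (w \<xi>)" for z \<xi>
      using arg_cong[OF comm_T[of z], of "\<lambda>x. blinfun_apply x \<xi>"]
        arg_cong[OF comm_A[OF w(1)], of "\<lambda>x. blinfun_apply x \<xi>"] by simp_all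
    show ?thesis
      by (rule blinfun_eqI) (simp add: w(2) conj_by_apply adj_T c)
  qed
  have comm: "x o\<^sub>L ?P = ?P o\<^sub>L x" if R: "open R" "bounded R" and x: "x \<in> A R" for R x
  proof -
    \<comment> \<open>The translates are cut down to \<open>R\<close> so that their union is exactly
      \<open>R\<close>, as additivity demands.\<close>
    define \<R> where "\<R> = (\<lambda>z. R \<inter> (\<lambda>y. y + z) ` D r0) ` UNIV"
    have opD: "open ((\<lambda>y. y + z) ` D r0)" "bounded ((\<lambda>y. y + z) ` D r0)" for z
      using open_translation[OF D(1), of z r0] bounded_translation[OF D(2), of z r0]
      by (auto simp: add.commute)
    have "y \<in> (\<lambda>x. x + (y - (u / 2 + v / 2, v / 2 - u / 2))) ` D r0" for y
      using r by (intro image_eqI[of _ _ "(u / 2 + v / 2, v / 2 - u / 2)"]) (auto simp: D_def double_cone_def)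
    then have cover: "\<Union>\<R> = R"
      unfolding \<R>_def by blast
    have op: "open S \<and> bounded S" if "S \<in> \<R>" for S
      using that R opD by (auto simp: \<R>_def)
    have comm_S: "y o\<^sub>L ?P = ?P o\<^sub>L y" if "S \<in> \<R>" "y \<in> A S" for S y
    proof -
      obtain z where "S = R \<inter> (\<lambda>y. y + z) ` D r0"
        using \<open>S \<in> \<R>\<close> by (auto simp: \<R>_def)
      then have "A S \<subseteq> A ((\<lambda>y. y + z) ` D r0)"
        using op[OF \<open>S \<in> \<R>\<close>] opD by (intro isotony) auto
      then show ?thesis
        using that comm_D by blast
    qed
    have "A R = vN_generated (\<Union>S\<in>\<R>. A S)"
      using additivity[of \<R>] op R by (simp add: cover)
    then have "x \<in> vN_generated (\<Union>S\<in>\<R>. A S)"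
      using x by simp
    moreover have "(\<Union>S\<in>\<R>. A S) \<subseteq> clinear_ops"
      using vN_clinear[OF von_neumann] op by blast
    moreover have "adj y \<in> (\<Union>S\<in>\<R>. A S)" if "y \<in> (\<Union>S\<in>\<R>. A S)" for y
      using vN_adj[OF von_neumann] op that by blast
    moreover have "?P \<in> commutant (\<Union>S\<in>\<R>. A S)"
      using comm_S by (auto simp: commutant_def proj_op_clinear[OF Z])
    ultimately show ?thesis
      by (intro vN_generated_commutes[of "\<Union>S\<in>\<R>. A S"])
  qed
  let ?S = "\<Union>R\<in>{R. open R \<and> bounded R}. A R"
  have "x \<Omega> \<in> Z" if "x \<in> vN_generated ?S" for x
  proof -
    have "?S \<subseteq> clinear_ops"
      using vN_clinear[OF von_neumann] by blast
    moreover have "adj y \<in> ?S" if "y \<in> ?S" for y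
      using vN_adj[OF von_neumann] that by blast
    moreover have "?P \<in> commutant ?S"
      using comm by (auto simp: commutant_def proj_op_clinear[OF Z])
    ultimately have "x o\<^sub>L ?P = ?P o\<^sub>L x"
      using that by (intro vN_generated_commutes[of ?S])
    then have "x (?P \<Omega>) = ?P (x \<Omega>)"
      by (metis blinfun_apply_blinfun_compose)
    moreover have "?P \<Omega> = \<Omega>"
      using orth_proj_fixed[OF Z(1) \<Omega>] proj_op_apply[OF Z] by simp
    ultimately show ?thesis
      using orth_proj_in[OF Z, of "x \<Omega>"] proj_op_apply[OF Z] by metis
  qed
  then have "closure ((\<lambda>x. blinfun_apply x \<Omega>) ` vN_generated ?S) \<subseteq> Z"
    by (intro closure_minimal Z(2)) auto
  then have "Z = UNIV"
    using vacuum_cyclic by auto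
  then have "cyc (D r) = UNIV"
    using r by (auto simp: Z_def)
  moreover have "cyc (D r) \<subseteq> cyc (double_cone I J)"
  proof (rule cyc_mono[OF D])
    show "open (double_cone I J)" "bounded (double_cone I J)"
      by (auto simp: ab cd intro!: open_double_cone bounded_double_cone)
    show "D r \<subseteq> double_cone I J"
      unfolding D_def ab cd by (intro double_cone_mono) (auto simp: u_def v_def r_def min_def field_simps)
  qed
  ultimately show ?thesis
    by auto
qed

end

section \<open>Mean ergodic theorem\<close>

text \<open>Uniform boundedness makes convergence stable under limits of the argument. The filter is
  arbitrary because both sequences and a real parameter tending to infinity occur.\<close>

lemma closed_tendsto_set:
  fixes X :: "'b \<Rightarrow> ('a::real_normed_vector \<Rightarrow> 'c::real_normed_vector)"
  assumes lin: "\<And>n. linear (X n)" and bound: "\<And>n \<xi>. norm (X n \<xi>) \<le> C * norm \<xi>"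
    and y: "bounded_linear y"
  shows "closed {\<xi>. ((\<lambda>n. X n \<xi>) \<longlongrightarrow> y \<xi>) F}"
proof -
  obtain D where D: "\<And>\<xi>. norm (y \<xi>) \<le> norm \<xi> * D"
    using bounded_linear.bounded[OF y] by blast
  define K where "K = \<bar>C\<bar> + \<bar>D\<bar> + 1"
  have K: "K > 0"
    by (simp add: K_def)
  have diff: "norm (X n \<xi> - y \<xi>) \<le> K * norm \<xi>" for n \<xi>
  proof -
    have "norm (X n \<xi> - y \<xi>) \<le> C * norm \<xi> + norm \<xi> * D"
      using norm_triangle_ineq4[of "X n \<xi>" "y \<xi>"] bound[of n \<xi>] D[of \<xi>] by linarith
    also have "\<dots> = (C + D) * norm \<xi>"
      by (simp add: algebra_simps)
    also have "\<dots> \<le> K * norm \<xi>"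
      by (intro mult_right_mono) (auto simp: K_def)
    finally show ?thesis .
  qed
  have "\<xi> \<in> {\<xi>. ((\<lambda>n. X n \<xi>) \<longlongrightarrow> y \<xi>) F}"
    if "\<xi> \<in> closure {\<xi>. ((\<lambda>n. X n \<xi>) \<longlongrightarrow> y \<xi>) F}" for \<xi>
  proof (intro CollectI tendstoI)
    fix e :: real assume "e > 0"
    then have "e / (2 * K) > 0"
      using K by simp
    from closure_approachable[THEN iffD1, OF that, rule_format, OF this]
    obtain \<eta> where \<eta>: "((\<lambda>n. X n \<eta>) \<longlongrightarrow> y \<eta>) F" "dist \<eta> \<xi> < e / (2 * K)"
      by auto
    have "\<forall>\<^sub>F n in F. dist (X n \<eta>) (y \<eta>) < e / 2"
      using \<eta>(1) \<open>e > 0\<close> by (intro tendstoD) auto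
    then show "\<forall>\<^sub>F n in F. dist (X n \<xi>) (y \<xi>) < e"
    proof eventually_elim
      case (elim n)
      have eq: "X n \<xi> - y \<xi> = (X n (\<xi> - \<eta>) - y (\<xi> - \<eta>)) + (X n \<eta> - y \<eta>)"
        by (simp add: linear_diff[OF lin] linear_diff[OF bounded_linear.linear[OF y]])
      have "norm (X n \<xi> - y \<xi>) \<le> K * norm (\<xi> - \<eta>) + norm (X n \<eta> - y \<eta>)"
        unfolding eq
        using norm_triangle_ineq[of "X n (\<xi> - \<eta>) - y (\<xi> - \<eta>)" "X n \<eta> - y \<eta>"] diff[of n "\<xi> - \<eta>"]
        by linarith
      moreover have "K * norm (\<xi> - \<eta>) < K * (e / (2 * K))"
        using \<eta>(2) K by (intro mult_strict_left_mono) (auto simp: dist_norm norm_minus_commute)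
      ultimately show ?case
        using elim K by (simp add: dist_norm)
    qed
  qed
  then show ?thesis
    using closure_subset closure_subset_eq by blast
qed

lemma tendsto_on_dense:
  fixes X :: "'b \<Rightarrow> ('a::real_normed_vector \<Rightarrow> 'c::real_normed_vector)"
  assumes "\<And>n. linear (X n)" "\<And>n \<xi>. norm (X n \<xi>) \<le> C * norm \<xi>" "bounded_linear y"
    and dense: "closure D = UNIV" and conv: "\<And>\<xi>. \<xi> \<in> D \<Longrightarrow> ((\<lambda>n. X n \<xi>) \<longlongrightarrow> y \<xi>) F"
  shows "((\<lambda>n. X n \<xi>) \<longlongrightarrow> y \<xi>) F"
proof -
  have "closure D \<subseteq> {\<xi>. ((\<lambda>n. X n \<xi>) \<longlongrightarrow> y \<xi>) F}"
    by (intro closure_minimal closed_tendsto_set[OF assms(1-3)]) (use conv in auto)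
  then show ?thesis
    using dense by auto
qed

text \<open>A vector orthogonal to all \<open>\<zeta> - u \<zeta>\<close> is fixed by every
  \<open>adj u\<close>, hence by \<open>u\<close>. So the space splits into fixed vectors and the
  closed span of coboundaries. The form of the averages is left open: they will be powers of one
  unitary, and smeared translations.\<close>

lemma mean_ergodic:
  fixes X :: "'b \<Rightarrow> ('h::{complex_inner,banach} \<Rightarrow> 'h)" and \<U> :: "('h \<Rightarrow>\<^sub>L 'h) set"
  defines "Fixed \<equiv> {\<xi>. \<forall>u\<in>\<U>. blinfun_apply u \<xi> = \<xi>}"
  assumes \<U>: "\<And>u. u \<in> \<U> \<Longrightarrow> unitary_op u"
    and lin: "\<And>n. linear (X n)" and hom: "\<And>n c \<xi>. X n (c *\<^sub>C \<xi>) = c *\<^sub>C X n \<xi>"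
    and bound: "\<And>n \<xi>. norm (X n \<xi>) \<le> norm \<xi>"
    and fixed: "\<And>\<xi>. \<xi> \<in> Fixed \<Longrightarrow> ((\<lambda>n. X n \<xi>) \<longlongrightarrow> \<xi>) F"
    and cobound: "\<And>u \<xi>. u \<in> \<U> \<Longrightarrow> ((\<lambda>n. X n (\<xi> - u \<xi>)) \<longlongrightarrow> 0) F"
  shows "((\<lambda>n. X n \<xi>) \<longlongrightarrow> orth_proj Fixed \<xi>) F"
proof -
  have Fixed: "csubspace Fixed" "closed Fixed"
  proof -
    show "csubspace Fixed"
      using unitary_clinear[OF \<U>]
      by (auto simp: Fixed_def csubspace_def blinfun.add_right clinear_ops_def)
    show "closed Fixed"
      unfolding Fixed_def Ball_def by (intro closed_Collect_all closed_Collect_imp closed_Collect_eq continuous_intros) auto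
  qed
  define C where "C = closed_cspan {\<zeta> - blinfun_apply u \<zeta> | u \<zeta>. u \<in> \<U>}"
  have C: "csubspace C" "closed C"
    by (simp_all add: C_def csubspace_closed_cspan closed_closed_cspan)
  have "C \<subseteq> {\<xi>. ((\<lambda>n. X n \<xi>) \<longlongrightarrow> 0) F}"
    unfolding C_def
  proof (rule closed_cspan_minimal)
    show "csubspace {\<xi>. ((\<lambda>n. X n \<xi>) \<longlongrightarrow> 0) F}"
      unfolding csubspace_def
    proof (intro conjI ballI allI CollectI)
      show "((\<lambda>n. X n 0) \<longlongrightarrow> 0) F"
        by (simp add: linear_0[OF lin])
    next
      fix \<xi> \<eta> assume "\<xi> \<in> {\<xi>. ((\<lambda>n. X n \<xi>) \<longlongrightarrow> 0) F}" "\<eta> \<in> {\<xi>. ((\<lambda>n. X n \<xi>) \<longlongrightarrow> 0) F}"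
      then show "((\<lambda>n. X n (\<xi> + \<eta>)) \<longlongrightarrow> 0) F"
        using tendsto_add[of "\<lambda>n. X n \<xi>" 0 F "\<lambda>n. X n \<eta>" 0] by (simp add: linear_add[OF lin])
    next
      fix c \<xi> assume "\<xi> \<in> {\<xi>. ((\<lambda>n. X n \<xi>) \<longlongrightarrow> 0) F}"
      then show "((\<lambda>n. X n (c *\<^sub>C \<xi>)) \<longlongrightarrow> 0) F"
        using tendsto_scaleC[of "\<lambda>n. X n \<xi>" 0 F c] by (simp add: hom)
    qed
    show "closed {\<xi>. ((\<lambda>n. X n \<xi>) \<longlongrightarrow> 0) F}"
      using closed_tendsto_set[where C = 1 and X = X and F = F, OF lin _ bounded_linear_zero] bound
      by simp
  qed (use cobound in auto)
  moreover have "\<xi> - orth_proj Fixed \<xi> \<in> C"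
  proof (rule orth_dense[OF C])
    fix \<eta> assume \<eta>: "\<forall>\<zeta>\<in>C. cinner \<zeta> \<eta> = 0"
    have "u \<eta> = \<eta>" if u: "u \<in> \<U>" for u
    proof -
      have "adj u \<eta> = \<eta>"
      proof (rule cinner_ext)
        fix \<zeta>
        have "\<zeta> - u \<zeta> \<in> C"
          unfolding C_def using u by (intro subsetD[OF closed_cspan_superset]) blast
        then have "cinner (\<zeta> - u \<zeta>) \<eta> = 0"
          using \<eta> by blast
        then show "cinner \<zeta> (adj u \<eta>) = cinner \<zeta> \<eta>"
          by (simp add: cinner_adj_right[OF unitary_clinear[OF \<U>[OF u]]] cinner.diff_left)
      qed
      then show ?thesis
        by (metis \<U>[OF u] unitary_apply_adj)
    qed
    then have "\<eta> \<in> Fixed"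
      by (simp add: Fixed_def)
    then show "cinner \<eta> (\<xi> - orth_proj Fixed \<xi>) = 0"
      by (rule orth_proj_orth[OF Fixed])
  qed
  ultimately have "((\<lambda>n. X n (\<xi> - orth_proj Fixed \<xi>)) \<longlongrightarrow> 0) F"
    by blast
  from tendsto_add[OF this fixed[OF orth_proj_in[OF Fixed, of \<xi>]]]
  show ?thesis
    by (simp add: linear_diff[OF lin])
qed

section \<open>Smearing\<close>

text \<open>Substituting \<open>t = \<sigma> * (S + S powr \<epsilon> * s)\<close> moves the scaling
  into the argument of \<open>g\<close>: the Jacobian cancels the prefactor, and evenness of
  \<open>h\<close> removes the sign.\<close>

lemma scaled_profile_integral:
  fixes g :: "real \<Rightarrow> 'a::{banach,second_countable_topology}"
  assumes "wave_profile h" "S > 0" and \<sigma>: "\<sigma> = 1 \<or> \<sigma> = - 1"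
  shows "(LINT t|lborel. scaled_profile h \<epsilon> (\<sigma> * S) t *\<^sub>R g t)
    = (LINT s|lborel. h s *\<^sub>R g (\<sigma> * (S + S powr \<epsilon> * s)))"
proof -
  define c where "c = \<sigma> * S powr \<epsilon>"
  have c: "c \<noteq> 0" "\<bar>c\<bar> = S powr \<epsilon>" "S powr (- \<epsilon>) * S powr \<epsilon> = 1"
    using assms by (auto simp: c_def powr_minus)
  have even: "h (- s) = h s" for s
    using assms by (simp add: wave_profile_def)
  have abs: "\<bar>\<sigma> * S\<bar> = S"
    using assms by auto
  have arg: "scaled_profile h \<epsilon> (\<sigma> * S) (\<sigma> * S + c * s) = S powr (- \<epsilon>) * h s" for s
  proof -
    have "S powr (- \<epsilon>) * (\<sigma> * S + c * s - \<sigma> * S) = (S powr (- \<epsilon>) * S powr \<epsilon>) * (\<sigma> * s)"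
      by (simp add: c_def algebra_simps)
    also have "\<dots> = \<sigma> * s"
      unfolding c(3) by simp
    finally have "scaled_profile h \<epsilon> (\<sigma> * S) (\<sigma> * S + c * s) = S powr (- \<epsilon>) * h (\<sigma> * s)"
      unfolding scaled_profile_def abs by (simp only:)
    then show ?thesis
      using \<sigma> even by auto
  qed
  have "(LINT t|lborel. scaled_profile h \<epsilon> (\<sigma> * S) t *\<^sub>R g t)
      = \<bar>c\<bar> *\<^sub>R (LINT s|lborel. scaled_profile h \<epsilon> (\<sigma> * S) (\<sigma> * S + c * s) *\<^sub>R g (\<sigma> * S + c * s))"
    by (rule lborel_integral_real_affine[OF c(1)])
  also have "\<dots> = (LINT s|lborel. \<bar>c\<bar> *\<^sub>R (S powr (- \<epsilon>) * h s) *\<^sub>R g (\<sigma> * S + c * s))"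
    unfolding arg by (rule integral_scaleR_right[symmetric])
  also have "\<dots> = (LINT s|lborel. h s *\<^sub>R g (\<sigma> * (S + S powr \<epsilon> * s)))"
  proof (rule Bochner_Integration.integral_cong[OF refl])
    fix s
    have "\<bar>c\<bar> * (S powr (- \<epsilon>) * h s) = h s"
      using c(3) by (simp add: c(2) mult.commute)
    moreover have "\<sigma> * S + c * s = \<sigma> * (S + S powr \<epsilon> * s)"
      by (simp add: c_def algebra_simps)
    ultimately show "\<bar>c\<bar> *\<^sub>R (S powr (- \<epsilon>) * h s) *\<^sub>R g (\<sigma> * S + c * s)
        = h s *\<^sub>R g (\<sigma> * (S + S powr \<epsilon> * s))"
      by simp
  qed
  finally show ?thesis .
qed

lemma
  assumes "wave_profile h"
  shows profile_continuous: "continuous_on UNIV h"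
    and profile_integrable: "integrable lborel h"
    and profile_integral: "(LINT s|lborel. h s) = 1"
    and profile_nonneg: "h s \<ge> 0"
proof -
  have "h differentiable at t" for t
    using assms unfolding wave_profile_def by (metis funpow_0)
  then show "continuous_on UNIV h"
    by (simp add: continuous_at_imp_continuous_on differentiable_imp_continuous_within)
  show "integrable lborel h" "(LINT s|lborel. h s) = 1" "h s \<ge> 0"
    using assms by (auto simp: wave_profile_def has_bochner_integral_iff)
qed

lemma profile_integrable_scaleR:
  fixes g :: "real \<Rightarrow> 'a::{banach,second_countable_topology}"
  assumes h: "wave_profile h" and g: "continuous_on UNIV g" "\<And>s. norm (g s) \<le> C"
  shows "integrable lborel (\<lambda>s. h s *\<^sub>R g s)"
    and "norm (LINT s|lborel. h s *\<^sub>R g s) \<le> C"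
proof -
  show int: "integrable lborel (\<lambda>s. h s *\<^sub>R g s)"
  proof (rule Bochner_Integration.integrable_bound)
    show "integrable lborel (\<lambda>s. C * h s)"
      using profile_integrable[OF h] by simp
    have "continuous_on UNIV (\<lambda>s. h s *\<^sub>R g s)"
      by (intro continuous_intros profile_continuous[OF h] g)
    then show "(\<lambda>s. h s *\<^sub>R g s) \<in> borel_measurable lborel"
      using borel_measurable_continuous_onI by simp
    show "AE s in lborel. norm (h s *\<^sub>R g s) \<le> norm (C * h s)"
    proof (rule AE_I2)
      fix s
      have "norm (g s) \<le> \<bar>C\<bar>"
        using g(2)[of s] by linarith
      then show "norm (h s *\<^sub>R g s) \<le> norm (C * h s)"
        by (simp add: abs_mult mult.commute[of "\<bar>C\<bar>"] mult_left_mono)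
    qed
  qed
  have "norm (LINT s|lborel. h s *\<^sub>R g s) \<le> (LINT s|lborel. norm (h s *\<^sub>R g s))"
    by (rule integral_norm_bound)
  also have "\<dots> \<le> (LINT s|lborel. C * h s)"
  proof (rule integral_mono)
    show "norm (h s *\<^sub>R g s) \<le> C * h s" for s
      using mult_left_mono[OF g(2)[of s] profile_nonneg[OF h, of s]] profile_nonneg[OF h, of s]
      by (simp add: mult.commute)
  qed (use integrable_norm[OF int] profile_integrable[OF h] in auto)
  also have "\<dots> = C"
    by (simp add: profile_integral[OF h])
  finally show "norm (LINT s|lborel. h s *\<^sub>R g s) \<le> C" .
qed

text \<open>By Scheffe's argument \<open>\<bar>a - b\<bar> = 2 (a - b)\<^sup>+ - (a - b)\<close>, and the positive part is dominated.\<close>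

lemma profile_translation_continuous:
  assumes h: "wave_profile h" and \<delta>: "(\<delta> \<longlongrightarrow> 0) (at_top :: real filter)"
  shows "((\<lambda>S. LINT s|lborel. \<bar>h s - h (s - \<delta> S)\<bar>) \<longlongrightarrow> 0) at_top"
proof -
  have meas: "(\<lambda>s. h (s - d)) \<in> borel_measurable lborel" for d
    by (simp, intro borel_measurable_continuous_onI
        continuous_on_compose2[OF profile_continuous[OF h]] continuous_intros) auto
  have meas0: "h \<in> borel_measurable lborel"
    using meas[of 0] by simp
  have int: "integrable lborel (\<lambda>s. h (s - d))" "(LINT s|lborel. h (s - d)) = 1" for d
    using lborel_integrable_real_affine[OF profile_integrable[OF h], of 1 "- d"]
      lborel_integral_real_affine[of 1 h "- d"] profile_integral[OF h] by simp_all
  note int0 = int[of 0, simplified]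
  have int_max: "integrable lborel (\<lambda>s. max 0 (h s - h (s - d)))" for d
    using int0(1) int(1)[of d] by (intro integrable_max) auto
  have "((\<lambda>S. LINT s|lborel. max 0 (h s - h (s - \<delta> S))) \<longlongrightarrow> (LINT s::real|lborel. 0::real)) at_top"
  proof (rule integral_dominated_convergence_at_top[where s = "\<lambda>S s. max 0 (h s - h (s - \<delta> S))"
        and f = "\<lambda>_. 0" and w = h])
    show "AE s in lborel. ((\<lambda>S. max 0 (h s - h (s - \<delta> S))) \<longlongrightarrow> 0) at_top"
    proof (rule AE_I2)
      fix s
      have "((\<lambda>S. s - \<delta> S) \<longlongrightarrow> s - 0) at_top"
        by (intro tendsto_intros \<delta>)
      then have "((\<lambda>S. h (s - \<delta> S)) \<longlongrightarrow> h s) at_top"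
        using continuous_on_tendsto_compose[OF profile_continuous[OF h], of "\<lambda>S. s - \<delta> S" s] by simp
      then have "((\<lambda>S. max 0 (h s - h (s - \<delta> S))) \<longlongrightarrow> max 0 (h s - h s)) at_top"
        by (intro tendsto_intros)
      then show "((\<lambda>S. max 0 (h s - h (s - \<delta> S))) \<longlongrightarrow> 0) at_top"
        by simp
    qed
    show "\<forall>\<^sub>F S in at_top. AE s in lborel. norm (max 0 (h s - h (s - \<delta> S))) \<le> h s"
      using profile_nonneg[OF h] by (auto intro!: always_eventually AE_I2)
  qed (use meas meas0 int0 in auto)
  then have lim: "((\<lambda>S. 2 * (LINT s|lborel. max 0 (h s - h (s - \<delta> S)))) \<longlongrightarrow> 2 * 0) at_top"
    by (intro tendsto_intros) simp
  have "(LINT s|lborel. \<bar>h s - h (s - d)\<bar>) = 2 * (LINT s|lborel. max 0 (h s - h (s - d)))" for d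
  proof -
    have "\<bar>h s - h (s - d)\<bar> = 2 * max 0 (h s - h (s - d)) - (h s - h (s - d))" for s
      by (simp add: max_def abs_if)
    then have "(LINT s|lborel. \<bar>h s - h (s - d)\<bar>)
        = (LINT s|lborel. 2 * max 0 (h s - h (s - d)) - (h s - h (s - d)))"
      by simp
    also have "\<dots> = 2 * (LINT s|lborel. max 0 (h s - h (s - d)))"
      using int[of d] int0 int_max[of d] by simp
    finally show ?thesis .
  qed
  then show ?thesis
    using lim by simp
qed

text \<open>Since \<open>\<epsilon> < 1\<close>, the width of the time window is negligible against
  its centre, so each fixed point \<open>s\<close> of the profile ends up at arbitrarily late
  times.\<close>

lemma filterlim_add_powr_mult_at_top:
  assumes "\<epsilon> < 1"
  shows "filterlim (\<lambda>S. S + S powr \<epsilon> * s) at_top (at_top :: real filter)"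
proof -
  have "((\<lambda>S. 1 + S powr (\<epsilon> - 1) * s) \<longlongrightarrow> 1 + 0 * s) at_top"
    by (intro tendsto_intros tendsto_neg_powr filterlim_ident) (use assms in auto)
  then have A: "filterlim (\<lambda>S. (1 + S powr (\<epsilon> - 1) * s) * S) at_top (at_top :: real filter)"
    by (intro filterlim_tendsto_pos_mult_at_top[of _ 1] filterlim_ident) auto
  have ev: "\<forall>\<^sub>F S in at_top. (1 + S powr (\<epsilon> - 1) * s) * S = S + S powr \<epsilon> * s"
    using eventually_gt_at_top[of 0]
  proof eventually_elim
    case (elim S)
    have "S powr (\<epsilon> - 1) * S = S powr \<epsilon>"
      using elim powr_add[of S "\<epsilon> - 1" 1] by simp
    then show ?case
      by (simp add: algebra_simps)
  qed
  show ?thesis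
    using A unfolding filterlim_cong[OF refl refl ev] .
qed

section \<open>One chirality of the net\<close>

lemma
  assumes "bounded_interval I"
  shows bounded_interval_open: "open I" and bounded_interval_bounded: "bounded I"
  using assms by (auto simp: bounded_interval_def)

lemma bounded_interval_greater:
  assumes "bounded I"
  obtains I' where "bounded_interval I'" "\<forall>a\<in>I. \<forall>b\<in>I'. a < b"
proof -
  obtain m where m: "\<And>x. x \<in> I \<Longrightarrow> \<bar>x\<bar> \<le> m"
    using assms by (auto simp: bounded_iff)
  show ?thesis
  proof (rule that[of "{m<..<m + 1}"])
    show "bounded_interval {m<..<m + 1}"
      unfolding bounded_interval_def by (intro exI[of _ m] exI[of _ "m + 1"]) simp
    show "\<forall>a\<in>I. \<forall>b\<in>{m<..<m + 1}. a < b"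
      using m by force
  qed
qed

lemma bounded_interval_less:
  assumes "bounded I"
  obtains I' where "bounded_interval I'" "\<forall>a\<in>I. \<forall>b\<in>I'. b < a"
proof -
  obtain m where m: "\<And>x. x \<in> I \<Longrightarrow> \<bar>x\<bar> \<le> m"
    using assms by (auto simp: bounded_iff)
  show ?thesis
  proof (rule that[of "{- m - 1<..<- m}"])
    show "bounded_interval {- m - 1<..<- m}"
      unfolding bounded_interval_def by (intro exI[of _ "- m - 1"] exI[of _ "- m"]) simp
    show "\<forall>a\<in>I. \<forall>b\<in>{- m - 1<..<- m}. b < a"
      using m by force
  qed
qed

lemma bounded_interval_shift: "bounded_interval J \<Longrightarrow> bounded_interval ((+) b ` J)"
proof -
  assume "bounded_interval J"
  then obtain c d where cd: "c < d" "J = {c<..<d}"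
    by (auto simp: bounded_interval_def)
  have "y \<in> (+) b ` {c<..<d}" if "y \<in> {b + c<..<b + d}" for y
    using that by (intro image_eqI[of _ _ "y - b"]) auto
  then have "(+) b ` J = {b + c<..<b + d}"
    using cd by auto
  then show ?thesis
    unfolding bounded_interval_def using cd by (intro exI[of _ "b + c"] exI[of _ "b + d"]) simp
qed

lemma mobius_act_affine: "mobius_act (affine_lift \<alpha> \<beta>) v = \<alpha> * v + \<beta>"
  using affine_lift_cell[OF arctan_lbound arctan_ubound, of \<alpha> \<beta> v 0]
  by (simp add: mobius_act_def tan_arctan)

lemma mobius_act_affine_interval:
  assumes "\<alpha> > 0"
  shows "mobius_act (affine_lift \<alpha> \<beta>) ` {c<..<d} = {\<alpha> * c + \<beta><..<\<alpha> * d + \<beta>}"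
proof -
  have "y \<in> mobius_act (affine_lift \<alpha> \<beta>) ` {c<..<d}" if "y \<in> {\<alpha> * c + \<beta><..<\<alpha> * d + \<beta>}" for y
    using that assms
    by (intro image_eqI[of _ _ "(y - \<beta>) / \<alpha>"]) (auto simp: mobius_act_affine field_simps)
  then show ?thesis
    using assms by (auto simp: mobius_act_affine)
qed

text \<open>The bound on \<open>arctan d + \<phi>\<close> keeps the rotated interval away from
  infinity, so that \<open>tan\<close> is monotone on it.\<close>

lemma mobius_act_rot_interval:
  assumes "c < d" "0 \<le> \<phi>" "arctan d + \<phi> < pi / 2"
  shows "mobius_act (rot \<phi>) ` {c<..<d} = {tan (arctan c + \<phi>)<..<tan (arctan d + \<phi>)}"
proof (intro equalityI subsetI)
  fix y assume "y \<in> mobius_act (rot \<phi>) ` {c<..<d}"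
  then obtain v where v: "c < v" "v < d" "y = tan (arctan v + \<phi>)"
    by (auto simp: mobius_act_def rot_def)
  have "arctan c < arctan v" "arctan v < arctan d"
    using v by (auto simp: arctan_less_iff)
  then show "y \<in> {tan (arctan c + \<phi>)<..<tan (arctan d + \<phi>)}"
    unfolding v(3) using assms arctan_lbound[of c] by (auto intro!: tan_monotone)
next
  fix y assume y: "y \<in> {tan (arctan c + \<phi>)<..<tan (arctan d + \<phi>)}"
  have "arctan c < arctan d"
    using assms by (simp add: arctan_less_iff)
  then have "arctan (tan (arctan c + \<phi>)) = arctan c + \<phi>" "arctan (tan (arctan d + \<phi>)) = arctan d + \<phi>"
    using assms arctan_lbound[of c] by (auto intro!: arctan_tan)
  moreover have "arctan (tan (arctan c + \<phi>)) < arctan y" "arctan y < arctan (tan (arctan d + \<phi>))"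
    using y by (auto simp: arctan_less_iff)
  ultimately have b: "arctan c < arctan y - \<phi>" "arctan y - \<phi> < arctan d"
    by linarith+
  define v where "v = tan (arctan y - \<phi>)"
  have v: "arctan v = arctan y - \<phi>"
    unfolding v_def using b arctan_lbound[of c] arctan_ubound[of d] by (intro arctan_tan) linarith+
  then have "c < v" "v < d"
    using b by (metis arctan_less_iff)+
  moreover have "y = mobius_act (rot \<phi>) v"
    by (simp add: mobius_act_def rot_def v tan_arctan)
  ultimately show "y \<in> mobius_act (rot \<phi>) ` {c<..<d}"
    by auto
qed

text \<open>What one light-cone factor sees: \<open>W\<close> moves the second interval and leaves
  the first alone. \<open>B_trans\<close> holds for every \<open>b\<close>, \<open>B_local\<close>
  only near the identity, with a neighbourhood depending on the intervals. The order relations in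
  \<open>B_comm\<close> describe one of the two spacelike positions of double cones.\<close>

locale half_net = mobius_rep W
  for W :: "(real \<Rightarrow> real) \<Rightarrow> ('h::separable_hilbert \<Rightarrow>\<^sub>L 'h)" +
  fixes B :: "real set \<Rightarrow> real set \<Rightarrow> ('h \<Rightarrow>\<^sub>L 'h) set" and \<Omega> :: 'h
  assumes B_vN: "bounded_interval I \<Longrightarrow> bounded_interval J \<Longrightarrow> von_neumann_algebra (B I J)"
    and B_mono: "\<lbrakk>bounded_interval I; bounded_interval J; bounded_interval I'; bounded_interval J';
      I \<subseteq> I'; J \<subseteq> J'\<rbrakk> \<Longrightarrow> B I J \<subseteq> B I' J'"
    and B_comm: "\<lbrakk>bounded_interval I; bounded_interval J; bounded_interval I'; bounded_interval J';
      \<forall>a\<in>I. \<forall>b\<in>I'. a < b; \<forall>a\<in>J. \<forall>b\<in>J'. b < a; x \<in> B I J; y \<in> B I' J'\<rbrakk> \<Longrightarrow> x o\<^sub>L y = y o\<^sub>L x"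
    and B_trans: "\<lbrakk>bounded_interval I; bounded_interval J\<rbrakk>
      \<Longrightarrow> conj_by (W (affine_lift 1 b)) ` B I J = B I ((+) b ` J)"
    and B_local: "\<lbrakk>bounded_interval I; bounded_interval J\<rbrakk>
      \<Longrightarrow> \<exists>N. openin (top_of_set mobius_cover) N \<and> id \<in> N \<and>
            (\<forall>g\<in>N. conj_by (W g) ` B I J = B I (mobius_act g ` J))"
    and B_cyclic: "\<lbrakk>bounded_interval I; bounded_interval J\<rbrakk>
      \<Longrightarrow> closure ((\<lambda>x. blinfun_apply x \<Omega>) ` B I J) = UNIV"
    and vacuum_fixed: "\<Omega> \<in> W_fixed"
begin

abbreviation "\<tau> b \<equiv> W (affine_lift 1 b)"

definition chir :: "real set \<Rightarrow> real set \<Rightarrow> ('h \<Rightarrow>\<^sub>L 'h) set" where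
  "chir I J = B I J \<inter> commutant (W ` mobius_cover)"

lemma translation_cover: "affine_lift 1 b \<in> mobius_cover"
  by (rule affine_lift_cover) simp

lemma \<tau>_unitary: "unitary_op (\<tau> b)"
  by (rule unitary[OF translation_cover])

lemma \<tau>_add: "\<tau> (a + b) = \<tau> a o\<^sub>L \<tau> b"
  using mult[OF translation_cover translation_cover, of a b] by (simp add: affine_lift_comp add.commute)

lemma adj_\<tau>: "adj (\<tau> b) = \<tau> (- b)"
  by (rule adj_W[OF translation_cover translation_cover]) (simp add: affine_lift_comp affine_lift_id)

lemma W_vacuum: "g \<in> mobius_cover \<Longrightarrow> W g \<Omega> = \<Omega>"
  by (rule fixed_all[OF vacuum_fixed])

lemma adj_W_vacuum: "g \<in> mobius_cover \<Longrightarrow> adj (W g) \<Omega> = \<Omega>"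
  by (rule unitary_fixed_adj[OF unitary W_vacuum])

lemma separating:
  assumes I: "bounded_interval I" and J: "bounded_interval J" "bounded_interval J'"
    and x: "x \<in> B I J" and y: "y \<in> B I J'" and eq: "x \<Omega> = y \<Omega>"
  shows "x = y"
proof -
  obtain I1 where I1: "bounded_interval I1" "\<forall>a\<in>I. \<forall>b\<in>I1. a < b"
    by (rule bounded_interval_greater[OF bounded_interval_bounded[OF I]])
  obtain J1 where J1: "bounded_interval J1" "\<forall>a\<in>J \<union> J'. \<forall>b\<in>J1. b < a"
    by (rule bounded_interval_less[of "J \<union> J'"])
      (simp add: bounded_interval_bounded[OF J(1)] bounded_interval_bounded[OF J(2)])
  show ?thesis
  proof (rule blinfun_eq_on_dense[OF B_cyclic[OF I1(1) J1(1)]])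
    fix \<xi> assume "\<xi> \<in> (\<lambda>x. blinfun_apply x \<Omega>) ` B I1 J1"
    then obtain z where z: "z \<in> B I1 J1" "\<xi> = z \<Omega>"
      by blast
    have "x o\<^sub>L z = z o\<^sub>L x"
      by (rule B_comm[OF I J(1) I1(1) J1(1) I1(2) _ x z(1)]) (use J1 in auto)
    moreover have "y o\<^sub>L z = z o\<^sub>L y"
      by (rule B_comm[OF I J(2) I1(1) J1(1) I1(2) _ y z(1)]) (use J1 in auto)
    ultimately show "x \<xi> = y \<xi>"
      unfolding z(2) using eq by (metis blinfun_apply_blinfun_compose)
  qed
qed

lemma rot_in_nbhd:
  assumes "openin (top_of_set mobius_cover) N" "id \<in> N"
  obtains \<delta> where "\<delta> > 0" "\<And>\<phi>. 0 < \<phi> \<Longrightarrow> \<phi> < \<delta> \<Longrightarrow> rot \<phi> \<in> N"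
proof -
  obtain N' where N': "open N'" "N = mobius_cover \<inter> N'"
    using assms(1) by (auto simp: openin_open)
  have "\<forall>\<^sub>F \<phi> in at_right 0. rot \<phi> \<in> N'"
  proof (rule topological_tendstoD[OF _ N'(1)])
    have "(rot \<longlongrightarrow> rot 0) (at 0)"
      using continuous_rot by (simp add: continuous_on_def)
    then show "(rot \<longlongrightarrow> rot 0) (at_right 0)"
      by (rule tendsto_within_subset) auto
    show "rot 0 \<in> N'"
      using assms(2) N'(2) by (simp add: rot_0)
  qed
  then obtain \<delta> where "\<delta> > 0" "\<And>\<phi>. 0 < \<phi> \<Longrightarrow> \<phi> < \<delta> \<Longrightarrow> rot \<phi> \<in> N'"
    by (auto simp: eventually_at_right_field)
  then show ?thesis
    using that N'(2) rot_cover by blast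
qed

text \<open>The affine map contracts towards \<open>m\<close> and tends to the identity as
  \<open>\<alpha>\<close> tends to 1 from below.\<close>

lemma dilation_in_nbhd:
  assumes "openin (top_of_set mobius_cover) N" "id \<in> N"
  obtains \<alpha> where "0 < \<alpha>" "\<alpha> < 1" "affine_lift \<alpha> ((1 - \<alpha>) * m) \<in> N"
proof -
  obtain N' where N': "open N'" "N = mobius_cover \<inter> N'"
    using assms(1) by (auto simp: openin_open)
  let ?f = "\<lambda>\<alpha>. affine_lift \<alpha> ((1 - \<alpha>) * m)"
  have "continuous_on {0<..} ?f"
    by (intro continuous_affine_lift continuous_intros)
  then have "isCont ?f 1"
    by (rule continuous_on_interior) (simp add: interior_open)
  then have "(?f \<longlongrightarrow> ?f 1) (at_left 1)"
    by (auto simp: isCont_def intro: tendsto_within_subset)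
  then have "\<forall>\<^sub>F \<alpha> in at_left 1. ?f \<alpha> \<in> N'"
    by (rule topological_tendstoD[OF _ N'(1)]) (use assms N' in \<open>auto simp: affine_lift_id\<close>)
  moreover have "\<forall>\<^sub>F \<alpha> in at_left 1. 0 < \<alpha> \<and> \<alpha> < (1::real)"
    using eventually_at_left_real[of 0 1] by simp
  ultimately have "\<forall>\<^sub>F \<alpha> in at_left 1. 0 < \<alpha> \<and> \<alpha> < 1 \<and> ?f \<alpha> \<in> N'"
    by eventually_elim simp
  then obtain \<alpha> where "0 < \<alpha>" "\<alpha> < 1" "?f \<alpha> \<in> N'"
    using eventually_happens'[OF trivial_limit_at_left_real] by blast
  then show ?thesis
    using that N'(2) affine_lift_cover by blast
qed

text \<open>The transform of \<open>y\<close> under \<open>W g\<close> creates the same vector from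
  the vacuum, so it equals \<open>y\<close> once it is known to be localized over the same
  \<open>I\<close>. That is known for translations and short rotations, and
  \<open>commute_all\<close> does the rest.\<close>

lemma invariant_if_vector_invariant:
  assumes I: "bounded_interval I" and J: "bounded_interval J"
    and y: "y \<in> B I J" and y\<Omega>: "y \<Omega> \<in> W_fixed"
  shows "y \<in> chir I J"
proof -
  have conj_eq: "W g o\<^sub>L y = y o\<^sub>L W g"
    if g: "g \<in> mobius_cover" and J': "bounded_interval J'" and m: "conj_by (W g) y \<in> B I J'" for g J'
  proof -
    have "conj_by (W g) y \<Omega> = y \<Omega>"
      by (simp add: conj_by_apply adj_W_vacuum[OF g] fixed_all[OF y\<Omega> g])
    then have "conj_by (W g) y = y"
      by (rule separating[OF I J' J m y])
    then show ?thesis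
      using conj_by_fixed_iff[OF unitary[OF g]] by blast
  qed
  obtain c d where cd: "c < d" "J = {c<..<d}"
    using J by (auto simp: bounded_interval_def)
  obtain N where N: "openin (top_of_set mobius_cover) N" "id \<in> N"
      "\<And>g. g \<in> N \<Longrightarrow> conj_by (W g) ` B I J = B I (mobius_act g ` J)"
    using B_local[OF I J] by blast
  obtain \<delta> where \<delta>: "\<delta> > 0" "\<And>\<phi>. 0 < \<phi> \<Longrightarrow> \<phi> < \<delta> \<Longrightarrow> rot \<phi> \<in> N"
    using rot_in_nbhd[OF N(1,2)] by blast
  have "W g o\<^sub>L y = y o\<^sub>L W g" if "g \<in> mobius_cover" for g
  \<comment> \<open>The second bound keeps the rotated image of \<open>J\<close> a bounded
    interval.\<close>
  proof (rule commute_all[where \<delta> = "min \<delta> (pi / 2 - arctan d)", OF _ _ _ that])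
    show "\<tau> b o\<^sub>L y = y o\<^sub>L \<tau> b" for b
      by (rule conj_eq[OF translation_cover bounded_interval_shift[OF J, of b]])
         (use B_trans[OF I J] y in blast)
    show "0 < min \<delta> (pi / 2 - arctan d)"
      using \<delta>(1) arctan_ubound[of d] by simp
    fix \<phi> assume \<phi>: "0 < \<phi>" "\<phi> < min \<delta> (pi / 2 - arctan d)"
    let ?J = "{tan (arctan c + \<phi>)<..<tan (arctan d + \<phi>)}"
    have "arctan c < arctan d"
      using cd by (simp add: arctan_less_iff)
    then have "tan (arctan c + \<phi>) < tan (arctan d + \<phi>)"
      using \<phi> arctan_lbound[of c] by (intro tan_monotone) auto
    then have J': "bounded_interval ?J"
      by (auto simp: bounded_interval_def)
    show "W (rot \<phi>) o\<^sub>L y = y o\<^sub>L W (rot \<phi>)"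
    proof (rule conj_eq[OF rot_cover J'])
      have "conj_by (W (rot \<phi>)) ` B I J = B I ?J"
        using N(3)[OF \<delta>(2)[OF \<phi>(1)]] \<phi> cd mobius_act_rot_interval[of c d \<phi>] by simp
      then show "conj_by (W (rot \<phi>)) y \<in> B I ?J"
        using y by blast
    qed
  qed
  moreover have "y \<in> clinear_ops"
    using y vN_clinear[OF B_vN[OF I J]] by blast
  ultimately show ?thesis
    using y by (auto simp: chir_def commutant_def)
qed

text \<open>The averages of \<open>x\<close> over the powers of a contraction about the centre of \<open>J\<close> stay in the
  algebra of \<open>I \<times> J\<close>, and on the dense set of vectors created from the vacuum in the spacelike
  complement they converge by the mean ergodic theorem.\<close>

lemma chiral_projection:
  assumes I: "bounded_interval I" and J: "bounded_interval J" and x: "x \<in> B I J"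
  obtains y where "y \<in> chir I J" "y \<Omega> = orth_proj W_fixed (x \<Omega>)"
proof -
  obtain c d where cd: "c < d" "J = {c<..<d}"
    using J by (auto simp: bounded_interval_def)
  obtain N where N: "openin (top_of_set mobius_cover) N" "id \<in> N"
      "\<And>g. g \<in> N \<Longrightarrow> conj_by (W g) ` B I J = B I (mobius_act g ` J)"
    using B_local[OF I J] by blast
  define m where "m = (c + d) / 2"
  obtain \<alpha> where \<alpha>: "0 < \<alpha>" "\<alpha> < 1" "affine_lift \<alpha> ((1 - \<alpha>) * m) \<in> N"
    using dilation_in_nbhd[OF N(1,2)] .
  define g where "g = affine_lift \<alpha> ((1 - \<alpha>) * m)"
  have g: "g \<in> mobius_cover"
    unfolding g_def by (rule affine_lift_cover[OF \<alpha>(1)])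
  define u where "u = W g"
  have u: "unitary_op u"
    unfolding u_def by (rule unitary[OF g])
  note M = B_vN[OF I J]
  have inv: "conj_by u z \<in> B I J" if "z \<in> B I J" for z
  proof -
    define J' where "J' = {\<alpha> * c + (1 - \<alpha>) * m<..<\<alpha> * d + (1 - \<alpha>) * m}"
    have J': "bounded_interval J'"
      unfolding J'_def bounded_interval_def using \<alpha> cd
      by (intro exI[of _ "\<alpha> * c + (1 - \<alpha>) * m"] exI[of _ "\<alpha> * d + (1 - \<alpha>) * m"]) simp
    have "\<alpha> * c + (1 - \<alpha>) * c \<le> \<alpha> * c + (1 - \<alpha>) * m" "\<alpha> * d + (1 - \<alpha>) * m \<le> \<alpha> * d + (1 - \<alpha>) * d"
      using \<alpha> cd by (auto intro!: mult_left_mono simp: m_def)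
    then have "J' \<subseteq> J"
      unfolding J'_def cd by (auto simp: algebra_simps)
    have "conj_by u ` B I J = B I J'"
      using N(3)[OF \<alpha>(3)] mobius_act_affine_interval[OF \<alpha>(1)] by (simp add: u_def g_def J'_def cd)
    then show ?thesis
      using that B_mono[OF I J' I J _ \<open>J' \<subseteq> J\<close>] by blast
  qed
  define Y where "Y k = (conj_by u ^^ k) x" for k
  have Y_Suc: "Y (Suc k) = conj_by u (Y k)" for k
    by (simp add: Y_def)
  have Y_in: "Y k \<in> B I J" for k
    by (induction k) (auto simp: Y_Suc inv, simp add: Y_def x)
  have Y_norm: "norm (Y k) \<le> norm x" for k
  proof (induction k)
    case (Suc k)
    then show ?case
      using norm_conj_by_le[OF u, of "Y k"] by (simp add: Y_Suc)
  qed (simp add: Y_def)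
  have Y_\<Omega>: "Y k \<Omega> = (blinfun_apply u ^^ k) (x \<Omega>)" for k
  proof (induction k)
    case (Suc k)
    have "adj u \<Omega> = \<Omega>"
      unfolding u_def by (rule adj_W_vacuum[OF g])
    then show ?case
      by (simp add: Y_Suc conj_by_apply Suc)
  qed (simp add: Y_def)
  \<comment> \<open>\<open>avg\<close> averages vectors and \<open>Z\<close> below averages
    operators; since \<open>adj u\<close> fixes \<open>\<Omega>\<close>, \<open>Z n \<Omega>\<close>
    is \<open>avg n (x \<Omega>)\<close>.\<close>
  define avg where "avg n \<xi> = inverse (real (Suc n)) *\<^sub>R (\<Sum>k<Suc n. (blinfun_apply u ^^ k) \<xi>)" for n \<xi>
  have uk_lin: "linear (blinfun_apply u ^^ k)" for k
  proof (induction k)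
    case (Suc k)
    then show ?case
      using linear_compose[OF Suc bounded_linear.linear[OF blinfun.bounded_linear_right[of u]]]
      by (simp add: comp_def)
  qed (simp add: linear_id[unfolded id_def] id_def)
  have uk_norm: "norm ((blinfun_apply u ^^ k) \<xi>) = norm \<xi>" for k \<xi>
    by (induction k) (auto simp: unitary_norm[OF u])
  have uk_hom: "(blinfun_apply u ^^ k) (c *\<^sub>C \<xi>) = c *\<^sub>C (blinfun_apply u ^^ k) \<xi>" for k c \<xi>
    using unitary_clinear[OF u] by (induction k) (auto simp: clinear_ops_def)
  have scaleC_sum: "c *\<^sub>C (\<Sum>k<n. f k) = (\<Sum>k<n. c *\<^sub>C f k)" for c n and f :: "nat \<Rightarrow> 'h"
    by (induction n) (auto simp: scaleC_add_right)
  have lim: "(\<lambda>n. avg n \<xi>) \<longlonglongrightarrow> orth_proj {\<xi>. \<forall>v\<in>{u}. blinfun_apply v \<xi> = \<xi>} \<xi>" for \<xi>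
  proof (rule mean_ergodic)
    show "linear (avg n)" for n
      unfolding avg_def
      by (rule linearI) (simp_all add: linear_add[OF uk_lin] linear_scale[OF uk_lin]
          sum.distrib scaleR_add_right scaleR_sum_right[symmetric] mult.commute)
    show "avg n (c *\<^sub>C \<xi>) = c *\<^sub>C avg n \<xi>" for n c \<xi>
      unfolding avg_def uk_hom scaleC_sum[symmetric] by (simp add: scaleR_scaleC scaleC_scaleC mult.commute)
    show "norm (avg n \<xi>) \<le> norm \<xi>" for n \<xi>
    proof -
      have "norm (\<Sum>k<Suc n. (blinfun_apply u ^^ k) \<xi>) \<le> (\<Sum>k<Suc n. norm ((blinfun_apply u ^^ k) \<xi>))"
        by (rule norm_sum)
      also have "\<dots> = real (Suc n) * norm \<xi>"
        by (simp add: uk_norm)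
      finally show ?thesis
        unfolding avg_def norm_scaleR by (simp add: field_simps del: sum.lessThan_Suc of_nat_Suc)
    qed
    show "(\<lambda>n. avg n \<xi>) \<longlonglongrightarrow> \<xi>" if "\<xi> \<in> {\<xi>. \<forall>v\<in>{u}. blinfun_apply v \<xi> = \<xi>}" for \<xi>
    proof -
      have "(blinfun_apply u ^^ k) \<xi> = \<xi>" for k
        using that by (induction k) auto
      then have "avg n \<xi> = \<xi>" for n
        by (simp add: avg_def sum_constant_scaleR del: sum.lessThan_Suc of_nat_Suc)
      then show ?thesis
        by simp
    qed
    show "(\<lambda>n. avg n (\<xi> - blinfun_apply v \<xi>)) \<longlonglongrightarrow> 0" if "v \<in> {u}" for v \<xi>
    proof -
      have "(\<Sum>k<n. (blinfun_apply u ^^ k) (\<xi> - u \<xi>)) = \<xi> - (blinfun_apply u ^^ n) \<xi>" for n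
        by (induction n) (auto simp: linear_diff[OF uk_lin] funpow_swap1)
      then have a: "avg n (\<xi> - u \<xi>) = inverse (real (Suc n)) *\<^sub>R (\<xi> - (blinfun_apply u ^^ Suc n) \<xi>)" for n
        by (simp only: avg_def)
      have "norm (avg n (\<xi> - u \<xi>)) \<le> inverse (real (Suc n)) * (2 * norm \<xi>)" for n
      proof -
        have "norm (\<xi> - (blinfun_apply u ^^ Suc n) \<xi>) \<le> 2 * norm \<xi>"
          using norm_triangle_ineq4[of \<xi> "(blinfun_apply u ^^ Suc n) \<xi>"] uk_norm[of "Suc n" \<xi>] by linarith
        then show ?thesis
          unfolding a norm_scaleR by (simp add: mult_left_mono del: of_nat_Suc funpow.simps)
      qed
      moreover have "(\<lambda>n. inverse (real (Suc n)) * (2 * norm \<xi>)) \<longlonglongrightarrow> 0"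
        using tendsto_mult_right[OF LIMSEQ_inverse_real_of_nat] by simp
      ultimately have "(\<lambda>n. avg n (\<xi> - u \<xi>)) \<longlonglongrightarrow> 0"
        by (rule Lim_null_comparison[OF always_eventually[OF allI]])
      then show ?thesis
        using that by simp
    qed
  qed (use u in auto)
  \<comment> \<open>The ergodic limit knows only the single unitary \<open>u\<close>. The
    contraction argument gives one inclusion, the Mautner phenomenon the other.\<close>
  have fix_eq: "{\<xi>. \<forall>v\<in>{u}. blinfun_apply v \<xi> = \<xi>} = W_fixed"
    using W_fixedI_contraction[OF \<alpha>(1,2)] fixed_all[OF _ g] by (auto simp: u_def g_def)
  define Z where "Z n = inverse (real (Suc n)) *\<^sub>R (\<Sum>k<Suc n. Y k)" for n
  have scaleR_in: "r *\<^sub>R z \<in> B I J" if "z \<in> B I J" for r z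
  proof -
    have "r *\<^sub>R z = scaleC_op (complex_of_real r) o\<^sub>L z"
      by (rule blinfun_eqI) (simp add: blinfun.scaleR_left scaleR_scaleC)
    then show ?thesis
      using that vN_compose[OF M vN_scaleC[OF M]] by simp
  qed
  have "(\<Sum>k<n. Y k) \<in> B I J" for n
  proof (induction n)
    case 0
    then show ?case
      using scaleR_in[OF x, of 0] by simp
  qed (auto intro: vN_add[OF M] Y_in)
  then have Z_in: "Z n \<in> B I J" for n
    unfolding Z_def by (intro scaleR_in)
  have Z_norm: "norm (Z n) \<le> norm x" for n
  proof -
    have "norm (\<Sum>k<Suc n. Y k) \<le> (\<Sum>k<Suc n. norm x)"
      by (intro sum_norm_le Y_norm)
    then show ?thesis
      unfolding Z_def norm_scaleR by (simp add: field_simps del: sum.lessThan_Suc of_nat_Suc)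
  qed
  have "Z n \<Omega> = avg n (x \<Omega>)" for n
    by (simp add: Z_def avg_def blinfun.scaleR_left blinfun.sum_left Y_\<Omega> del: sum.lessThan_Suc of_nat_Suc)
  then have Z_\<Omega>: "(\<lambda>n. Z n \<Omega>) \<longlonglongrightarrow> orth_proj W_fixed (x \<Omega>)"
    using lim[of "x \<Omega>", unfolded fix_eq] by simp
  \<comment> \<open>On vectors created by \<open>B I1 J1\<close> the averages can be commuted past
    the creating operator, so their convergence on \<open>\<Omega>\<close> is enough.\<close>
  obtain I1 where I1: "bounded_interval I1" "\<forall>a\<in>I. \<forall>b\<in>I1. a < b"
    by (rule bounded_interval_greater[OF bounded_interval_bounded[OF I]])
  obtain J1 where J1: "bounded_interval J1" "\<forall>a\<in>J. \<forall>b\<in>J1. b < a"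
    by (rule bounded_interval_less[OF bounded_interval_bounded[OF J]])
  have conv: "convergent (\<lambda>n. Z n \<xi>)" if "\<xi> \<in> (\<lambda>x. blinfun_apply x \<Omega>) ` B I1 J1" for \<xi>
  proof -
    obtain z where z: "z \<in> B I1 J1" "\<xi> = z \<Omega>"
      using \<open>\<xi> \<in> _\<close> by blast
    have "Z n o\<^sub>L z = z o\<^sub>L Z n" for n
      by (rule B_comm[OF I J I1(1) J1(1) I1(2) J1(2) Z_in z(1)])
    then have "Z n \<xi> = z (Z n \<Omega>)" for n
      unfolding z(2) by (metis blinfun_apply_blinfun_compose)
    moreover have "(\<lambda>n. z (Z n \<Omega>)) \<longlonglongrightarrow> z (orth_proj W_fixed (x \<Omega>))"
      by (intro blinfun.tendsto tendsto_const Z_\<Omega>)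
    ultimately show ?thesis
      by (auto simp: convergent_def)
  qed
  have Zc: "Z n \<in> clinear_ops" for n
    using Z_in vN_clinear[OF M] by blast
  obtain y where y: "y \<in> clinear_ops" "\<And>\<xi>. (\<lambda>n. Z n \<xi>) \<longlonglongrightarrow> y \<xi>"
    by (rule strong_limit_operator[OF Zc Z_norm B_cyclic[OF I1(1) J1(1)] conv]) (assumption, blast intro: that)
  have "y \<in> B I J"
    by (rule vN_strong_limit[OF M Z_in y])
  moreover have "y \<Omega> = orth_proj W_fixed (x \<Omega>)"
    by (rule LIMSEQ_unique[OF y(2) Z_\<Omega>])
  ultimately show ?thesis
    using that invariant_if_vector_invariant[OF I J] orth_proj_in[OF csubspace_W_fixed closed_W_fixed]
    by metis
qed

end

section \<open>Asymptotic fields\<close>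

context half_net
begin

text \<open>Strong continuity becomes joint continuity because the operators \<open>\<tau> b\<close>
  are isometric.\<close>

lemma continuous_translated:
  assumes a: "continuous_on UNIV a" and \<eta>: "continuous_on UNIV \<eta>"
  shows "continuous_on UNIV (\<lambda>s::real. \<tau> (a s) (\<eta> s))"
  unfolding continuous_on_def
proof
  fix s
  have "((\<lambda>r. \<eta> r - \<eta> s) \<longlongrightarrow> \<eta> s - \<eta> s) (at s)"
    using \<eta> by (intro tendsto_diff tendsto_const) (simp add: continuous_on_def)
  then have "((\<lambda>r. norm (\<eta> r - \<eta> s)) \<longlongrightarrow> 0) (at s)"
    by (intro tendsto_norm_zero) simp
  then have "((\<lambda>r. norm (\<tau> (a r) (\<eta> r - \<eta> s))) \<longlongrightarrow> 0) (at s)"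
    by (simp add: unitary_norm[OF \<tau>_unitary])
  then have 1: "((\<lambda>r. \<tau> (a r) (\<eta> r - \<eta> s)) \<longlongrightarrow> 0) (at s)"
    by (rule tendsto_norm_zero_cancel)
  have "continuous_on UNIV (\<lambda>r. \<tau> (a r) (\<eta> s))"
    by (rule continuous_on_compose2[OF cont_trans a]) auto
  then have "((\<lambda>r. \<tau> (a r) (\<eta> s)) \<longlongrightarrow> \<tau> (a s) (\<eta> s)) (at s)"
    by (simp add: continuous_on_def)
  from tendsto_add[OF 1 this] show "((\<lambda>r. \<tau> (a r) (\<eta> r)) \<longlongrightarrow> \<tau> (a s) (\<eta> s)) (at s within UNIV)"
    by (simp add: blinfun.diff_right)
qed

lemma continuous_conj:
  assumes a: "continuous_on UNIV a"
  shows "continuous_on UNIV (\<lambda>s::real. conj_by (\<tau> (a s)) x \<xi>)"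
  unfolding conj_by_apply adj_\<tau>
  by (intro continuous_translated a blinfun.continuous_on continuous_on_const
      continuous_on_compose2[OF cont_trans, of UNIV "\<lambda>s. - a s"] continuous_intros) auto

text \<open>As the window widens, a translation by a fixed \<open>b\<close> amounts to a shift of
  the profile by order \<open>S powr (- \<epsilon>)\<close>, which is small in L1; so the averages
  kill coboundaries. The factor 2 arises because \<open>T (t, t)\<close> moves a light-cone
  coordinate by \<open>2 * t\<close>.\<close>

lemma smeared_ergodic:
  assumes h: "wave_profile h" and "0 < \<epsilon>" and \<sigma>: "\<sigma> = 1 \<or> \<sigma> = - 1"
  shows "((\<lambda>S. LINT s|lborel. h s *\<^sub>R \<tau> (2 * (\<sigma> * (S + S powr \<epsilon> * s))) \<zeta>)
    \<longlongrightarrow> orth_proj W_fixed \<zeta>) at_top"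
proof -
  define a where "a S s = 2 * (\<sigma> * (S + S powr \<epsilon> * s))" for S s
  define Q where "Q S \<zeta> = (LINT s|lborel. h s *\<^sub>R \<tau> (a S s) \<zeta>)" for S \<zeta>
  have ca: "continuous_on UNIV (a S)" for S
    unfolding a_def by (intro continuous_intros)
  have c: "continuous_on UNIV (\<lambda>s. \<tau> (a S s + b) \<xi>)" for S b \<xi>
    by (rule continuous_on_compose2[OF cont_trans, of UNIV]) (auto intro!: continuous_intros ca)
  have int: "integrable lborel (\<lambda>s. h s *\<^sub>R \<tau> (a S s + b) \<xi>)" for S b \<xi>
    by (rule profile_integrable_scaleR[OF h c, of _ _ _ "norm \<xi>"]) (simp add: unitary_norm[OF \<tau>_unitary])
  note int0 = int[of _ 0, simplified]
  have fixed_eq: "{\<xi>. \<forall>u\<in>range \<tau>. blinfun_apply u \<xi> = \<xi>} = W_fixed"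
    by (auto simp: W_fixed_def)
  have "((\<lambda>S. Q S \<zeta>) \<longlongrightarrow> orth_proj {\<xi>. \<forall>u\<in>range \<tau>. blinfun_apply u \<xi> = \<xi>} \<zeta>) at_top"
  proof (rule mean_ergodic)
    show "unitary_op u" if "u \<in> range \<tau>" for u
      using that \<tau>_unitary by auto
    show "linear (Q S)" for S
    proof (rule linearI)
      show "Q S (\<xi> + \<eta>) = Q S \<xi> + Q S \<eta>" for \<xi> \<eta>
        unfolding Q_def blinfun.add_right scaleR_add_right
        by (rule Bochner_Integration.integral_add[OF int0 int0])
      show "Q S (r *\<^sub>R \<xi>) = r *\<^sub>R Q S \<xi>" for r \<xi>
        unfolding Q_def blinfun.scaleR_right scaleR_left_commute[of _ r]
        by (rule integral_scaleR_right)
    qed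
    show "Q S (k *\<^sub>C \<xi>) = k *\<^sub>C Q S \<xi>" for S k \<xi>
    proof -
      have "h s *\<^sub>R \<tau> (a S s) (k *\<^sub>C \<xi>) = k *\<^sub>C (h s *\<^sub>R \<tau> (a S s) \<xi>)" for s
        using unitary_clinear[OF \<tau>_unitary]
        by (simp add: clinear_ops_def scaleR_scaleC scaleC_scaleC mult.commute)
      then show ?thesis
        unfolding Q_def by (simp add: integral_bounded_linear[OF bounded_linear_scaleC int0])
    qed
    show "norm (Q S \<xi>) \<le> norm \<xi>" for S \<xi>
      unfolding Q_def by (rule profile_integrable_scaleR(2)[OF h])
        (use c[of S 0] in \<open>auto simp: unitary_norm[OF \<tau>_unitary]\<close>)
    show "((\<lambda>S. Q S \<xi>) \<longlongrightarrow> \<xi>) at_top" if "\<xi> \<in> {\<xi>. \<forall>u\<in>range \<tau>. blinfun_apply u \<xi> = \<xi>}" for \<xi>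
    proof -
      have "Q S \<xi> = (LINT s|lborel. h s *\<^sub>R \<xi>)" for S
        using that by (simp add: Q_def)
      also have "(LINT s|lborel. h s *\<^sub>R \<xi>) = \<xi>"
        using integral_scaleR_left[of \<xi> lborel h] profile_integrable[OF h] profile_integral[OF h] by simp
      finally show ?thesis
        by simp
    qed
    show "((\<lambda>S. Q S (\<xi> - blinfun_apply u \<xi>)) \<longlongrightarrow> 0) at_top" if u_range: "u \<in> range \<tau>" for u \<xi>
    proof -
      obtain b where u: "u = \<tau> b"
        using u_range by (rule rangeE)
      \<comment> \<open>Solves \<open>2 * (\<sigma> * (S powr \<epsilon> * \<delta> S)) = b\<close>,
        as the square of \<open>\<sigma>\<close> is 1.\<close>
      define \<delta> where "\<delta> S = \<sigma> * b / 2 * S powr (- \<epsilon>)" for S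
      have "((\<lambda>S. S powr (- \<epsilon>)) \<longlongrightarrow> 0) (at_top :: real filter)"
        using \<open>0 < \<epsilon>\<close> by (intro tendsto_neg_powr filterlim_ident) simp
      then have "(\<delta> \<longlongrightarrow> \<sigma> * b / 2 * 0) at_top"
        unfolding \<delta>_def by (intro tendsto_intros)
      then have \<delta>: "(\<delta> \<longlongrightarrow> 0) at_top"
        by simp
      have bound: "norm (Q S (\<xi> - u \<xi>)) \<le> (LINT s|lborel. \<bar>h s - h (s - \<delta> S)\<bar>) * norm \<xi>" if "S > 0" for S
      proof -
        have shift: "a S (\<delta> S + s) = a S s + b" for s
        proof -
          have "S powr \<epsilon> * S powr (- \<epsilon>) = 1"
            using that by (simp add: powr_minus)
          then have "2 * (\<sigma> * (S powr \<epsilon> * \<delta> S)) = \<sigma> * \<sigma> * b"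
            by (simp add: \<delta>_def algebra_simps)
          then show ?thesis
            using \<sigma> by (auto simp: a_def algebra_simps)
        qed
        have i2: "integrable lborel (\<lambda>s. h (s - \<delta> S) *\<^sub>R \<tau> (a S s) \<xi>)"
        proof -
          have "integrable lborel (\<lambda>s. h (\<delta> S + 1 * s - \<delta> S) *\<^sub>R \<tau> (a S (\<delta> S + 1 * s)) \<xi>)"
            using int[of S b \<xi>] by (simp add: shift)
          then show ?thesis
            by (subst (asm) lborel_integrable_real_affine_iff) auto
        qed
        have "(LINT s|lborel. h (s - \<delta> S) *\<^sub>R \<tau> (a S s) \<xi>) = (LINT s|lborel. h s *\<^sub>R \<tau> (a S s + b) \<xi>)"
          using lborel_integral_real_affine[of 1 "\<lambda>s. h (s - \<delta> S) *\<^sub>R \<tau> (a S s) \<xi>" "\<delta> S"] by (simp add: shift)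
        moreover have "Q S (\<xi> - u \<xi>) = (LINT s|lborel. h s *\<^sub>R \<tau> (a S s) \<xi>) - (LINT s|lborel. h s *\<^sub>R \<tau> (a S s + b) \<xi>)"
        proof -
          have "h s *\<^sub>R \<tau> (a S s) (\<xi> - u \<xi>) = h s *\<^sub>R \<tau> (a S s) \<xi> - h s *\<^sub>R \<tau> (a S s + b) \<xi>" for s
            unfolding u \<tau>_add by (simp add: blinfun.diff_right scaleR_diff_right)
          then show ?thesis
            unfolding Q_def by (simp only: Bochner_Integration.integral_diff[OF int0 int])
        qed
        ultimately have "Q S (\<xi> - u \<xi>) = (LINT s|lborel. (h s - h (s - \<delta> S)) *\<^sub>R \<tau> (a S s) \<xi>)"
          using int0[of S \<xi>] i2 by (simp add: scaleR_diff_left)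
        then have "norm (Q S (\<xi> - u \<xi>)) \<le> (LINT s|lborel. norm ((h s - h (s - \<delta> S)) *\<^sub>R \<tau> (a S s) \<xi>))"
          by (simp only: integral_norm_bound)
        also have "\<dots> = (LINT s|lborel. \<bar>h s - h (s - \<delta> S)\<bar>) * norm \<xi>"
          by (simp add: unitary_norm[OF \<tau>_unitary])
        finally show ?thesis .
      qed
      have "((\<lambda>S. (LINT s|lborel. \<bar>h s - h (s - \<delta> S)\<bar>) * norm \<xi>) \<longlongrightarrow> 0 * norm \<xi>) at_top"
        by (intro tendsto_intros profile_translation_continuous[OF h \<delta>])
      then show ?thesis
        by (intro Lim_null_comparison[OF eventually_mono[OF eventually_gt_at_top[of 0] bound]]) simp_all
    qed
  qed
  then show ?thesis
    unfolding fixed_eq Q_def a_def .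
qed

text \<open>The translated \<open>x\<close> runs off along the second coordinate, to the right for
  \<open>\<sigma> = 1\<close> and to the left for \<open>\<sigma> = - 1\<close>. It becomes
  spacelike to a cone whose first interval lies on the same side of \<open>I\<close>.\<close>

lemma late_commute:
  assumes I: "bounded_interval I" "bounded_interval I1" and J: "bounded_interval J" "bounded_interval J1"
    and x: "x \<in> B I J" and z: "z \<in> B I1 J1" and \<sigma>: "\<sigma> = 1 \<or> \<sigma> = - 1"
    and I1: "\<forall>a\<in>I. \<forall>b\<in>I1. \<sigma> * a < \<sigma> * b"
  obtains M where "\<And>t. t \<ge> M \<Longrightarrow> conj_by (\<tau> (2 * (\<sigma> * t))) x o\<^sub>L z = z o\<^sub>L conj_by (\<tau> (2 * (\<sigma> * t))) x"
proof -
  obtain m m1 where m: "\<And>v. v \<in> J \<Longrightarrow> \<bar>v\<bar> \<le> m" and m1: "\<And>v. v \<in> J1 \<Longrightarrow> \<bar>v\<bar> \<le> m1"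
    using bounded_interval_bounded[OF J(1)] bounded_interval_bounded[OF J(2)] by (auto simp: bounded_iff)
  show ?thesis
  proof (rule that[of "\<bar>m\<bar> + \<bar>m1\<bar> + 1"])
    fix t assume t: "t \<ge> \<bar>m\<bar> + \<bar>m1\<bar> + 1"
    let ?J = "(+) (2 * (\<sigma> * t)) ` J"
    have J': "bounded_interval ?J"
      by (rule bounded_interval_shift[OF J(1)])
    have x': "conj_by (\<tau> (2 * (\<sigma> * t))) x \<in> B I ?J"
      using B_trans[OF I(1) J(1)] x by blast
    show "conj_by (\<tau> (2 * (\<sigma> * t))) x o\<^sub>L z = z o\<^sub>L conj_by (\<tau> (2 * (\<sigma> * t))) x"
    proof (cases "\<sigma> = 1")
      case True
      show ?thesis
      proof (rule B_comm[OF I(1) J' I(2) J(2) _ _ x' z])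
        show "\<forall>a\<in>?J. \<forall>b\<in>J1. b < a"
          using True m m1 t by force
      qed (use I1 True in auto)
    next
      case False
      then have "\<sigma> = - 1"
        using \<sigma> by simp
      have "z o\<^sub>L conj_by (\<tau> (2 * (\<sigma> * t))) x = conj_by (\<tau> (2 * (\<sigma> * t))) x o\<^sub>L z"
      proof (rule B_comm[OF I(2) J(2) I(1) J' _ _ z x'])
        show "\<forall>a\<in>J1. \<forall>b\<in>?J. b < a"
          using \<open>\<sigma> = - 1\<close> m m1 t by force
      qed (use I1 \<open>\<sigma> = - 1\<close> in auto)
      then show ?thesis ..
    qed
  qed
qed

text \<open>On vectors \<open>z \<Omega>\<close> with \<open>z\<close> localized on the side from which the wave escapes, \<open>x\<close>
  eventually commutes with \<open>z\<close>, so the limit is determined by the one on the vacuum.\<close>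

lemma asymptotic_limit:
  assumes h: "wave_profile h" and \<epsilon>: "0 < \<epsilon>" "\<epsilon> < 1" and \<sigma>: "\<sigma> = 1 \<or> \<sigma> = - 1"
    and I: "bounded_interval I" and J: "bounded_interval J" and x: "x \<in> B I J"
    and y: "y \<in> chir I J" and y\<Omega>: "y \<Omega> = orth_proj W_fixed (x \<Omega>)"
  shows "((\<lambda>S. LINT t|lborel. scaled_profile h \<epsilon> (\<sigma> * S) t *\<^sub>R conj_by (\<tau> (2 * t)) x \<xi>) \<longlongrightarrow> y \<xi>) at_top"
proof -
  define a where "a S s = S + S powr \<epsilon> * s" for S s
  define X where "X t = conj_by (\<tau> (2 * (\<sigma> * t))) x" for t
  define Y where "Y S \<xi> = (LINT s|lborel. h s *\<^sub>R X (a S s) \<xi>)" for S \<xi>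
  have X_norm: "norm (X t \<xi>) \<le> norm x * norm \<xi>" for t \<xi>
    unfolding X_def by (rule order_trans[OF norm_blinfun mult_right_mono[OF norm_conj_by_le[OF \<tau>_unitary]]]) simp
  have X_cont: "continuous_on UNIV (\<lambda>s. X (a S s) \<xi>)" for S \<xi>
    unfolding X_def by (intro continuous_conj) (auto simp: a_def intro!: continuous_intros)
  note int = profile_integrable_scaleR(1)[OF h X_cont X_norm]
  have lin: "linear (Y S)" for S
  proof (rule linearI)
    show "Y S (\<xi> + \<eta>) = Y S \<xi> + Y S \<eta>" for \<xi> \<eta>
      unfolding Y_def blinfun.add_right scaleR_add_right
      by (rule Bochner_Integration.integral_add[OF int int])
    show "Y S (r *\<^sub>R \<xi>) = r *\<^sub>R Y S \<xi>" for r \<xi>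
      unfolding Y_def blinfun.scaleR_right scaleR_left_commute[of _ r]
      by (rule integral_scaleR_right)
  qed
  have bound: "norm (Y S \<xi>) \<le> norm x * norm \<xi>" for S \<xi>
    unfolding Y_def by (rule profile_integrable_scaleR(2)[OF h X_cont X_norm])
  obtain I1 where I1: "bounded_interval I1" "\<forall>a\<in>I. \<forall>b\<in>I1. \<sigma> * a < \<sigma> * b"
  proof (cases "\<sigma> = 1")
    case True
    then show ?thesis
      using that by (auto intro: bounded_interval_greater[OF bounded_interval_bounded[OF I]])
  next
    case False
    then have "\<sigma> = - 1"
      using \<sigma> by simp
    then show ?thesis
      using that by (auto intro: bounded_interval_less[OF bounded_interval_bounded[OF I]])
  qed
  have lim: "((\<lambda>S. Y S \<xi>) \<longlongrightarrow> y \<xi>) at_top"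
  proof (rule tendsto_on_dense[OF lin bound blinfun.bounded_linear_right B_cyclic[OF I1(1) J]])
    fix \<xi> assume "\<xi> \<in> (\<lambda>x. blinfun_apply x \<Omega>) ` B I1 J"
    then obtain z where z: "z \<in> B I1 J" and \<xi>: "\<xi> = z \<Omega>"
      by blast
    obtain M where M: "\<And>t. t \<ge> M \<Longrightarrow> X t o\<^sub>L z = z o\<^sub>L X t"
      using late_commute[OF I I1(1) J J x z \<sigma> I1(2)] unfolding X_def by blast
    have "y \<in> B I J" and yW: "W g o\<^sub>L y = y o\<^sub>L W g" if "g \<in> mobius_cover" for g
      using y that by (auto simp: chir_def commutant_def)
    then have yB: "y \<in> B I J"
      using id_cover by blast
    \<comment> \<open>Commutation is obtained for some late translate of \<open>y\<close>, and
      \<open>y\<close> equals all its translates.\<close>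
    obtain t where "conj_by (\<tau> (2 * (\<sigma> * t))) y o\<^sub>L z = z o\<^sub>L conj_by (\<tau> (2 * (\<sigma> * t))) y"
      using late_commute[OF I I1(1) J J yB z \<sigma> I1(2)] by blast
    moreover have "conj_by (\<tau> b) y = y" for b
      using conj_by_fixed_iff[OF \<tau>_unitary] yW[OF translation_cover] by blast
    ultimately have "y o\<^sub>L z = z o\<^sub>L y"
      by simp
    then have yz: "y \<xi> = z (y \<Omega>)"
      unfolding \<xi> by (metis blinfun_apply_blinfun_compose)
    have "X t \<Omega> = \<tau> (2 * (\<sigma> * t)) (x \<Omega>)" for t
      by (simp add: X_def conj_by_apply adj_W_vacuum[OF translation_cover])
    then have "((\<lambda>S. Y S \<Omega>) \<longlongrightarrow> y \<Omega>) at_top"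
      using smeared_ergodic[OF h \<epsilon>(1) \<sigma>, of "x \<Omega>"] by (simp add: Y_def a_def y\<Omega>)
    then have 1: "((\<lambda>S. z (Y S \<Omega>)) \<longlongrightarrow> y \<xi>) at_top"
      unfolding yz by (intro blinfun.tendsto tendsto_const)
    \<comment> \<open>The defect of commuting \<open>z\<close> past the translated \<open>x\<close>.
      It is bounded and vanishes at late times, so dominated convergence sends its smeared average
      to 0.\<close>
    define D where "D t = X t \<xi> - z (X t \<Omega>)" for t
    have D0: "D t = 0" if "t \<ge> M" for t
      using M[OF that] unfolding D_def \<xi> by (metis blinfun_apply_blinfun_compose right_minus_eq)
    define C where "C = norm x * norm \<xi> + norm z * (norm x * norm \<Omega>)"
    have D_norm: "norm (D t) \<le> C" for t
    proof -
      have "norm (z (X t \<Omega>)) \<le> norm z * (norm x * norm \<Omega>)"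
        by (rule order_trans[OF norm_blinfun mult_left_mono[OF X_norm]]) simp
      then show ?thesis
        using norm_triangle_ineq4[of "X t \<xi>" "z (X t \<Omega>)"] X_norm[of t \<xi>] by (simp add: D_def C_def)
    qed
    have D_cont: "continuous_on UNIV (\<lambda>s. D (a S s))" for S
      unfolding D_def by (intro continuous_intros X_cont)
    have "((\<lambda>S. LINT s|lborel. h s *\<^sub>R D (a S s)) \<longlongrightarrow> (LINT s::real|lborel. (0::'h))) at_top"
    proof (rule integral_dominated_convergence_at_top[where s = "\<lambda>S s. h s *\<^sub>R D (a S s)"
          and f = "\<lambda>_. 0" and w = "\<lambda>s. h s * C"])
      show "(\<lambda>s. h s *\<^sub>R D (a S s)) \<in> borel_measurable lborel" for S
        using profile_integrable_scaleR(1)[OF h D_cont D_norm] by (rule borel_measurable_integrable)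
      show "AE s in lborel. ((\<lambda>S. h s *\<^sub>R D (a S s)) \<longlongrightarrow> 0) at_top"
      proof (rule AE_I2)
        fix s
        have "\<forall>\<^sub>F S in at_top. a S s \<ge> M"
          using filterlim_add_powr_mult_at_top[OF \<epsilon>(2), of s] unfolding a_def filterlim_at_top by blast
        then have "\<forall>\<^sub>F S in at_top. h s *\<^sub>R D (a S s) = 0"
          by eventually_elim (simp add: D0)
        then show "((\<lambda>S. h s *\<^sub>R D (a S s)) \<longlongrightarrow> 0) at_top"
          by (rule tendsto_eventually)
      qed
      show "\<forall>\<^sub>F S in at_top. AE s in lborel. norm (h s *\<^sub>R D (a S s)) \<le> h s * C"
        using profile_nonneg[OF h] D_norm by (auto intro!: always_eventually AE_I2 mult_left_mono)
    qed (use profile_integrable[OF h] in auto)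
    moreover have "(LINT s|lborel. h s *\<^sub>R D (a S s)) = Y S \<xi> - z (Y S \<Omega>)" for S
    proof -
      have i: "integrable lborel (\<lambda>s. z (h s *\<^sub>R X (a S s) \<Omega>))"
        by (rule integrable_bounded_linear[OF blinfun.bounded_linear_right int])
      have "z (Y S \<Omega>) = (LINT s|lborel. z (h s *\<^sub>R X (a S s) \<Omega>))"
        unfolding Y_def by (rule integral_bounded_linear[OF blinfun.bounded_linear_right int, symmetric])
      then show ?thesis
        using Bochner_Integration.integral_diff[OF int i] unfolding Y_def D_def
        by (simp add: scaleR_diff_right blinfun.scaleR_right)
    qed
    ultimately have "((\<lambda>S. Y S \<xi> - z (Y S \<Omega>)) \<longlongrightarrow> 0) at_top"
      by simp
    from tendsto_add[OF this 1] show "((\<lambda>S. Y S \<xi>) \<longlongrightarrow> y \<xi>) at_top"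
      by simp
  qed
  have "\<forall>\<^sub>F S in at_top. (LINT t|lborel. scaled_profile h \<epsilon> (\<sigma> * S) t *\<^sub>R conj_by (\<tau> (2 * t)) x \<xi>) = Y S \<xi>"
    using eventually_gt_at_top[of 0]
  proof eventually_elim
    case (elim S)
    show ?case
      unfolding Y_def X_def a_def by (rule scaled_profile_integral[OF h elim \<sigma>])
  qed
  from tendsto_cong[OF this] lim show ?thesis
    by simp
qed

section \<open>The algebra of chiral fields\<close>

lemma chir_subset: "chir I J \<subseteq> B I J"
  by (auto simp: chir_def)

lemma chir_wave: "y \<in> chir I J \<Longrightarrow> y \<Omega> \<in> W_fixed"
  using vacuum_fixed unfolding chir_def commutant_def W_fixed_def
  by (auto simp: translation_cover) (metis blinfun_apply_blinfun_compose imageI translation_cover)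

lemma chir_adj:
  assumes "bounded_interval I" "bounded_interval J" "y \<in> chir I J"
  shows "adj y \<in> chir I J"
proof -
  have "adj y \<in> commutant (W ` mobius_cover)"
  proof (rule commutant_adj)
    show "W ` mobius_cover \<subseteq> clinear_ops"
      using unitary_clinear[OF unitary] by blast
    fix u assume "u \<in> W ` mobius_cover"
    then obtain g where g: "g \<in> mobius_cover" "u = W g"
      by blast
    then show "adj u \<in> W ` mobius_cover"
      using adj_W_exists[OF g(1)] by auto
  qed (use assms in \<open>simp add: chir_def\<close>)
  then show ?thesis
    using assms vN_adj[OF B_vN[OF assms(1,2)]] by (simp add: chir_def)
qed

lemma W_clinear: "W ` mobius_cover \<subseteq> clinear_ops"
  using unitary_clinear[OF unitary] by blast

lemma
  assumes "bounded_interval I" "bounded_interval J"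
  shows chir_compose: "x \<in> chir I J \<Longrightarrow> y \<in> chir I J \<Longrightarrow> x o\<^sub>L y \<in> chir I J"
    and chir_diff: "x \<in> chir I J \<Longrightarrow> y \<in> chir I J \<Longrightarrow> x - y \<in> chir I J"
    and chir_id: "id_blinfun \<in> chir I J"
    and chir_clinear: "chir I J \<subseteq> clinear_ops"
  using vN_compose[OF B_vN[OF assms]] vN_diff[OF B_vN[OF assms]] vN_id[OF B_vN[OF assms]]
    commutant_id[OF W_clinear]
  by (auto simp: chir_def intro: commutant_compose commutant_diff) (auto simp: commutant_def)

lemma chir_mono:
  "\<lbrakk>bounded_interval I; bounded_interval J; bounded_interval I'; bounded_interval J'; I \<subseteq> I'; J \<subseteq> J'\<rbrakk>
    \<Longrightarrow> chir I J \<subseteq> chir I' J'"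
  using B_mono[of I J I' J'] by (auto simp: chir_def)

text \<open>Translations along the second coordinate commute with \<open>y\<close>, so
  \<open>y\<close> is localized over every translate of \<open>J\<close>. This freedom will make
  left and right fields spacelike.\<close>

lemma chir_translate:
  assumes "bounded_interval I" "bounded_interval J" "y \<in> chir I J"
  shows "y \<in> B I ((+) b ` J)"
proof -
  have "y \<in> B I J" "\<tau> b o\<^sub>L y = y o\<^sub>L \<tau> b"
    using assms(3) translation_cover by (auto simp: chir_def commutant_def)
  then have "conj_by (\<tau> b) y = y"
    using conj_by_fixed_iff[OF \<tau>_unitary] by blast
  then show ?thesis
    using B_trans[OF assms(1,2), of b] \<open>y \<in> B I J\<close> by (metis image_eqI)
qed

text \<open>Local vectors approximate \<open>\<xi>\<close>; projecting them onto
  \<open>W_fixed\<close> keeps the limit, and the projected vectors are created by chiral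
  fields.\<close>

lemma chir_dense:
  assumes I: "bounded_interval I" and J: "bounded_interval J" and \<xi>: "\<xi> \<in> W_fixed"
  obtains y where "\<And>n::nat. y n \<in> chir I J" "(\<lambda>n. y n \<Omega>) \<longlonglongrightarrow> \<xi>"
proof -
  have "\<xi> \<in> closure ((\<lambda>x. blinfun_apply x \<Omega>) ` B I J)"
    using B_cyclic[OF I J] by simp
  then obtain f where f: "\<And>n::nat. f n \<in> (\<lambda>x. blinfun_apply x \<Omega>) ` B I J" "f \<longlonglongrightarrow> \<xi>"
    unfolding closure_sequential by blast
  have "\<exists>y\<in>chir I J. y \<Omega> = orth_proj W_fixed (f n)" for n
  proof -
    obtain x where "x \<in> B I J" "f n = x \<Omega>"
      using f(1)[of n] by blast
    then show ?thesis
      using chiral_projection[OF I J] by metis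
  qed
  then obtain y where y: "\<And>n. y n \<in> chir I J" "\<And>n. y n \<Omega> = orth_proj W_fixed (f n)"
    by metis
  have "(\<lambda>n. orth_proj W_fixed (f n)) \<longlonglongrightarrow> orth_proj W_fixed \<xi>"
    by (rule bounded_linear.tendsto[OF bounded_linear_orth_proj[OF csubspace_W_fixed closed_W_fixed] f(2)])
  then have "(\<lambda>n. y n \<Omega>) \<longlonglongrightarrow> \<xi>"
    by (simp add: y(2) orth_proj_fixed[OF csubspace_W_fixed \<xi>])
  then show ?thesis
    using that y(1) by blast
qed

end

section \<open>The two chiralities\<close>

context half_net
begin

text \<open>Forgets the localization, since sequences of local operators come with varying
  regions.\<close>

definition chir_local :: "('h \<Rightarrow>\<^sub>L 'h) set" where
  "chir_local = {y. \<exists>I J. bounded_interval I \<and> bounded_interval J \<and> y \<in> chir I J}"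

lemma chir_localI: "bounded_interval I \<Longrightarrow> bounded_interval J \<Longrightarrow> y \<in> chir I J \<Longrightarrow> y \<in> chir_local"
  by (auto simp: chir_local_def)

lemma chir_local_diff:
  assumes "x \<in> chir_local" "y \<in> chir_local"
  shows "x - y \<in> chir_local"
proof -
  obtain I J I' J' where I: "bounded_interval I" "bounded_interval I'"
      and J: "bounded_interval J" "bounded_interval J'" and x: "x \<in> chir I J" and y: "y \<in> chir I' J'"
    using assms by (auto simp: chir_local_def)
  have "bounded ((I \<union> I') \<union> (J \<union> J'))"
    using I J bounded_interval_bounded by auto
  then obtain m where m: "\<And>v. v \<in> (I \<union> I') \<union> (J \<union> J') \<Longrightarrow> \<bar>v\<bar> \<le> m"
    by (auto simp: bounded_iff)
  define K where "K = {- \<bar>m\<bar> - 1<..<\<bar>m\<bar> + 1}"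
  have "- \<bar>m\<bar> - 1 < \<bar>m\<bar> + 1"
    by linarith
  then have K: "bounded_interval K"
    unfolding K_def bounded_interval_def by blast
  have "I \<subseteq> K" "I' \<subseteq> K" "J \<subseteq> K" "J' \<subseteq> K"
    using m by (fastforce simp: K_def)+
  then have "x \<in> chir K K" "y \<in> chir K K"
    using x y chir_mono[OF I(1) J(1) K K] chir_mono[OF I(2) J(2) K K] by blast+
  then show ?thesis
    using chir_diff[OF K K] chir_localI[OF K K] by blast
qed

end

lemma bounded_double_cone_cover:
  fixes R :: "(real \<times> real) set"
  assumes "bounded R"
  obtains I where "bounded_interval I" "R \<subseteq> double_cone I I"
proof -
  obtain m where m: "\<And>a. a \<in> R \<Longrightarrow> norm a \<le> m"
    using assms by (auto simp: bounded_iff)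
  define I where "I = {- (2 * \<bar>m\<bar> + 1)<..<2 * \<bar>m\<bar> + 1}"
  have "- (2 * \<bar>m\<bar> + 1) < 2 * \<bar>m\<bar> + 1"
    by linarith
  then have "bounded_interval I"
    unfolding I_def bounded_interval_def by blast
  moreover have "a \<in> double_cone I I" if "a \<in> R" for a
  proof -
    have "\<bar>fst a\<bar> \<le> m" "\<bar>snd a\<bar> \<le> m"
      using m[OF that] norm_fst_le[of "fst a" "snd a"] norm_snd_le[of "snd a" "fst a"] by auto
    then show ?thesis
      by (auto simp: double_cone_def I_def)
  qed
  ultimately show ?thesis
    using that by blast
qed

text \<open>The Minkowski square of a difference is the product of its light-cone coordinates, which
  have opposite signs here.\<close>

lemma spacelike_double_cones:
  assumes "\<forall>a\<in>I. \<forall>b\<in>I'. a < b" "\<forall>a\<in>J. \<forall>b\<in>J'. b < a"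
  shows "spacelike_separated (double_cone I J) (double_cone I' J')"
  unfolding spacelike_separated_def
proof (intro ballI)
  fix a b assume ab: "a \<in> double_cone I J" "b \<in> double_cone I' J'"
  then have "fst a - snd a < fst b - snd b" "fst b + snd b < fst a + snd a"
    using assms by (auto simp: double_cone_def)
  then have "((fst a - fst b) - (snd a - snd b)) * ((fst a - fst b) + (snd a - snd b)) < 0"
    by (intro mult_neg_pos) linarith+
  then show "(fst a - fst b)\<^sup>2 < (snd a - snd b)\<^sup>2"
    by (simp add: power2_eq_square algebra_simps)
qed

section \<open>The two light-cone factors as half nets\<close>

context mobius_covariant_net
begin

lemma V_unitary: "f \<in> mobius_cover \<Longrightarrow> g \<in> mobius_cover \<Longrightarrow> unitary_op (V (f, g))"
  using mobius_representation by (simp add: unitary_representation_def mobius2_group_def)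

lemma V_mult:
  assumes "f \<in> mobius_cover" "g \<in> mobius_cover" "f' \<in> mobius_cover" "g' \<in> mobius_cover"
  shows "V (f \<circ> f', g \<circ> g') = V (f, g) o\<^sub>L V (f', g')"
proof -
  have "V (mobius2_mult (f, g) (f', g')) = V (f, g) o\<^sub>L V (f', g')"
    using mobius_representation assms unfolding unitary_representation_def mobius2_group_def by blast
  then show ?thesis
    by (simp add: mobius2_mult_def)
qed

lemma V_cont: "continuous_on (mobius_cover \<times> mobius_cover) (\<lambda>g. V g \<xi>)"
  using mobius_representation by (simp add: unitary_representation_def mobius2_group_def)

lemma V_translation: "V (affine_lift 1 b, affine_lift 1 c) = T ((b + c) / 2, (c - b) / 2)"
proof -
  have "V (poincare_lift 0 ((b + c) / 2, (c - b) / 2)) = U (poincare_map 0 ((b + c) / 2, (c - b) / 2))"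
    by (rule extends)
  moreover have "poincare_lift 0 ((b + c) / 2, (c - b) / 2) = (affine_lift 1 b, affine_lift 1 c)"
    by (simp add: poincare_lift_def field_simps)
  ultimately show ?thesis
    by (simp add: translation_op_def translation_map)
qed

lemma V_translation_R: "V (id, affine_lift 1 c) = T (c / 2, c / 2)"
  using V_translation[of 0 c] by (simp add: affine_lift_id)

lemma V_translation_L: "V (affine_lift 1 b, id) = T (b / 2, - b / 2)"
  using V_translation[of b 0] by (simp add: affine_lift_id)

lemma rep_R: "mobius_rep (\<lambda>g. V (id, g))"
proof
  have "continuous_on mobius_cover (\<lambda>g. V (id, g) \<xi>)" for \<xi>
    by (rule continuous_on_compose2[OF V_cont]) (auto intro!: continuous_intros simp: id_cover)
  then show "unitary_representation mobius_cover (\<circ>) (\<lambda>g. V (id, g))"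
    using V_mult[OF id_cover _ id_cover] by (simp add: unitary_representation_def V_unitary id_cover)
qed

lemma rep_L: "mobius_rep (\<lambda>g. V (g, id))"
proof
  have "continuous_on mobius_cover (\<lambda>g. V (g, id) \<xi>)" for \<xi>
    by (rule continuous_on_compose2[OF V_cont]) (auto intro!: continuous_intros simp: id_cover)
  then show "unitary_representation mobius_cover (\<circ>) (\<lambda>g. V (g, id))"
    using V_mult[OF _ id_cover _ id_cover] by (simp add: unitary_representation_def V_unitary id_cover)
qed

lemma wave_space_R: "mobius_rep.W_fixed (\<lambda>g. V (id, g)) = wave_space U 1"
  unfolding mobius_rep.W_fixed_def[OF rep_R] wave_space_def V_translation_R
proof (intro Collect_cong iffI allI)
  show "T (t, 1 * t) \<xi> = \<xi>" if "\<forall>b. T (b / 2, b / 2) \<xi> = \<xi>" for t \<xi>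
    using spec[OF that, of "2 * t"] by simp
qed simp

lemma wave_space_L: "mobius_rep.W_fixed (\<lambda>g. V (g, id)) = wave_space U (- 1)"
  unfolding mobius_rep.W_fixed_def[OF rep_L] wave_space_def V_translation_L
proof (intro Collect_cong iffI allI)
  show "T (t, - 1 * t) \<xi> = \<xi>" if "\<forall>b. T (b / 2, - b / 2) \<xi> = \<xi>" for t \<xi>
    using spec[OF that, of "2 * t"] by simp
  show "T (b / 2, - b / 2) \<xi> = \<xi>" if "\<forall>t. T (t, - 1 * t) \<xi> = \<xi>" for b \<xi>
    using spec[OF that, of "b / 2"] by simp
qed

lemma double_cone_interval:
  assumes "bounded_interval I" "bounded_interval J"
  shows "open (double_cone I J)" "bounded (double_cone I J)"
  using assms by (auto intro!: open_double_cone bounded_double_cone bounded_interval_open bounded_interval_bounded)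

lemma translate_double_cone:
  "(\<lambda>x. x + ((b + c) / 2, (c - b) / 2)) ` double_cone I J = double_cone ((+) b ` I) ((+) c ` J)"
proof (intro equalityI subsetI)
  fix y assume "y \<in> (\<lambda>x. x + ((b + c) / 2, (c - b) / 2)) ` double_cone I J"
  then obtain x where x: "x \<in> double_cone I J" "y = x + ((b + c) / 2, (c - b) / 2)"
    by blast
  have "fst y - snd y = b + (fst x - snd x)" "fst y + snd y = c + (fst x + snd x)"
    by (simp_all add: x(2) field_simps)
  then show "y \<in> double_cone ((+) b ` I) ((+) c ` J)"
    using x(1) by (simp add: double_cone_def)
next
  fix y assume y: "y \<in> double_cone ((+) b ` I) ((+) c ` J)"
  have "y - ((b + c) / 2, (c - b) / 2) \<in> double_cone I J"
  proof -
    have "fst y - snd y - b \<in> I" "fst y + snd y - c \<in> J"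
      using y by (auto simp: double_cone_def)
    moreover have "fst (y - ((b + c) / 2, (c - b) / 2)) - snd (y - ((b + c) / 2, (c - b) / 2)) = fst y - snd y - b"
      "fst (y - ((b + c) / 2, (c - b) / 2)) + snd (y - ((b + c) / 2, (c - b) / 2)) = fst y + snd y - c"
      by (simp_all add: field_simps)
    ultimately show ?thesis
      by (simp only: double_cone_def mem_Collect_eq simp_thms)
  qed
  then show "y \<in> (\<lambda>x. x + ((b + c) / 2, (c - b) / 2)) ` double_cone I J"
    by (intro image_eqI[of _ _ "y - ((b + c) / 2, (c - b) / 2)"]) simp_all
qed

lemma mobius2_act_double_cone:
  "mobius2_act (f, g) ` double_cone I J = double_cone (mobius_act f ` I) (mobius_act g ` J)"
proof (intro equalityI subsetI)
  fix y assume "y \<in> mobius2_act (f, g) ` double_cone I J"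
  then obtain x where x: "x \<in> double_cone I J" "y = mobius2_act (f, g) x"
    by blast
  have "fst y - snd y = mobius_act f (fst x - snd x)" "fst y + snd y = mobius_act g (fst x + snd x)"
    by (simp_all add: x(2) mobius2_act_def Let_def field_simps)
  then show "y \<in> double_cone (mobius_act f ` I) (mobius_act g ` J)"
    using x(1) by (simp add: double_cone_def)
next
  fix y assume "y \<in> double_cone (mobius_act f ` I) (mobius_act g ` J)"
  then obtain u v where uv: "u \<in> I" "v \<in> J" "fst y - snd y = mobius_act f u" "fst y + snd y = mobius_act g v"
    by (auto simp: double_cone_def)
  define x where "x = ((u + v) / 2, (v - u) / 2)"
  have x: "fst x - snd x = u" "fst x + snd x = v"
    by (simp_all add: x_def field_simps)
  have "mobius2_act (f, g) x = y"
    using uv by (auto simp: mobius2_act_def Let_def x prod_eq_iff field_simps)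
  moreover have "x \<in> double_cone I J"
    using uv x by (simp add: double_cone_def)
  ultimately show "y \<in> mobius2_act (f, g) ` double_cone I J"
    by blast
qed

lemma mobius_act_id: "mobius_act id ` I = I"
  by (simp add: mobius_act_def tan_arctan)

lemma locality_double_cones:
  assumes "bounded_interval I" "bounded_interval J" "bounded_interval I'" "bounded_interval J'"
    and "\<forall>a\<in>I. \<forall>b\<in>I'. a < b" "\<forall>a\<in>J. \<forall>b\<in>J'. b < a"
    and "x \<in> A (double_cone I J)" "y \<in> A (double_cone I' J')"
  shows "x o\<^sub>L y = y o\<^sub>L x"
  by (rule locality[OF double_cone_interval[OF assms(1,2)] double_cone_interval[OF assms(3,4)]
        spacelike_double_cones[OF assms(5,6)] assms(7,8)])

lemma local_covariance:
  assumes "bounded_interval I" "bounded_interval J"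
  obtains Q where "open Q" "(id, id) \<in> Q"
    "\<And>f g. f \<in> mobius_cover \<Longrightarrow> g \<in> mobius_cover \<Longrightarrow> (f, g) \<in> Q \<Longrightarrow>
      conj_by (V (f, g)) ` A (double_cone I J) = A (double_cone (mobius_act f ` I) (mobius_act g ` J))"
proof -
  obtain N where N: "openin (top_of_set mobius2_group) N" "(id, id) \<in> N"
      "\<And>g. g \<in> N \<Longrightarrow> conj_by (V g) ` A (double_cone I J) = A (mobius2_act g ` double_cone I J)"
    using mobius_covariance[OF double_cone_interval[OF assms]] by blast
  obtain Q where Q: "open Q" "N = mobius2_group \<inter> Q"
    using N(1) by (auto simp: openin_open)
  show ?thesis
  proof (rule that[OF Q(1)])
    show "(id, id) \<in> Q"
      using N(2) Q(2) by blast
    show "conj_by (V (f, g)) ` A (double_cone I J) = A (double_cone (mobius_act f ` I) (mobius_act g ` J))"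
      if "f \<in> mobius_cover" "g \<in> mobius_cover" "(f, g) \<in> Q" for f g
      using N(3)[of "(f, g)"] that Q(2) by (simp add: mobius2_group_def mobius2_act_double_cone)
  qed
qed

lemma half_net_R: "half_net (\<lambda>g. V (id, g)) (\<lambda>I J. A (double_cone I J)) \<Omega>"
proof (rule half_net.intro[OF rep_R], unfold_locales)
  fix I J I' J' :: "real set" and x y
  assume I: "bounded_interval I" and J: "bounded_interval J"
  note R = double_cone_interval[OF I J]
  show "von_neumann_algebra (A (double_cone I J))"
    by (rule von_neumann[OF R])
  show "closure ((\<lambda>x. blinfun_apply x \<Omega>) ` A (double_cone I J)) = UNIV"
    using reeh_schlieder[OF I J] by (simp add: cyc_def)
  show "conj_by (V (id, affine_lift 1 b)) ` A (double_cone I J) = A (double_cone I ((+) b ` J))" for b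
    using T_covariance[OF R, of "((0 + b) / 2, (b - 0) / 2)"] unfolding translate_double_cone
    by (simp add: V_translation_R)
  obtain Q where Q: "open Q" "(id, id) \<in> Q"
    "\<And>f g. f \<in> mobius_cover \<Longrightarrow> g \<in> mobius_cover \<Longrightarrow> (f, g) \<in> Q \<Longrightarrow>
      conj_by (V (f, g)) ` A (double_cone I J) = A (double_cone (mobius_act f ` I) (mobius_act g ` J))"
    by (rule local_covariance[OF I J]) (blast intro: that)
  have "open (Pair id -` Q)"
    by (rule open_vimage[OF Q(1)]) (intro continuous_intros)
  then show "\<exists>N. openin (top_of_set mobius_cover) N \<and> id \<in> N \<and>
      (\<forall>g\<in>N. conj_by (V (id, g)) ` A (double_cone I J) = A (double_cone I (mobius_act g ` J)))"
    using Q(2) Q(3)[OF id_cover]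
    by (intro exI[of _ "mobius_cover \<inter> (Pair id -` Q)"]) (auto simp: id_cover mobius_act_id)
  assume I': "bounded_interval I'" and J': "bounded_interval J'"
  show "A (double_cone I J) \<subseteq> A (double_cone I' J')" if "I \<subseteq> I'" "J \<subseteq> J'"
    by (rule isotony[OF R double_cone_interval[OF I' J'] double_cone_mono[OF that]])
  show "x o\<^sub>L y = y o\<^sub>L x"
    if "\<forall>a\<in>I. \<forall>b\<in>I'. a < b" "\<forall>a\<in>J. \<forall>b\<in>J'. b < a" "x \<in> A (double_cone I J)" "y \<in> A (double_cone I' J')"
    by (rule locality_double_cones[OF I J I' J' that])
next
  show "\<Omega> \<in> mobius_rep.W_fixed (\<lambda>g. V (id, g))"
    unfolding wave_space_R wave_space_def by (simp add: T_vacuum)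
qed

lemma half_net_L: "half_net (\<lambda>g. V (g, id)) (\<lambda>J I. A (double_cone I J)) \<Omega>"
proof (rule half_net.intro[OF rep_L], unfold_locales)
  fix J I J' I' :: "real set" and x y
  assume J: "bounded_interval J" and I: "bounded_interval I"
  note R = double_cone_interval[OF I J]
  show "von_neumann_algebra (A (double_cone I J))"
    by (rule von_neumann[OF R])
  show "closure ((\<lambda>x. blinfun_apply x \<Omega>) ` A (double_cone I J)) = UNIV"
    using reeh_schlieder[OF I J] by (simp add: cyc_def)
  show "conj_by (V (affine_lift 1 b, id)) ` A (double_cone I J) = A (double_cone ((+) b ` I) J)" for b
    using T_covariance[OF R, of "((b + 0) / 2, (0 - b) / 2)"] unfolding translate_double_cone
    by (simp add: V_translation_L)
  obtain Q where Q: "open Q" "(id, id) \<in> Q"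
    "\<And>f g. f \<in> mobius_cover \<Longrightarrow> g \<in> mobius_cover \<Longrightarrow> (f, g) \<in> Q \<Longrightarrow>
      conj_by (V (f, g)) ` A (double_cone I J) = A (double_cone (mobius_act f ` I) (mobius_act g ` J))"
    by (rule local_covariance[OF I J]) (blast intro: that)
  have "open ((\<lambda>f. (f, id)) -` Q)"
    by (rule open_vimage[OF Q(1)]) (intro continuous_intros)
  then show "\<exists>N. openin (top_of_set mobius_cover) N \<and> id \<in> N \<and>
      (\<forall>g\<in>N. conj_by (V (g, id)) ` A (double_cone I J) = A (double_cone (mobius_act g ` I) J))"
    using Q(2) Q(3)[OF _ id_cover]
    by (intro exI[of _ "mobius_cover \<inter> ((\<lambda>f. (f, id)) -` Q)"]) (auto simp: id_cover mobius_act_id)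
  assume J': "bounded_interval J'" and I': "bounded_interval I'"
  show "A (double_cone I J) \<subseteq> A (double_cone I' J')" if "J \<subseteq> J'" "I \<subseteq> I'"
    by (rule isotony[OF R double_cone_interval[OF I' J'] double_cone_mono[OF that(2,1)]])
  show "x o\<^sub>L y = y o\<^sub>L x"
    if "\<forall>a\<in>J. \<forall>b\<in>J'. a < b" "\<forall>a\<in>I. \<forall>b\<in>I'. b < a" "x \<in> A (double_cone I J)" "y \<in> A (double_cone I' J')"
    \<comment> \<open>Exchanging the coordinates reverses the order relations, so locality is
      applied with the two cones interchanged.\<close>
    by (rule locality_double_cones[OF I' J' I J _ _ that(4,3), symmetric]) (use that in auto)
next
  show "\<Omega> \<in> mobius_rep.W_fixed (\<lambda>g. V (g, id))"
    unfolding wave_space_L wave_space_def by (simp add: T_vacuum)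
qed

end

section \<open>Collision states\<close>

context mobius_covariant_net
begin

text \<open>\<open>R\<close> moves \<open>a\<^sub>0 + a\<^sub>1\<close>, so its invariant operators are the left chiral fields and its fixed
  vectors are \<open>\<H>\<^sub>+\<close>; for \<open>L\<close> the roles are exchanged.\<close>

interpretation R: half_net "\<lambda>g. V (id, g)" "\<lambda>I J. A (double_cone I J)" \<Omega>
  by (rule half_net_R)

interpretation L: half_net "\<lambda>g. V (g, id)" "\<lambda>J I. A (double_cone I J)" \<Omega>
  by (rule half_net_L)

lemma R_chir: "R.chir I J = chiral_L A V J I"
proof -
  have "(\<lambda>g. V (id, g)) ` mobius_cover = V ` ({id} \<times> mobius_cover)"
    by auto
  then show ?thesis
    by (simp add: R.chir_def chiral_L_def)
qed

lemma L_chir: "L.chir J I = chiral_R A V I J"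
proof -
  have "(\<lambda>g. V (g, id)) ` mobius_cover = V ` (mobius_cover \<times> {id})"
    by auto
  then show ?thesis
    by (simp add: L.chir_def chiral_R_def)
qed

text \<open>Each field may be moved freely along one coordinate. Moving \<open>a\<close> along the
  second and \<open>b\<close> along the first makes the cones spacelike, wherever they
  started.\<close>

lemma chiral_fields_commute:
  assumes "a \<in> R.chir_local" "b \<in> L.chir_local"
  shows "a o\<^sub>L b = b o\<^sub>L a"
proof -
  obtain I J where I: "bounded_interval I" and J: "bounded_interval J" and a: "a \<in> R.chir I J"
    using assms(1) by (auto simp: R.chir_local_def)
  obtain I' J' where I': "bounded_interval I'" and J': "bounded_interval J'" and b: "b \<in> L.chir J' I'"
    using assms(2) by (auto simp: L.chir_local_def)
  have "bounded ((I \<union> I') \<union> (J \<union> J'))"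
    using I I' J J' bounded_interval_bounded by auto
  then obtain m where m: "\<And>v. v \<in> (I \<union> I') \<union> (J \<union> J') \<Longrightarrow> \<bar>v\<bar> \<le> m"
    by (auto simp: bounded_iff)
  \<comment> \<open>Any two points of the intervals differ by at most \<open>2 * m\<close>; the
    extra 1 makes the inequality strict.\<close>
  define t where "t = 2 * m + 1"
  have a': "a \<in> A (double_cone I ((+) t ` J))"
    by (rule R.chir_translate[OF I J a])
  have b': "b \<in> A (double_cone ((+) t ` I') J')"
    by (rule L.chir_translate[OF J' I' b])
  have less: "u < t + v" if "u \<in> (I \<union> I') \<union> (J \<union> J')" "v \<in> (I \<union> I') \<union> (J \<union> J')" for u v
    using m[OF that(1)] m[OF that(2)] by (simp add: t_def)
  show ?thesis
    by (rule locality_double_cones[OF I bounded_interval_shift[OF J] bounded_interval_shift[OF I'] J' _ _ a' b'])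
       (auto intro!: less)
qed

text \<open>The two group factors commute, so projecting \<open>\<eta>\<close> onto the vectors
  fixed by one factor keeps its invariance under the other. The projection is then Poincare
  invariant and, by uniqueness of the vacuum, a multiple of \<open>\<Omega>\<close>.\<close>

lemma wave_vectors_factorize:
  assumes \<xi>: "\<xi> \<in> R.W_fixed" and \<eta>: "\<eta> \<in> L.W_fixed"
  shows "cinner \<xi> \<eta> = cinner \<xi> \<Omega> * cinner \<Omega> \<eta>"
proof -
  note P = R.csubspace_W_fixed R.closed_W_fixed
  define p where "p = orth_proj R.W_fixed \<eta>"
  have p: "p \<in> R.W_fixed"
    unfolding p_def by (rule orth_proj_in[OF P])
  have split: "V (f, g) \<zeta> = V (f, id) (V (id, g) \<zeta>)" "V (f, g) \<zeta> = V (id, g) (V (f, id) \<zeta>)"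
    if "f \<in> mobius_cover" "g \<in> mobius_cover" for f g \<zeta>
    using V_mult[OF that(1) id_cover id_cover that(2)] V_mult[OF id_cover that(2) that(1) id_cover]
    by (metis blinfun_apply_blinfun_compose comp_id id_comp)+
  have L_fix: "V (f, id) p = p" if f: "f \<in> mobius_cover" for f
  proof -
    have u: "unitary_op (V (f, id))"
      by (rule V_unitary[OF f id_cover])
    have inv: "V (k, id) \<zeta> \<in> R.W_fixed" if k: "k \<in> mobius_cover" and \<zeta>: "\<zeta> \<in> R.W_fixed" for k \<zeta>
      unfolding R.W_fixed_def
    proof (intro CollectI allI)
      fix b
      have "V (id, affine_lift 1 b) (V (k, id) \<zeta>) = V (k, id) (V (id, affine_lift 1 b) \<zeta>)"
        using split[OF k R.translation_cover[of b], of \<zeta>] by simp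
      then show "V (id, affine_lift 1 b) (V (k, id) \<zeta>) = V (k, id) \<zeta>"
        using \<zeta> by (simp add: R.W_fixed_def)
    qed
    obtain k where k: "k \<in> mobius_cover" "adj (V (f, id)) = V (k, id)"
      using L.adj_W_exists[OF f] by blast
    have "V (f, id) o\<^sub>L proj_op R.W_fixed = proj_op R.W_fixed o\<^sub>L V (f, id)"
      by (rule proj_op_commutes[OF P unitary_clinear[OF u]]) (use inv f k in auto)
    then have "V (f, id) (proj_op R.W_fixed \<eta>) = proj_op R.W_fixed (V (f, id) \<eta>)"
      by (metis blinfun_apply_blinfun_compose)
    then show ?thesis
      by (simp add: proj_op_apply[OF P] p_def L.fixed_all[OF \<eta> f])
  qed
  have "U g p = p" if g_in: "g \<in> poincare_group" for g
  proof -
    obtain l b where g: "g = poincare_map l b"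
      using g_in unfolding poincare_group_def by blast
    have c: "affine_lift (exp (- l)) (fst b - snd b) \<in> mobius_cover" "affine_lift (exp l) (fst b + snd b) \<in> mobius_cover"
      by (auto intro: affine_lift_cover)
    show ?thesis
      unfolding g extends[symmetric] poincare_lift_def split(1)[OF c]
      by (simp add: R.fixed_all[OF p c(2)] L_fix[OF c(1)])
  qed
  then have c: "\<exists>c. p = c *\<^sub>C \<Omega>"
  proof (cases "p = 0")
    case True
    then show ?thesis
      by (intro exI[of _ 0]) simp
  next
    case False
    let ?q = "complex_of_real (1 / norm p) *\<^sub>C p"
    assume inv: "\<And>g. g \<in> poincare_group \<Longrightarrow> U g p = p"
    have "U g ?q = ?q" if "g \<in> poincare_group" for g
    proof -
      have "U g \<in> clinear_ops"
        using representation that by (simp add: unitary_representation_def unitary_op_def)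
      then show ?thesis
        using inv[OF that] by (simp add: clinear_ops_def)
    qed
    moreover have "norm ?q = 1"
      unfolding norm_scaleC norm_of_real using False by simp
    ultimately obtain c where "?q = c *\<^sub>C \<Omega>"
      using vacuum_unique[of ?q] by blast
    then have "complex_of_real (norm p) *\<^sub>C ?q = (complex_of_real (norm p) * c) *\<^sub>C \<Omega>"
      by (simp add: scaleC_scaleC)
    moreover have "complex_of_real (norm p) *\<^sub>C ?q = p"
      using False by (simp add: scaleC_scaleC flip: of_real_mult)
    ultimately show ?thesis
      by metis
  qed
  then obtain c where c: "p = c *\<^sub>C \<Omega>"
    by blast
  have orth: "cinner \<zeta> \<eta> = cinner \<zeta> p" if "\<zeta> \<in> R.W_fixed" for \<zeta>
    using orth_proj_orth[OF P that, of \<eta>] by (simp add: p_def cinner.diff_right)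
  have "cinner \<Omega> \<eta> = c"
    using orth[OF R.vacuum_fixed] vacuum_unit by (simp add: c cinner_scaleC_right cinner_self)
  then show ?thesis
    using orth[OF \<xi>] by (simp add: c cinner_scaleC_right mult.commute)
qed

text \<open>Since the fields commute, the squared norm is the inner product of
  \<open>(adj a o\<^sub>L a) \<Omega>\<close> and \<open>(adj b o\<^sub>L b) \<Omega>\<close>, two
  wave vectors of opposite kinds, which factorizes.\<close>

lemma norm_product:
  assumes a: "a \<in> R.chir_local" and b: "b \<in> L.chir_local"
  shows "norm (a (b \<Omega>)) = norm (a \<Omega>) * norm (b \<Omega>)"
proof -
  obtain I J where I: "bounded_interval I" and J: "bounded_interval J" and aI: "a \<in> R.chir I J"
    using a by (auto simp: R.chir_local_def)
  obtain I' J' where I': "bounded_interval I'" and J': "bounded_interval J'" and bJ: "b \<in> L.chir J' I'"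
    using b by (auto simp: L.chir_local_def)
  have ac: "a \<in> clinear_ops" and bc: "b \<in> clinear_ops"
    using aI R.chir_clinear[OF I J] bJ L.chir_clinear[OF J' I'] by blast+
  have aa: "adj a o\<^sub>L a \<in> R.chir I J"
    by (intro R.chir_compose[OF I J] R.chir_adj[OF I J] aI)
  have bb: "adj b o\<^sub>L b \<in> L.chir J' I'"
    by (intro L.chir_compose[OF J' I'] L.chir_adj[OF J' I'] bJ)
  have "(adj a o\<^sub>L a) o\<^sub>L b = b o\<^sub>L (adj a o\<^sub>L a)"
    by (rule chiral_fields_commute[OF R.chir_localI[OF I J aa] b])
  then have comm: "adj a (a (b \<Omega>)) = b (adj a (a \<Omega>))"
    by (metis blinfun_apply_blinfun_compose)
  have "cinner (a (b \<Omega>)) (a (b \<Omega>)) = cinner (adj a (a (b \<Omega>))) (b \<Omega>)"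
    by (simp add: cinner_adj_left[OF ac])
  also have "\<dots> = cinner ((adj a o\<^sub>L a) \<Omega>) ((adj b o\<^sub>L b) \<Omega>)"
    by (simp add: comm cinner_adj_right[OF bc])
  also have "\<dots> = cinner ((adj a o\<^sub>L a) \<Omega>) \<Omega> * cinner \<Omega> ((adj b o\<^sub>L b) \<Omega>)"
    by (rule wave_vectors_factorize[OF R.chir_wave[OF aa] L.chir_wave[OF bb]])
  also have "\<dots> = cinner (a \<Omega>) (a \<Omega>) * cinner (b \<Omega>) (b \<Omega>)"
    by (simp add: cinner_adj_left[OF ac] cinner_adj_right[OF bc])
  finally have "complex_of_real ((norm (a (b \<Omega>)))\<^sup>2) = complex_of_real ((norm (a \<Omega>) * norm (b \<Omega>))\<^sup>2)"
    unfolding cinner_self by (simp add: power_mult_distrib)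
  then show ?thesis
    by (metis mult_nonneg_nonneg norm_ge_zero of_real_eq_iff power2_eq_imp_eq)
qed

text \<open>Only norms of vectors created from the vacuum occur. This matters because the
  approximating fields converge on \<open>\<Omega>\<close> while nothing bounds their operator
  norms.\<close>

lemma norm_product_diff:
  assumes a: "a \<in> R.chir_local" "a' \<in> R.chir_local" and b: "b \<in> L.chir_local" "b' \<in> L.chir_local"
  shows "norm (a (b \<Omega>) - a' (b' \<Omega>)) \<le> norm (a \<Omega> - a' \<Omega>) * norm (b \<Omega>) + norm (a' \<Omega>) * norm (b \<Omega> - b' \<Omega>)"
proof -
  have "a (b \<Omega>) - a' (b' \<Omega>) = (a - a') (b \<Omega>) + a' ((b - b') \<Omega>)"
    by (simp add: blinfun.diff_left blinfun.diff_right)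
  then have "norm (a (b \<Omega>) - a' (b' \<Omega>)) \<le> norm ((a - a') (b \<Omega>)) + norm (a' ((b - b') \<Omega>))"
    by (simp only: norm_triangle_ineq)
  also have "\<dots> = norm ((a - a') \<Omega>) * norm (b \<Omega>) + norm (a' \<Omega>) * norm ((b - b') \<Omega>)"
    by (simp only: norm_product[OF R.chir_local_diff[OF a] b(1)] norm_product[OF a(2) L.chir_local_diff[OF b]])
  finally show ?thesis
    by (simp add: blinfun.diff_left)
qed

text \<open>The limit of the products depends only on the limits of the single-field vectors, which
  makes collision states independent of the approximating operators.\<close>

lemma product_limit:
  assumes a: "\<And>n. a n \<in> R.chir_local" "(\<lambda>n. a n \<Omega>) \<longlonglongrightarrow> \<xi>"
    and b: "\<And>n. b n \<in> L.chir_local" "(\<lambda>n. b n \<Omega>) \<longlonglongrightarrow> \<eta>"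
    and a': "\<And>n. a' n \<in> R.chir_local" "(\<lambda>n. a' n \<Omega>) \<longlonglongrightarrow> \<xi>"
    and b': "\<And>n. b' n \<in> L.chir_local" "(\<lambda>n. b' n \<Omega>) \<longlonglongrightarrow> \<eta>"
    and \<zeta>: "(\<lambda>n. a n (b n \<Omega>)) \<longlonglongrightarrow> \<zeta>"
  shows "(\<lambda>n. a' n (b' n \<Omega>)) \<longlonglongrightarrow> \<zeta>"
proof -
  have "(\<lambda>n. norm (a' n \<Omega> - a n \<Omega>) * norm (b' n \<Omega>) + norm (a n \<Omega>) * norm (b' n \<Omega> - b n \<Omega>))
      \<longlonglongrightarrow> norm (\<xi> - \<xi>) * norm \<eta> + norm \<xi> * norm (\<eta> - \<eta>)"
    by (intro tendsto_add tendsto_mult tendsto_norm tendsto_diff a b a' b')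
  then have "(\<lambda>n. norm (a' n \<Omega> - a n \<Omega>) * norm (b' n \<Omega>) + norm (a n \<Omega>) * norm (b' n \<Omega> - b n \<Omega>)) \<longlonglongrightarrow> 0"
    by simp
  then have "(\<lambda>n. a' n (b' n \<Omega>) - a n (b n \<Omega>)) \<longlonglongrightarrow> 0"
    by (rule Lim_null_comparison[OF always_eventually[OF allI], rotated])
       (rule norm_product_diff[OF a'(1) a(1) b'(1) b(1)])
  from tendsto_add[OF this \<zeta>] show ?thesis
    by simp
qed

lemma product_convergent:
  assumes a: "\<And>n::nat. a n \<in> R.chir_local" "(\<lambda>n. a n \<Omega>) \<longlonglongrightarrow> \<xi>"
    and b: "\<And>n. b n \<in> L.chir_local" "(\<lambda>n. b n \<Omega>) \<longlonglongrightarrow> \<eta>"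
  shows "convergent (\<lambda>n. a n (b n \<Omega>))"
proof -
  have "Bseq (\<lambda>n. a n \<Omega>)" "Bseq (\<lambda>n. b n \<Omega>)"
    using a(2) b(2) by (auto intro!: convergent_imp_Bseq convergentI)
  then obtain Ka Kb where K: "Ka > 0" "\<And>n. norm (a n \<Omega>) \<le> Ka" "Kb > 0" "\<And>n. norm (b n \<Omega>) \<le> Kb"
    by (auto elim!: BseqE)
  have "Cauchy (\<lambda>n. a n (b n \<Omega>))"
  proof (rule metric_CauchyI)
    fix e :: real assume "e > 0"
    define d where "d = e / (Ka + Kb)"
    have "d * (Ka + Kb) = e"
      using K by (simp add: d_def)
    moreover have "d * Kb + Ka * d = d * (Ka + Kb)"
      by (simp add: algebra_simps)
    ultimately have d: "d > 0" "d * Kb + Ka * d = e"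
      using \<open>e > 0\<close> K by (auto simp: d_def)
    obtain N1 where N1: "\<And>m n. m \<ge> N1 \<Longrightarrow> n \<ge> N1 \<Longrightarrow> dist (a m \<Omega>) (a n \<Omega>) < d"
      using metric_CauchyD[OF LIMSEQ_imp_Cauchy[OF a(2)] d(1)] by blast
    obtain N2 where N2: "\<And>m n. m \<ge> N2 \<Longrightarrow> n \<ge> N2 \<Longrightarrow> dist (b m \<Omega>) (b n \<Omega>) < d"
      using metric_CauchyD[OF LIMSEQ_imp_Cauchy[OF b(2)] d(1)] by blast
    have "dist (a m (b m \<Omega>)) (a n (b n \<Omega>)) < e" if "m \<ge> max N1 N2" "n \<ge> max N1 N2" for m n
    proof -
      have 1: "norm (a m \<Omega> - a n \<Omega>) < d" "norm (b m \<Omega> - b n \<Omega>) < d"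
        using N1[of m n] N2[of m n] that by (simp_all add: dist_norm)
      have "norm (a m (b m \<Omega>) - a n (b n \<Omega>))
          \<le> norm (a m \<Omega> - a n \<Omega>) * norm (b m \<Omega>) + norm (a n \<Omega>) * norm (b m \<Omega> - b n \<Omega>)"
        by (rule norm_product_diff[OF a(1) a(1) b(1) b(1)])
      also have "\<dots> \<le> norm (a m \<Omega> - a n \<Omega>) * Kb + Ka * norm (b m \<Omega> - b n \<Omega>)"
        using K by (intro add_mono mult_left_mono mult_right_mono) auto
      also have "\<dots> < d * Kb + Ka * d"
        using 1 K by (intro add_strict_mono mult_strict_left_mono mult_strict_right_mono) auto
      finally show ?thesis
        using d(2) by (simp add: dist_norm)
    qed
    then show "\<exists>M. \<forall>m\<ge>M. \<forall>n\<ge>M. dist (a m (b m \<Omega>)) (a n (b n \<Omega>)) < e"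
      by blast
  qed
  then show ?thesis
    by (rule Cauchy_convergent)
qed

section \<open>Asymptotic fields and collision states of the net\<close>

lemma sign_filter:
  assumes "F = at_top \<or> F = (at_bot :: real filter)"
  obtains \<sigma> where "\<sigma> = 1 \<or> \<sigma> = (- 1 :: real)" "\<And>(f :: real \<Rightarrow> 'h) l. ((\<lambda>S. f (\<sigma> * S)) \<longlongrightarrow> l) at_top \<Longrightarrow> (f \<longlongrightarrow> l) F"
  using assms
proof
  assume "F = at_top"
  then show ?thesis
    using that[of 1] by simp
next
  assume "F = at_bot"
  then show ?thesis
    using that[of "- 1"] by (simp add: filterlim_at_bot_mirror)
qed

lemma
  assumes h: "wave_profile h" "0 < \<epsilon>" "\<epsilon> < 1" and F: "F = at_top \<or> F = at_bot"
    and I: "bounded_interval I" and J: "bounded_interval J" and x: "x \<in> A (double_cone I J)"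
  shows asymptotic_field_R:
      "\<lbrakk>y \<in> R.chir I J; y \<Omega> = orth_proj R.W_fixed (x \<Omega>)\<rbrakk> \<Longrightarrow> asymptotic_field U h \<epsilon> F 1 x \<xi> = y \<xi>"
    and asymptotic_field_L:
      "\<lbrakk>y \<in> L.chir J I; y \<Omega> = orth_proj L.W_fixed (x \<Omega>)\<rbrakk> \<Longrightarrow> asymptotic_field U h \<epsilon> F (- 1) x \<xi> = y \<xi>"
proof -
  obtain \<sigma> where \<sigma>: "\<sigma> = 1 \<or> \<sigma> = (- 1 :: real)"
    and lim: "\<And>(f :: real \<Rightarrow> 'h) l. ((\<lambda>S. f (\<sigma> * S)) \<longlongrightarrow> l) at_top \<Longrightarrow> (f \<longlongrightarrow> l) F"
    using sign_filter[OF F] by blast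
  have "F \<noteq> bot"
    using F trivial_limit_at_top_linorder trivial_limit_at_bot_linorder by metis
  note Lim = tendsto_Lim[OF this lim]
  show "asymptotic_field U h \<epsilon> F 1 x \<xi> = y \<xi>"
    if "y \<in> R.chir I J" "y \<Omega> = orth_proj R.W_fixed (x \<Omega>)"
    unfolding asymptotic_field_def
    by (rule Lim) (use R.asymptotic_limit[OF h \<sigma> I J x that] in \<open>simp add: smeared_op_def V_translation_R\<close>)
  show "asymptotic_field U h \<epsilon> F (- 1) x \<xi> = y \<xi>"
    if "y \<in> L.chir J I" "y \<Omega> = orth_proj L.W_fixed (x \<Omega>)"
    unfolding asymptotic_field_def
    by (rule Lim) (use L.asymptotic_limit[OF h \<sigma> J I x that] in \<open>simp add: smeared_op_def V_translation_L\<close>)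
qed

lemma local_op_double_cone:
  assumes "local_op A x"
  obtains I where "bounded_interval I" "x \<in> A (double_cone I I)"
proof -
  obtain R where R: "open R" "bounded R" "x \<in> A R"
    using assms by (auto simp: local_op_def)
  obtain I where I: "bounded_interval I" "R \<subseteq> double_cone I I"
    using bounded_double_cone_cover[OF R(2)] .
  then show ?thesis
    using that isotony[OF R(1,2) double_cone_interval[OF I(1) I(1)] I(2)] R(3) by blast
qed

text \<open>\<open>collision_state\<close> is a definite description. Existence: chiral fields are
  their own asymptotic fields, so the given sequences are admissible. Uniqueness: asymptotic fields
  of arbitrary local operators are again chiral, so \<open>product_limit\<close> compares any two
  choices.\<close>

lemma collision_state_limit:
  assumes h: "wave_profile h" "0 < \<epsilon>" "\<epsilon> < 1" and F: "F = at_top \<or> F = at_bot"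
    and a: "\<And>n. a n \<in> R.chir_local" "(\<lambda>n. a n \<Omega>) \<longlonglongrightarrow> \<xi>"
    and b: "\<And>n. b n \<in> L.chir_local" "(\<lambda>n. b n \<Omega>) \<longlonglongrightarrow> \<eta>"
  shows "(\<lambda>n. a n (b n \<Omega>)) \<longlonglongrightarrow> collision_state A U \<Omega> h \<epsilon> F \<xi> \<eta>"
proof -
  obtain \<zeta> where \<zeta>: "(\<lambda>n. a n (b n \<Omega>)) \<longlonglongrightarrow> \<zeta>"
    using product_convergent[OF a b] by (auto simp: convergent_def)
  have "collision_state A U \<Omega> h \<epsilon> F \<xi> \<eta> = \<zeta>"
    unfolding collision_state_def
  proof (rule the_equality)
    have aw: "a n \<Omega> \<in> R.W_fixed" "local_op A (a n)" "asymptotic_field U h \<epsilon> F 1 (a n) \<theta> = a n \<theta>" for n \<theta>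
    proof -
      obtain I J where I: "bounded_interval I" and J: "bounded_interval J" and aI: "a n \<in> R.chir I J"
        using a(1)[of n] by (auto simp: R.chir_local_def)
      show w: "a n \<Omega> \<in> R.W_fixed"
        by (rule R.chir_wave[OF aI])
      have A: "a n \<in> A (double_cone I J)"
        using aI R.chir_subset by blast
      then show "local_op A (a n)"
        using double_cone_interval[OF I J] by (auto simp: local_op_def)
      show "asymptotic_field U h \<epsilon> F 1 (a n) \<theta> = a n \<theta>"
        by (rule asymptotic_field_R[OF h F I J A aI]) (simp add: orth_proj_fixed[OF R.csubspace_W_fixed w])
    qed
    have bw: "b n \<Omega> \<in> L.W_fixed" "local_op A (b n)" "asymptotic_field U h \<epsilon> F (- 1) (b n) \<theta> = b n \<theta>" for n \<theta>
    proof -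
      obtain I J where I: "bounded_interval I" and J: "bounded_interval J" and bJ: "b n \<in> L.chir J I"
        using b(1)[of n] by (auto simp: L.chir_local_def)
      show w: "b n \<Omega> \<in> L.W_fixed"
        by (rule L.chir_wave[OF bJ])
      have A: "b n \<in> A (double_cone I J)"
        using bJ L.chir_subset by blast
      then show "local_op A (b n)"
        using double_cone_interval[OF I J] by (auto simp: local_op_def)
      show "asymptotic_field U h \<epsilon> F (- 1) (b n) \<theta> = b n \<theta>"
        by (rule asymptotic_field_L[OF h F I J A bJ]) (simp add: orth_proj_fixed[OF L.csubspace_W_fixed w])
    qed
    have "approximating_ops A U \<Omega> 1 \<xi> a"
      using a(2) aw by (simp add: approximating_ops_def wave_space_R[symmetric] orth_proj_fixed[OF R.csubspace_W_fixed])
    moreover have "approximating_ops A U \<Omega> (- 1) \<eta> b"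
      using b(2) bw by (simp add: approximating_ops_def wave_space_L[symmetric] orth_proj_fixed[OF L.csubspace_W_fixed])
    moreover have "(\<lambda>n. asymptotic_field U h \<epsilon> F 1 (a n) (asymptotic_field U h \<epsilon> F (- 1) (b n) \<Omega>)) \<longlonglongrightarrow> \<zeta>"
      using \<zeta> by (simp add: aw bw)
    ultimately show "\<exists>x y. approximating_ops A U \<Omega> 1 \<xi> x \<and> approximating_ops A U \<Omega> (- 1) \<eta> y \<and>
        (\<lambda>n. asymptotic_field U h \<epsilon> F 1 (x n) (asymptotic_field U h \<epsilon> F (- 1) (y n) \<Omega>)) \<longlonglongrightarrow> \<zeta>"
      by blast
  next
    fix \<zeta>'
    assume "\<exists>x y. approximating_ops A U \<Omega> 1 \<xi> x \<and> approximating_ops A U \<Omega> (- 1) \<eta> y \<and>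
        (\<lambda>n. asymptotic_field U h \<epsilon> F 1 (x n) (asymptotic_field U h \<epsilon> F (- 1) (y n) \<Omega>)) \<longlonglongrightarrow> \<zeta>'"
    then obtain x y where x: "\<And>n. local_op A (x n)" "(\<lambda>n. orth_proj R.W_fixed (x n \<Omega>)) \<longlonglongrightarrow> \<xi>"
      and y: "\<And>n. local_op A (y n)" "(\<lambda>n. orth_proj L.W_fixed (y n \<Omega>)) \<longlonglongrightarrow> \<eta>"
      and \<zeta>': "(\<lambda>n. asymptotic_field U h \<epsilon> F 1 (x n) (asymptotic_field U h \<epsilon> F (- 1) (y n) \<Omega>)) \<longlonglongrightarrow> \<zeta>'"
      by (auto simp: approximating_ops_def wave_space_R[symmetric] wave_space_L[symmetric])
    have "\<exists>a\<in>R.chir_local. a \<Omega> = orth_proj R.W_fixed (x n \<Omega>) \<and> (\<forall>\<theta>. asymptotic_field U h \<epsilon> F 1 (x n) \<theta> = a \<theta>)" for n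
    proof -
      obtain I where I: "bounded_interval I" "x n \<in> A (double_cone I I)"
        using local_op_double_cone[OF x(1)] .
      obtain a where a: "a \<in> R.chir I I" "a \<Omega> = orth_proj R.W_fixed (x n \<Omega>)"
        using R.chiral_projection[OF I(1) I(1) I(2)] .
      then show ?thesis
        using asymptotic_field_R[OF h F I(1) I(1) I(2)] R.chir_localI[OF I(1) I(1)] by blast
    qed
    then obtain a' where a': "\<And>n. a' n \<in> R.chir_local" "\<And>n. a' n \<Omega> = orth_proj R.W_fixed (x n \<Omega>)"
        "\<And>n \<theta>. asymptotic_field U h \<epsilon> F 1 (x n) \<theta> = a' n \<theta>"
      by metis
    have "\<exists>b\<in>L.chir_local. b \<Omega> = orth_proj L.W_fixed (y n \<Omega>) \<and> (\<forall>\<theta>. asymptotic_field U h \<epsilon> F (- 1) (y n) \<theta> = b \<theta>)" for n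
    proof -
      obtain I where I: "bounded_interval I" "y n \<in> A (double_cone I I)"
        using local_op_double_cone[OF y(1)] .
      obtain b where b: "b \<in> L.chir I I" "b \<Omega> = orth_proj L.W_fixed (y n \<Omega>)"
        using L.chiral_projection[OF I(1) I(1) I(2)] .
      then show ?thesis
        using asymptotic_field_L[OF h F I(1) I(1) I(2)] L.chir_localI[OF I(1) I(1)] by blast
    qed
    then obtain b' where b': "\<And>n. b' n \<in> L.chir_local" "\<And>n. b' n \<Omega> = orth_proj L.W_fixed (y n \<Omega>)"
        "\<And>n \<theta>. asymptotic_field U h \<epsilon> F (- 1) (y n) \<theta> = b' n \<theta>"
      by metis
    have "(\<lambda>n. a' n (b' n \<Omega>)) \<longlonglongrightarrow> \<zeta>"
      by (rule product_limit[OF a b a'(1) _ b'(1) _ \<zeta>]) (simp_all add: a'(2) b'(2) x(2) y(2))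
    moreover have "(\<lambda>n. a' n (b' n \<Omega>)) \<longlonglongrightarrow> \<zeta>'"
      using \<zeta>' by (simp add: a'(3) b'(3))
    ultimately show "\<zeta>' = \<zeta>"
      using LIMSEQ_unique by blast
  qed
  then show ?thesis
    using \<zeta> by simp
qed

text \<open>One choice of intervals suffices because its chiral fields already create a dense set of
  wave vectors. Conversely each product vector is itself a collision state, with constant
  approximating sequences.\<close>

lemma collision_space_eq:
  assumes h: "wave_profile h" "0 < \<epsilon>" "\<epsilon> < 1" and F: "F = at_top \<or> F = at_bot"
    and I: "bounded_interval I" and J: "bounded_interval J"
    and I': "bounded_interval I'" and J': "bounded_interval J'"
  shows "collision_space A U \<Omega> h \<epsilon> F
    = closed_cspan {blinfun_apply a (blinfun_apply b \<Omega>) | a b. a \<in> R.chir I J' \<and> b \<in> L.chir J I'}"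
    (is "_ = closed_cspan ?K")
proof
  have loc: "a \<in> R.chir I J' \<Longrightarrow> a \<in> R.chir_local" "b \<in> L.chir J I' \<Longrightarrow> b \<in> L.chir_local" for a b
    using R.chir_localI[OF I J'] L.chir_localI[OF J I'] by blast+
  show "collision_space A U \<Omega> h \<epsilon> F \<subseteq> closed_cspan ?K"
    unfolding collision_space_def
  proof (rule closed_cspan_minimal[OF csubspace_closed_cspan closed_closed_cspan], safe)
    fix \<xi> \<eta> assume "\<xi> \<in> wave_space U 1" "\<eta> \<in> wave_space U (- 1)"
    then have \<xi>: "\<xi> \<in> R.W_fixed" and \<eta>: "\<eta> \<in> L.W_fixed"
      by (simp_all add: wave_space_R wave_space_L)
    obtain a where a: "\<And>n::nat. a n \<in> R.chir I J'" "(\<lambda>n. a n \<Omega>) \<longlonglongrightarrow> \<xi>"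
      using R.chir_dense[OF I J' \<xi>] by blast
    obtain b where b: "\<And>n::nat. b n \<in> L.chir J I'" "(\<lambda>n. b n \<Omega>) \<longlonglongrightarrow> \<eta>"
      using L.chir_dense[OF J I' \<eta>] by blast
    have lim: "(\<lambda>n. a n (b n \<Omega>)) \<longlonglongrightarrow> collision_state A U \<Omega> h \<epsilon> F \<xi> \<eta>"
      by (rule collision_state_limit[OF h F loc(1)[OF a(1)] a(2) loc(2)[OF b(1)] b(2)])
    have "a n (b n \<Omega>) \<in> closed_cspan ?K" for n
      using a(1) b(1) by (intro subsetD[OF closed_cspan_superset]) blast
    then show "collision_state A U \<Omega> h \<epsilon> F \<xi> \<eta> \<in> closed_cspan ?K"
      using closed_sequentially[OF closed_closed_cspan _ lim] by blast
  qed
  show "closed_cspan ?K \<subseteq> collision_space A U \<Omega> h \<epsilon> F"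
    unfolding collision_space_def
  proof (rule closed_cspan_minimal[OF csubspace_closed_cspan closed_closed_cspan], safe)
    fix a b assume a: "a \<in> R.chir I J'" and b: "b \<in> L.chir J I'"
    have "(\<lambda>n::nat. a (b \<Omega>)) \<longlonglongrightarrow> collision_state A U \<Omega> h \<epsilon> F (a \<Omega>) (b \<Omega>)"
      by (rule collision_state_limit[OF h F loc(1)[OF a] tendsto_const loc(2)[OF b] tendsto_const])
    then have "a (b \<Omega>) = collision_state A U \<Omega> h \<epsilon> F (a \<Omega>) (b \<Omega>)"
      by (simp add: LIMSEQ_const_iff)
    moreover have "a \<Omega> \<in> wave_space U 1" "b \<Omega> \<in> wave_space U (- 1)"
      using R.chir_wave[OF a] L.chir_wave[OF b] by (simp_all add: wave_space_R wave_space_L)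
    ultimately show "a (b \<Omega>) \<in> closed_cspan {collision_state A U \<Omega> h \<epsilon> F \<xi>p \<xi>m | \<xi>p \<xi>m.
        \<xi>p \<in> wave_space U 1 \<and> \<xi>m \<in> wave_space U (- 1)}"
      by (intro subsetD[OF closed_cspan_superset]) blast
  qed
qed

text \<open>The span of the product vectors is stable under fields of both kinds, because they
  commute past each other. Its projection therefore commutes with the generated algebra, and the
  span contains \<open>\<Omega>\<close>.\<close>

lemma chiral_space_eq:
  assumes I: "bounded_interval I" and J: "bounded_interval J"
    and I': "bounded_interval I'" and J': "bounded_interval J'"
  shows "closed_cspan {blinfun_apply a (blinfun_apply b \<Omega>) | a b. a \<in> R.chir I J' \<and> b \<in> L.chir J I'}
    = closure ((\<lambda>x. blinfun_apply x \<Omega>) ` vN_generated (R.chir I J' \<union> L.chir J I'))"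
    (is "closed_cspan ?K = closure (_ ` vN_generated ?S)")
proof
  have S: "?S \<subseteq> clinear_ops" "\<And>x. x \<in> ?S \<Longrightarrow> adj x \<in> ?S"
    using R.chir_clinear[OF I J'] L.chir_clinear[OF J I'] R.chir_adj[OF I J'] L.chir_adj[OF J I'] by blast+
  note N = vN_generated_vN[OF S] and sup = vN_generated_superset[of ?S]
  show "closed_cspan ?K \<subseteq> closure ((\<lambda>x. blinfun_apply x \<Omega>) ` vN_generated ?S)"
  proof (rule closed_cspan_minimal)
    show "csubspace (closure ((\<lambda>x. blinfun_apply x \<Omega>) ` vN_generated ?S))"
      by (intro csubspace_closure csubspace_orbit N)
    show "?K \<subseteq> closure ((\<lambda>x. blinfun_apply x \<Omega>) ` vN_generated ?S)"
    proof (rule order_trans[OF _ closure_subset], safe)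
      fix a b assume "a \<in> R.chir I J'" "b \<in> L.chir J I'"
      then have "a o\<^sub>L b \<in> vN_generated ?S"
        using sup by (intro N(1)) auto
      then show "a (b \<Omega>) \<in> (\<lambda>x. blinfun_apply x \<Omega>) ` vN_generated ?S"
        by (intro image_eqI[of _ _ "a o\<^sub>L b"]) simp_all
    qed
  qed simp
  let ?M = "closed_cspan ?K"
  have M: "csubspace ?M" "closed ?M"
    by (rule csubspace_closed_cspan closed_closed_cspan)+
  have inv: "x \<xi> \<in> ?M" if x: "x \<in> ?S" and \<xi>: "\<xi> \<in> ?M" for x \<xi>
  proof -
    have "?M \<subseteq> {\<xi>. x \<xi> \<in> ?M}"
    proof (rule closed_cspan_minimal)
      show "csubspace {\<xi>. x \<xi> \<in> ?M}"
        using M(1) S(1) x unfolding csubspace_def clinear_ops_def by (auto simp: blinfun.add_right subset_iff)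
      show "closed {\<xi>. x \<xi> \<in> ?M}"
        by (rule closed_blinfun_vimage[OF M(2)])
      show "?K \<subseteq> {\<xi>. x \<xi> \<in> ?M}"
      proof safe
        fix a b assume a: "a \<in> R.chir I J'" and b: "b \<in> L.chir J I'"
        show "x (a (b \<Omega>)) \<in> ?M"
        proof (cases "x \<in> R.chir I J'")
          case True
          have "(x o\<^sub>L a) (b \<Omega>) \<in> ?M"
            using R.chir_compose[OF I J' True a] b by (intro subsetD[OF closed_cspan_superset]) blast
          then show ?thesis
            by simp
        next
          case False
          then have xL: "x \<in> L.chir J I'"
            using x by blast
          have "a o\<^sub>L x = x o\<^sub>L a"
            by (rule chiral_fields_commute[OF R.chir_localI[OF I J' a] L.chir_localI[OF J I' xL]])
          then have "x (a (b \<Omega>)) = a ((x o\<^sub>L b) \<Omega>)"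
            by (metis blinfun_apply_blinfun_compose)
          moreover have "a ((x o\<^sub>L b) \<Omega>) \<in> ?M"
            using L.chir_compose[OF J I' xL b] a by (intro subsetD[OF closed_cspan_superset]) blast
          ultimately show ?thesis
            by simp
        qed
      qed
    qed
    then show ?thesis
      using \<xi> by blast
  qed
  have P: "proj_op ?M \<in> commutant ?S"
  proof -
    have "x o\<^sub>L proj_op ?M = proj_op ?M o\<^sub>L x" if "x \<in> ?S" for x
      using that S by (intro proj_op_commutes[OF M] inv) auto
    then show ?thesis
      by (simp add: commutant_def proj_op_clinear[OF M])
  qed
  have \<Omega>: "\<Omega> \<in> ?M"
  proof -
    have "id_blinfun (id_blinfun \<Omega>) \<in> ?M"
      using R.chir_id[OF I J'] L.chir_id[OF J I'] by (intro subsetD[OF closed_cspan_superset]) blast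
    then show ?thesis
      by simp
  qed
  have "n \<Omega> \<in> ?M" if "n \<in> vN_generated ?S" for n
  proof -
    have "n o\<^sub>L proj_op ?M = proj_op ?M o\<^sub>L n"
      by (rule vN_generated_commutes[OF S P that])
    from arg_cong[OF this, of "\<lambda>x. blinfun_apply x \<Omega>"]
    have "n (proj_op ?M \<Omega>) = proj_op ?M (n \<Omega>)"
      by simp
    then show ?thesis
      using orth_proj_in[OF M, of "n \<Omega>"]
      by (simp only: proj_op_apply[OF M] orth_proj_fixed[OF M(1) \<Omega>])
  qed
  then show "closure ((\<lambda>x. blinfun_apply x \<Omega>) ` vN_generated ?S) \<subseteq> ?M"
    by (intro closure_minimal M(2)) auto
qed

lemma collision_space_chiral:
  assumes "wave_profile h" "0 < \<epsilon>" "\<epsilon> < 1" "F = at_top \<or> F = at_bot"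
    and "bounded_interval I" "bounded_interval J" "bounded_interval I'" "bounded_interval J'"
  shows "collision_space A U \<Omega> h \<epsilon> F
    = closure ((\<lambda>x. blinfun_apply x \<Omega>) ` vN_generated (chiral_L A V J' I \<union> chiral_R A V I' J))"
  using collision_space_eq[OF assms] unfolding chiral_space_eq[OF assms(5-8)]
  by (simp only: R_chir L_chir)

end

theorem theorem4p5:
  fixes A :: "(real \<times> real) set \<Rightarrow> ('h::separable_hilbert \<Rightarrow>\<^sub>L 'h) set"
    and U :: "(real \<times> real \<Rightarrow> real \<times> real) \<Rightarrow> ('h \<Rightarrow>\<^sub>L 'h)"
    and V :: "mobius2 \<Rightarrow> ('h \<Rightarrow>\<^sub>L 'h)"
    and \<Omega> :: 'h
    and h :: "real \<Rightarrow> real" and \<epsilon> :: real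
    and I J I' J' :: "real set"
  assumes "mobius_covariant_net A U \<Omega> V"
    and "0 < \<epsilon>" "\<epsilon> < 1" "wave_profile h"
    and "bounded_interval I" "bounded_interval J"
    and "bounded_interval I'" "bounded_interval J'"
  shows "out_space A U \<Omega> h \<epsilon> = in_space A U \<Omega> h \<epsilon> \<and>
         in_space A U \<Omega> h \<epsilon> =
           closure ((\<lambda>x. blinfun_apply x \<Omega>) ` vN_generated (chiral_L A V J' I \<union> chiral_R A V I' J))"
proof -
  interpret mobius_covariant_net A U \<Omega> V
    by fact
  \<comment> \<open>The right-hand side does not mention the filter, so the outgoing and the
    incoming case yield the same set.\<close>
  note eq = collision_space_chiral[OF assms(4,2,3) _ assms(5-8)]
  show ?thesis
    using eq[of at_top] eq[of at_bot] by simp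
qed

end
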